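(* Let $\rho\in\mathbb{Y}$ satisfy $\|\rho\|_{\mathbb{Y}}>\|y^*\|_{\mathbb{Y}}$, let $q\in[1,\infty]$ and let $i\in\{1,\dots,d\}$. Then there are positive constants $\delta_{0,\nu}$, $r$ (depending on $\rho$) and $c_4(y^*,\nu,f_i,r)$, not depending on the mesh, such that for every mesh $\mathbb{T}_N$ with fill-distance $\delta<\delta_{0,\nu}$, the kernel interpolant (MAP estimate) $$\hat y\in\mathop{\arg\min}_{y\in\mathcal{I}_N}\tfrac12\|y\|_{\mathbb{Y}}^2$$ satisfies $$|\mathcal{E}_i[\hat y]|_{H_q^0}\le \delta^{\nu}\,T^{1/q}\,c_4(y^*,\nu,f_i,r)\,\|y^*\|_{\mathbb{Y}},$$ $$|\mathcal{E}_i[\hat y]|_{H_q^m}\le \delta^{\nu+1-m-(1/2-1/q)_+}\,c_4(y^*,\nu,f_i,r)\,\|y^*\|_{\mathbb{Y}},\qquad m=1,\dots,\nu.$$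
   Context: Let $0<T<\infty$, $\mathbb{T}=[0,T]$, $d\ge1$, $y_0\in\mathbb{R}^d$, and let $\nu\ge 1$ be a fixed integer. Consider the ODE $Dy(t)=f(t,y(t))$, $y(0)=y_0$, where $D$ is the time derivative. Standing assumptions. (1) $f\in C^{\alpha+1}(\tilde{\mathbb{T}}\times\mathbb{R}^d,\mathbb{R}^d)$ for some $\alpha\ge\nu$ and some set $\tilde{\mathbb{T}}$ with $\mathbb{T}\subset\tilde{\mathbb{T}}\subset\mathbb{R}$. (2) $T<T^*$, where $T^*>0$ is such that the ODE admits a unique solution $y^*\in C^{\alpha+1}([0,T^* ),\mathbb{R}^d)$ (such $T^*$ exists by classical theory). The restriction of this solution to $\mathbb{T}$ is also denoted $y^*$; it belongs to the space $\mathbb{Y}$ below. The space $\mathbb{Y}=\mathbb{Y}^{\nu+1}$ (the RKHS of the prior) is the set of $y:\mathbb{T}\to\mathbb{R}^d$ such that $D^my$ is absolutely continuous for $m=0,\dots,\nu$ and $D^{\nu+1}y\in\mathcal{L}_2(\mathbb{T},\mathbb{R}^d)$, with inner product $$\langle y,y'\rangle_{\mathbb{Y}}=\vec y_0^{\,\top}\Sigma(t_0^-)^{-1}\vec y_0^{\,\prime}+\int_0^T(\mathcal{A}y)(\tau)^\top(\mathcal{A}y')(\tau)\,d\tau,$$ where $\vec y_0\in\mathbb{R}^{d(\nu+1)}$ stacks $y(0),Dy(0),\dots,D^\nu y(0)$ (and $\vec y_0^{\,\prime}$ does so for $y'$), $\Sigma(t_0^-)$ is a fixed positive definite matrix of size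 $d(\nu+1)$, and $\mathcal{A}=\Gamma^{-1/2}\big(\mathrm{I}_dD^{\nu+1}-\sum_{m=0}^\nu F_mD^m\big)$ with fixed $F_m\in\mathbb{R}^{d\times d}$ and positive definite $\Gamma\in\mathbb{R}^{d\times d}$. A mesh is $\mathbb{T}_N=\{t_n\}_{n=0}^N$ with $0=t_0<t_1<\dots<t_N=T$; its fill-distance is $\delta=\sup_{t\in\mathbb{T}}\min_{0\le n\le N}|t-t_n|$. The information operator is $\mathcal{Z}[y](t)=Dy(t)-f(t,y(t))$, and the feasible set is $$\mathcal{I}_N=\{y\in\mathbb{Y}: y(0)=y_0,\ \dot y(0)=f(0,y_0)\}\cap\{y\in\mathbb{Y}:\mathcal{Z}[y](t)=0,\ t\in\mathbb{T}_N\}.$$ The error operator is $\mathcal{E}[y](t)=\int_0^t\mathcal{Z}[y](\tau)\,d\tau$, and $\mathcal{E}_i$ is its $i$th coordinate; $f_i$ is the $i$th coordinate of $f$. For scalar functions $u$ on $\mathbb{T}$, $|u|_{H_q^m}=\|D^mu\|_{\mathcal{L}_q(\mathbb{T},\mathbb{R})}$ (so $|u|_{H_q^0}=\|u\|_{\mathcal{L}_q}$). Also $(a)_+=\max(a,0)$, and $1/q=0$ if $q=\infty$. The arguments in $c_4(y^*,\nu,f_i,r)$ indicate dependence of the constant. *)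

theory Defs
  imports "HOL-Analysis.Analysis" "HOL-Probability.Essential_Supremum"
begin

section \<open>Regularity of functions\<close>

text \<open>
  Derivatives are taken within \<open>S\<close>, hence are one-sided at the end points of an interval. The
  derivative is existentially quantified because it need not be unique when \<open>S\<close> has isolated
  points; requiring every directional derivative to be of class \<open>k\<close> is, in finite dimension, the
  same as requiring the derivative to be a map of class \<open>k\<close> into the space of linear maps.
\<close>

primrec Ck_on :: "nat \<Rightarrow> 'a::euclidean_space set \<Rightarrow> ('a \<Rightarrow> 'b::real_normed_vector) \<Rightarrow> bool" where
  "Ck_on 0 S f \<longleftrightarrow> continuous_on S f"
| "Ck_on (Suc k) S f \<longleftrightarrow>
     (\<exists>f'. (\<forall>x\<in>S. (f has_derivative f' x) (at x within S)) \<and> (\<forall>v. Ck_on k S (\<lambda>x. f' x v)))"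

primrec Dn :: "real set \<Rightarrow> nat \<Rightarrow> (real \<Rightarrow> 'b::real_normed_vector) \<Rightarrow> real \<Rightarrow> 'b" where
  "Dn S 0 y = y"
| "Dn S (Suc m) y = (\<lambda>t. vector_derivative (Dn S m y) (at t within S))"

definition abs_continuous_on :: "real set \<Rightarrow> (real \<Rightarrow> 'b::real_normed_vector) \<Rightarrow> bool" where
  "abs_continuous_on S g \<longleftrightarrow>
     (\<forall>\<epsilon>>0. \<exists>\<delta>>0. \<forall>\<D> X. \<D> division_of X \<and> X \<subseteq> S \<and> (\<Sum>K\<in>\<D>. Sup K - Inf K) < \<delta> \<longrightarrow>
        (\<Sum>K\<in>\<D>. norm (g (Sup K) - g (Inf K))) < \<epsilon>)"

definition L2_on :: "real set \<Rightarrow> (real \<Rightarrow> 'b::euclidean_space) \<Rightarrow> bool" where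
  "L2_on S g \<longleftrightarrow> g \<in> borel_measurable (lebesgue_on S) \<and>
     integrable (lebesgue_on S) (\<lambda>t. (norm (g t))\<^sup>2)"


section \<open>Matrices\<close>

definition pos_def :: "real ^ 'n ^ 'n \<Rightarrow> bool" where
  "pos_def A \<longleftrightarrow> transpose A = A \<and> (\<forall>x. x \<noteq> 0 \<longrightarrow> 0 < x \<bullet> (A *v x))"

definition inv_sqrt :: "real ^ 'n ^ 'n \<Rightarrow> real ^ 'n ^ 'n" where
  "inv_sqrt A = (SOME S. pos_def S \<and> S ** S = matrix_inv A)"

text \<open>Square matrices whose rows and columns are indexed by a finite set \<open>I\<close>.\<close>

definition pos_def_on :: "'a set \<Rightarrow> ('a \<Rightarrow> 'a \<Rightarrow> real) \<Rightarrow> bool" where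
  "pos_def_on I A \<longleftrightarrow> (\<forall>a\<in>I. \<forall>b\<in>I. A a b = A b a) \<and>
     (\<forall>x. (\<exists>a\<in>I. x a \<noteq> 0) \<longrightarrow> 0 < (\<Sum>a\<in>I. \<Sum>b\<in>I. x a * A a b * x b))"

definition mat_inv_on :: "'a set \<Rightarrow> ('a \<Rightarrow> 'a \<Rightarrow> real) \<Rightarrow> 'a \<Rightarrow> 'a \<Rightarrow> real" where
  "mat_inv_on I A = (SOME B. \<forall>a\<in>I. \<forall>b\<in>I.
     (\<Sum>c\<in>I. A a c * B c b) = (if a = b then 1 else 0) \<and>
     (\<Sum>c\<in>I. B a c * A c b) = (if a = b then 1 else 0))"


section \<open>The reproducing kernel Hilbert space of the prior\<close>

text \<open>
  Functions on \<open>[0,T]\<close> are represented by total functions, of which only the values on \<open>[0,T]\<close>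
  matter. \<open>D\<^sup>\<nu>\<^sup>+\<^sup>1 y\<close> exists only almost everywhere; the value of \<^const>\<open>Dn\<close> on the exceptional
  null set is irrelevant.
\<close>

definition Yspace :: "real \<Rightarrow> nat \<Rightarrow> (real \<Rightarrow> real ^ 'd) set" where
  "Yspace T \<nu> = {y.
     (\<forall>m<\<nu>. \<forall>t\<in>{0..T}. Dn {0..T} m y differentiable (at t within {0..T})) \<and>
     (\<forall>m\<le>\<nu>. abs_continuous_on {0..T} (Dn {0..T} m y)) \<and>
     (AE t in lebesgue_on {0..T}. Dn {0..T} \<nu> y differentiable (at t within {0..T})) \<and>
     L2_on {0..T} (Dn {0..T} (\<nu> + 1) y)}"

text \<open>The entry \<open>(m, j)\<close> of the stacked vector of initial derivatives, \<open>m \<le> \<nu>\<close>.\<close>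

definition stacked :: "real \<Rightarrow> (real \<Rightarrow> real ^ 'd) \<Rightarrow> nat \<times> 'd \<Rightarrow> real" where
  "stacked T y = (\<lambda>(m, j). Dn {0..T} m y 0 $ j)"

definition stack_index :: "nat \<Rightarrow> (nat \<times> 'd::finite) set" where
  "stack_index \<nu> = {..\<nu>} \<times> UNIV"

definition Aop :: "real \<Rightarrow> nat \<Rightarrow> (nat \<Rightarrow> real ^ 'd ^ 'd) \<Rightarrow> real ^ 'd ^ 'd \<Rightarrow>
    (real \<Rightarrow> real ^ 'd) \<Rightarrow> real \<Rightarrow> real ^ 'd" where
  "Aop T \<nu> F \<Gamma> y t =
     inv_sqrt \<Gamma> *v (Dn {0..T} (\<nu> + 1) y t - (\<Sum>m\<le>\<nu>. F m *v Dn {0..T} m y t))"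

definition innerY :: "real \<Rightarrow> nat \<Rightarrow> (nat \<times> 'd \<Rightarrow> nat \<times> 'd \<Rightarrow> real) \<Rightarrow> (nat \<Rightarrow> real ^ 'd ^ 'd) \<Rightarrow>
    real ^ 'd ^ 'd \<Rightarrow> (real \<Rightarrow> real ^ 'd) \<Rightarrow> (real \<Rightarrow> real ^ 'd) \<Rightarrow> real" where
  "innerY T \<nu> \<Sigma> F \<Gamma> y y' =
     (\<Sum>a\<in>stack_index \<nu>. \<Sum>b\<in>stack_index \<nu>.
        stacked T y a * mat_inv_on (stack_index \<nu>) \<Sigma> a b * stacked T y' b) +
     integral {0..T} (\<lambda>\<tau>. Aop T \<nu> F \<Gamma> y \<tau> \<bullet> Aop T \<nu> F \<Gamma> y' \<tau>)"

definition normY :: "real \<Rightarrow> nat \<Rightarrow> (nat \<times> 'd \<Rightarrow> nat \<times> 'd \<Rightarrow> real) \<Rightarrow> (nat \<Rightarrow> real ^ 'd ^ 'd) \<Rightarrow>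
    real ^ 'd ^ 'd \<Rightarrow> (real \<Rightarrow> real ^ 'd) \<Rightarrow> real" where
  "normY T \<nu> \<Sigma> F \<Gamma> y = sqrt (innerY T \<nu> \<Sigma> F \<Gamma> y y)"


section \<open>The initial value problem, meshes and the feasible set\<close>

definition ivp_solution :: "real set \<Rightarrow> (real \<Rightarrow> real ^ 'd \<Rightarrow> real ^ 'd) \<Rightarrow> real ^ 'd \<Rightarrow>
    (real \<Rightarrow> real ^ 'd) \<Rightarrow> bool" where
  "ivp_solution J f y0 y \<longleftrightarrow>
     y 0 = y0 \<and> (\<forall>t\<in>J. (y has_vector_derivative f t (y t)) (at t within J))"

definition unique_Ck_solution :: "nat \<Rightarrow> real set \<Rightarrow> (real \<Rightarrow> real ^ 'd \<Rightarrow> real ^ 'd) \<Rightarrow>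
    real ^ 'd \<Rightarrow> (real \<Rightarrow> real ^ 'd) \<Rightarrow> bool" where
  "unique_Ck_solution k J f y0 y \<longleftrightarrow>
     Ck_on k J y \<and> ivp_solution J f y0 y \<and>
     (\<forall>z. Ck_on k J z \<and> ivp_solution J f y0 z \<longrightarrow> (\<forall>t\<in>J. z t = y t))"

definition is_mesh :: "real \<Rightarrow> nat \<Rightarrow> (nat \<Rightarrow> real) \<Rightarrow> bool" where
  "is_mesh T N s \<longleftrightarrow> s 0 = 0 \<and> s N = T \<and> (\<forall>n<N. s n < s (Suc n))"

definition fill_distance :: "real \<Rightarrow> nat \<Rightarrow> (nat \<Rightarrow> real) \<Rightarrow> real" where
  "fill_distance T N s = (SUP t\<in>{0..T}. MIN n\<in>{..N}. \<bar>t - s n\<bar>)"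

definition Zop :: "real \<Rightarrow> (real \<Rightarrow> real ^ 'd \<Rightarrow> real ^ 'd) \<Rightarrow> (real \<Rightarrow> real ^ 'd) \<Rightarrow>
    real \<Rightarrow> real ^ 'd" where
  "Zop T f y t = Dn {0..T} 1 y t - f t (y t)"

definition feasible :: "real \<Rightarrow> nat \<Rightarrow> (real \<Rightarrow> real ^ 'd \<Rightarrow> real ^ 'd) \<Rightarrow> real ^ 'd \<Rightarrow>
    nat \<Rightarrow> (nat \<Rightarrow> real) \<Rightarrow> (real \<Rightarrow> real ^ 'd) set" where
  "feasible T \<nu> f y0 N s =
     {y \<in> Yspace T \<nu>. y 0 = y0 \<and> Dn {0..T} 1 y 0 = f 0 y0} \<inter>
     {y \<in> Yspace T \<nu>. \<forall>t\<in>s ` {..N}. Zop T f y t = 0}"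

definition Eop :: "real \<Rightarrow> (real \<Rightarrow> real ^ 'd \<Rightarrow> real ^ 'd) \<Rightarrow> (real \<Rightarrow> real ^ 'd) \<Rightarrow>
    real \<Rightarrow> real ^ 'd" where
  "Eop T f y t = integral {0..t} (Zop T f y)"


section \<open>Lebesgue norms and Sobolev seminorms\<close>

text \<open>
  The norms take values in the extended nonnegative reals; being at most a real number therefore
  includes being finite.
\<close>

definition recip :: "ennreal \<Rightarrow> real" where
  "recip q = enn2real (inverse q)"

definition Lq_norm :: "real set \<Rightarrow> ennreal \<Rightarrow> (real \<Rightarrow> real) \<Rightarrow> ennreal" where
  "Lq_norm S q u =
     (if u \<notin> borel_measurable (lebesgue_on S) then \<infinity>
      else if q = \<infinity> then esssup (lebesgue_on S) (\<lambda>t. ennreal \<bar>u t\<bar>)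
      else let I = (\<integral>\<^sup>+ t. ennreal (\<bar>u t\<bar> powr enn2real q) \<partial>lebesgue_on S)
           in if I = \<infinity> then \<infinity> else ennreal (enn2real I powr recip q))"

definition sobolev_seminorm :: "real \<Rightarrow> ennreal \<Rightarrow> nat \<Rightarrow> (real \<Rightarrow> real) \<Rightarrow> ennreal" where
  "sobolev_seminorm T q m u = Lq_norm {0..T} q (Dn {0..T} m u)"

end

theory Submission
  imports Defs
begin

text \<open>
  The exact solution \<open>y\<^sup>*\<close> is feasible, so the interpolant \<open>y\<close> satisfies \<open>\<parallel>y\<parallel> \<le> \<parallel>y\<^sup>*\<parallel>\<close>. The norm of the
  RKHS controls the initial derivatives and \<open>\<parallel>\<A>y\<parallel>\<close> in \<open>L\<^sub>2\<close>, hence, by Gronwall's inequality, the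
  suprema of \<open>y, \<dots>, D\<^sup>\<nu>y\<close> and the \<open>L\<^sub>2\<close> norm of \<open>D\<^sup>\<nu>\<^sup>+\<^sup>1y\<close>. By the chain rule the \<open>\<nu>\<close>-th derivative
  of the residual \<open>Z = Dy\<^sub>i - f\<^sub>i(\<cdot>, y)\<close> is bounded in \<open>L\<^sub>2\<close> by a constant that depends only on \<open>f\<^sub>i\<close>
  and \<open>\<parallel>y\<^sup>*\<parallel>\<close>. Since \<open>Z\<close> vanishes on the mesh, Rolle's theorem puts a zero of each of
  \<open>Z, \<dots>, D\<^sup>\<nu>\<^sup>-\<^sup>1Z\<close> within distance \<open>O(\<delta>)\<close> of every point, and integrating back from these zeros
  gains a factor \<open>\<delta>\<close> per derivative in \<open>L\<^sub>2\<close>, and \<open>\<delta>\<^sup>1\<^sup>/\<^sup>2\<close> in the last step from \<open>L\<^sub>2\<close> to the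
  supremum norm. The norms in \<open>L\<^sub>q\<close> lie in between.
\<close>


section \<open>Absolutely continuous functions\<close>

text \<open>The claimed bounds are linear in the norm of y*, whereas the bound \<open>M\<close> on
  the residual depends on that norm nonlinearly, through f. The constant is therefore
  \<open>M\<close> divided by \<open>?norm ystar\<close>, up to factors in T and \<nu>. Norm zero is
  treated apart: then y* and the interpolant both vanish on [0,T], and so does the residual. The
  constants are fixed before the problem, and \<open>c\<^sub>4\<close> sees only the coordinate f_i
  of f. Hence the estimates have to be uniform over a ball of the RKHS and over all f with the same
  f_i. The top order is the delicate one. D^\<nu> y is only absolutely continuous, so D^\<nu> Z is
  merely in L_2, and the zeros given by Rolle's theorem stop at D^(\<nu>-1) Z. Integrating back from
  there takes the fundamental theorem of calculus for absolutely continuous functions. Since E' = Z,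
  order m of the seminorm is order m - 1 of Z, whence the exponent \<nu> + 1 - m. For m = 0, E is
  bounded by the L_1 norm of Z, and the exponent stays at \<nu>.\<close>

lemma abs_continuous_on_imp_has_integral:
  fixes g :: "real \<Rightarrow> 'a::banach"
  assumes "a \<le> b" and ac: "abs_continuous_on {a..b} g" and "negligible E"
    and der: "\<And>x. x \<in> {a..b} - E \<Longrightarrow> (g has_vector_derivative g' x) (at x within {a..b})"
  shows "(g' has_integral g b - g a) {a..b}"
proof -
  \<comment> \<open>With the integrand set to 0 on E, a tag in E contributes only an increment of g,
    which absolute continuity controls.\<close>
  define h where "h x = (if x \<in> E then 0 else g' x)" for x
  have "(h has_integral g b - g a) {a..b}"
    unfolding has_integral_factor_content_real
  proof safe
    fix e :: real assume "e > 0"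
    show "\<exists>d. gauge d \<and> (\<forall>p. p tagged_division_of {a..b} \<and> d fine p \<longrightarrow>
      norm ((\<Sum>(x, k)\<in>p. measure lborel k *\<^sub>R h x) - (g b - g a)) \<le> e * measure lborel {a..b})"
    proof (cases "a = b")
      case True
      have "norm ((\<Sum>(x, k)\<in>p. measure lborel k *\<^sub>R h x) - (g b - g a)) \<le> e * measure lborel {a..b}" 
        if "p tagged_division_of {a..b}" for p
        using True sum_content_null[of a b p h] that by simp
      then show ?thesis by (auto intro!: exI[of _ "\<lambda>x. ball x 1"])
    next
      case False
      with \<open>a \<le> b\<close> have "a < b" by simp
      \<comment> \<open>Half of the admissible error is spent on the tags in E; the other half is
        the slope error e/2 at the remaining tags.\<close>
      define \<epsilon> where "\<epsilon> = e * (b - a) / 2"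
      have "\<epsilon> > 0" using \<open>a < b\<close> \<open>e > 0\<close> by (simp add: \<epsilon>_def)
      obtain \<delta> where "\<delta> > 0" and \<delta>: "\<And>\<D> X. \<D> division_of X \<Longrightarrow> X \<subseteq> {a..b} \<Longrightarrow>
          (\<Sum>K\<in>\<D>. Sup K - Inf K) < \<delta> \<Longrightarrow> (\<Sum>K\<in>\<D>. norm (g (Sup K) - g (Inf K))) < \<epsilon>"
        using ac \<open>\<epsilon> > 0\<close> unfolding abs_continuous_on_def by meson
      \<comment> \<open>Outer regularity bounds the measure of U - E. Since E is null, the bound
        passes to U through a negligible symmetric difference.\<close>
      obtain U where U: "open U" "E \<subseteq> U" "U - E \<in> lmeasurable"
          "emeasure lebesgue (U - E) < ennreal \<delta>"
        using sets_lebesgue_outer_open[OF negligible_imp_sets[OF \<open>negligible E\<close>] \<open>\<delta> > 0\<close>] .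
      have sym: "negligible ((U - E - U) \<union> (U - (U - E)))"
        by (rule negligible_subset[OF \<open>negligible E\<close>]) auto
      have "U \<in> lmeasurable"
        using lmeasurable_negligible_symdiff[OF U(3) sym] .
      moreover have "measure lebesgue U < \<delta>"
        using measure_negligible_symdiff[OF U(3) sym] U(3,4) \<open>\<delta> > 0\<close>
        by (simp add: emeasure_eq_measure2 ennreal_less_iff)
      ultimately have U: "open U" "E \<subseteq> U" "U \<in> lmeasurable" "measure lebesgue U < \<delta>"
        using U by auto
      have "\<exists>d>0. \<forall>y\<in>{a..b}. \<bar>y - x\<bar> < d \<longrightarrow>
          norm (g y - g x - (y - x) *\<^sub>R g' x) \<le> e/2 * \<bar>y - x\<bar>" if "x \<in> {a..b} - E" for x
        using der[OF that] \<open>e > 0\<close>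
        unfolding has_vector_derivative_def has_derivative_within_alt real_norm_def
        by (meson half_gt_zero)
      then obtain d where d: "\<And>x. x \<in> {a..b} - E \<Longrightarrow> d x > 0"
        "\<And>x y. x \<in> {a..b} - E \<Longrightarrow> y \<in> {a..b} \<Longrightarrow> \<bar>y - x\<bar> < d x \<Longrightarrow>
          norm (g y - g x - (y - x) *\<^sub>R g' x) \<le> e/2 * \<bar>y - x\<bar>"
        by metis
      \<comment> \<open>Intervals tagged in E are forced into the small open set U; at the other
        tags of \<open>{a..b}\<close> the gauge is the radius of the derivative estimate.\<close>
      define \<gamma> where "\<gamma> x = (if x \<in> E then U else if x \<in> {a..b} then ball x (d x) else ball x 1)" for x
      have gauge: "gauge \<gamma>" using U d(1) by (auto simp: gauge_def \<gamma>_def)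
      have bound: "norm ((\<Sum>(x, K)\<in>p. measure lborel K *\<^sub>R h x) - (g b - g a)) \<le> e * measure lborel {a..b}"
        if p: "p tagged_division_of {a..b}" and fine: "\<gamma> fine p" for p
      proof -
        note pD = tagged_division_ofD[OF p]
        have K: "Inf K \<in> {a..b} \<and> Sup K \<in> {a..b} \<and> Inf K \<in> K \<and> Sup K \<in> K \<and> Inf K \<le> x \<and> x \<le> Sup K \<and>
            measure lborel K = Sup K - Inf K \<and> measure lebesgue K = Sup K - Inf K \<and> x \<in> {a..b}" if xK: "(x, K) \<in> p" for x K
        proof -
          obtain u v where uv: "K = cbox u v" using pD(4)[OF xK] by blast
          with pD(2)[OF xK] pD(3)[OF xK] have "u \<le> v" "a \<le> u" "v \<le> b" "u \<le> x" "x \<le> v" by auto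
          then show ?thesis by (simp add: uv)
        qed
        let ?q = "{(x,K) \<in> p. x \<in> E}"
        let ?r = "{(x,K) \<in> p. x \<notin> E}"
        have fin: "finite p" by (rule pD(1))
        have pq: "p = ?q \<union> ?r" "?q \<inter> ?r = {}" by auto
        have finq: "finite ?q" "finite ?r" using fin by (auto intro: finite_subset[OF _ fin])
        have "(\<Sum>(x, K)\<in>p. g (Sup K) - g (Inf K)) = g b - g a"
          using additive_tagged_division_1[OF \<open>a \<le> b\<close> p] by simp
        then have "(\<Sum>(x, K)\<in>p. measure lborel K *\<^sub>R h x) - (g b - g a)
            = (\<Sum>(x, K)\<in>p. measure lborel K *\<^sub>R h x - (g (Sup K) - g (Inf K)))"
          by (simp add: case_prod_unfold sum_subtractf)
        also have "\<dots> = (\<Sum>(x, K)\<in>?q. measure lborel K *\<^sub>R h x - (g (Sup K) - g (Inf K)))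
            + (\<Sum>(x, K)\<in>?r. measure lborel K *\<^sub>R h x - (g (Sup K) - g (Inf K)))"
          using sum.union_disjoint[OF finq pq(2)] by (simp flip: pq(1))
        finally have eq: "(\<Sum>(x, K)\<in>p. measure lborel K *\<^sub>R h x) - (g b - g a) = \<dots>" .
        have "norm (\<Sum>(x, K)\<in>?q. measure lborel K *\<^sub>R h x - (g (Sup K) - g (Inf K)))
            \<le> (\<Sum>(x, K)\<in>?q. norm (g (Sup K) - g (Inf K)))"
          by (rule order_trans[OF norm_sum]) (auto intro!: sum_mono simp: h_def norm_minus_commute)
        also have "\<dots> < \<epsilon>"
        proof -
          have pd: "?q tagged_partial_division_of {a..b}"
            by (rule tagged_partial_division_subset[OF p[unfolded tagged_division_of_def, THEN conjunct1]]) auto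
          then have div: "snd ` ?q division_of (\<Union>(snd ` ?q))"
            by (rule partial_division_of_tagged_division)
          have td: "?q tagged_division_of (\<Union>(snd ` ?q))"
            using tagged_partial_division_of_Union_self[OF pd] .
          have sub: "\<Union>(snd ` ?q) \<subseteq> {a..b}" "\<Union>(snd ` ?q) \<subseteq> U"
          proof -
            have "K \<subseteq> {a..b} \<and> K \<subseteq> U" if "(x, K) \<in> p" "x \<in> E" for x K
              using pD(3)[OF that(1)] fineD[OF fine that(1)] that(2) by (simp add: \<gamma>_def)
            then have "\<forall>K\<in>snd ` ?q. K \<subseteq> {a..b} \<and> K \<subseteq> U" by auto
            then show "\<Union>(snd ` ?q) \<subseteq> {a..b}" "\<Union>(snd ` ?q) \<subseteq> U" by blast+
          qed
          have "(\<Sum>K\<in>snd ` ?q. Sup K - Inf K) = (\<Sum>K\<in>snd ` ?q. measure lebesgue K)"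
            using K by (intro sum.cong) auto
          also have "\<dots> = measure lebesgue (\<Union>(snd ` ?q))"
            by (rule content_division[OF div])
          also have "\<dots> \<le> measure lebesgue U"
            using sub U(3) lmeasurable_division[OF div] by (intro measure_mono_fmeasurable) auto
          finally have "(\<Sum>K\<in>snd ` ?q. norm (g (Sup K) - g (Inf K))) < \<epsilon>"
            using U(4) by (intro \<delta>[OF div sub(1)]) simp
          moreover have "(\<Sum>(x, K)\<in>?q. norm (g (Sup K) - g (Inf K)))
              = (\<Sum>K\<in>snd ` ?q. norm (g (Sup K) - g (Inf K)))"
          proof -
            \<comment> \<open>The passage from tagged pairs to intervals requires the value 0 on
              every box with empty interior. The empty box is one of them, and the increment between
              \<open>Sup {}\<close> and \<open>Inf {}\<close> need not vanish.\<close>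
            let ?d = "\<lambda>K. if K = {} then 0 else norm (g (Sup K) - g (Inf K))"
            have ne: "K \<noteq> {}" if "(x, K) \<in> p" for x K
              using pD(2)[OF that] by auto
            then have "(\<Sum>(x, K)\<in>?q. norm (g (Sup K) - g (Inf K))) = (\<Sum>(x, K)\<in>?q. ?d K)"
              by (intro sum.cong) auto
            also have "\<dots> = (\<Sum>K\<in>snd ` ?q. ?d K)"
              by (rule sum.over_tagged_division_lemma[OF td])
                (auto simp: box_eq_empty not_less order.order_iff_strict)
            also have "\<dots> = (\<Sum>K\<in>snd ` ?q. norm (g (Sup K) - g (Inf K)))"
              using ne by (intro sum.cong) auto
            finally show ?thesis .
          qed
          ultimately show ?thesis by simp
        qed
        finally have q: "norm (\<Sum>(x, K)\<in>?q. measure lborel K *\<^sub>R h x - (g (Sup K) - g (Inf K))) < \<epsilon>" .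
        have "norm (\<Sum>(x, K)\<in>?r. measure lborel K *\<^sub>R h x - (g (Sup K) - g (Inf K)))
            \<le> (\<Sum>(x, K)\<in>?r. e/2 * measure lborel K)"
        proof (rule order_trans[OF norm_sum], rule sum_mono, clarify)
          fix x K assume xK: "(x, K) \<in> p" "x \<notin> E"
          note k = K[OF xK(1)]
          have "K \<subseteq> ball x (d x)"
            using fineD[OF fine xK(1)] xK(2) k by (simp add: \<gamma>_def)
          then have dist: "\<bar>Sup K - x\<bar> < d x" "\<bar>Inf K - x\<bar> < d x"
            using k by (auto simp: dist_real_def)
          \<comment> \<open>The increment is split at the tag x, which lies between the two end
            points, so that the two errors add up to e/2 times the length.\<close>
          have "measure lborel K *\<^sub>R h x - (g (Sup K) - g (Inf K))
            = (g (Inf K) - g x - (Inf K - x) *\<^sub>R g' x) - (g (Sup K) - g x - (Sup K - x) *\<^sub>R g' x)"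
          proof -
            have "measure lborel K = Sup K - Inf K" using k by blast
            then show ?thesis
              by (simp only: h_def xK(2) if_False scaleR_diff_left) (simp add: algebra_simps)
          qed
          also have "norm \<dots> \<le> e/2 * \<bar>Inf K - x\<bar> + e/2 * \<bar>Sup K - x\<bar>"
            using k xK dist by (intro norm_triangle_le_diff add_mono d(2)) auto
          also have "\<dots> = e/2 * (\<bar>Inf K - x\<bar> + \<bar>Sup K - x\<bar>)"
            by (rule distrib_left[symmetric])
          also have "\<bar>Inf K - x\<bar> + \<bar>Sup K - x\<bar> = measure lborel K" using k by simp
          finally show "norm (measure lborel K *\<^sub>R h x - (g (Sup K) - g (Inf K))) \<le> e/2 * measure lborel K" .
        qed
        also have "\<dots> \<le> (\<Sum>(x, K)\<in>p. e/2 * measure lborel K)"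
          using \<open>e > 0\<close> by (intro sum_mono2 fin) auto
        also have "\<dots> = e/2 * (b - a)"
          using additive_content_tagged_division[of p a b] p \<open>a < b\<close>
          unfolding case_prod_unfold sum_distrib_left[symmetric] by simp
        finally have r: "norm (\<Sum>(x, K)\<in>?r. measure lborel K *\<^sub>R h x - (g (Sup K) - g (Inf K))) \<le> e/2 * (b - a)" .
        show ?thesis
          unfolding eq using q r \<open>a < b\<close>
          by (intro norm_triangle_le) (simp add: \<epsilon>_def field_simps)
      qed
      show ?thesis
        by (intro exI[of _ \<gamma>] conjI allI impI gauge bound) auto
    qed
  qed
  then show ?thesis
    using \<open>negligible E\<close> by (rule has_integral_spike[rotated 2]) (simp add: h_def)
qed


section \<open>Positive definite matrices\<close>

text \<open>The quadratic form attains a minimum on the compact unit sphere; this minimum is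
  positive, and homogeneity extends the bound to all vectors.\<close>

lemma pos_def_bounded_below:
  assumes "pos_def A"
  obtains c where "c > 0" "\<And>x. c * (x \<bullet> x) \<le> x \<bullet> (A *v x)"
proof -
  have "continuous_on (sphere 0 1) (\<lambda>x. x \<bullet> (A *v x))"
    by (intro continuous_intros linear_continuous_on matrix_vector_mul_bounded_linear)
  then obtain u where u: "u \<in> sphere 0 1" "\<And>x. x \<in> sphere 0 1 \<Longrightarrow> u \<bullet> (A *v u) \<le> x \<bullet> (A *v x)"
    using continuous_attains_inf[of "sphere 0 1" "\<lambda>x. x \<bullet> (A *v x)"] by auto
  show ?thesis
  proof
    show "u \<bullet> (A *v u) > 0"
      using assms u(1) by (metis mem_sphere_0 norm_zero pos_def_def zero_neq_one)
    show "u \<bullet> (A *v u) * (x \<bullet> x) \<le> x \<bullet> (A *v x)" for x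
    proof (cases "x = 0")
      case False
      then have "u \<bullet> (A *v u) \<le> (x /\<^sub>R norm x) \<bullet> (A *v (x /\<^sub>R norm x))"
        by (intro u(2)) simp
      also have "\<dots> = (x \<bullet> (A *v x)) / (norm x)\<^sup>2"
        by (simp add: matrix_vector_mult_scaleR power2_eq_square field_simps)
      finally show ?thesis
        using False by (simp add: field_simps dot_square_norm)
    qed simp
  qed
qed

text \<open>If \<open>A = I - B\<close> with \<open>\<parallel>B\<parallel> < 1\<close>, then \<open>(I - Y)\<^sup>2 = A\<close> says that \<open>Y\<close> is a fixed point of
  the contraction \<open>Y \<mapsto> (B + Y\<^sup>2) / 2\<close> of a small ball of symmetric operators.\<close>

lemma pos_def_sqrt:
  fixes A :: "real ^ 'n ^ 'n"
  assumes "pos_def A"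
  obtains R where "pos_def R" "R ** R = A"
proof -
  obtain c where "c > 0" and c: "\<And>x. c * (x \<bullet> x) \<le> x \<bullet> (A *v x)"
    using pos_def_bounded_below[OF assms] by blast
  obtain K where "K > 0" and K: "\<And>x. norm (A *v x) \<le> K * norm x"
    using bounded_linear.pos_bounded[OF matrix_vector_mul_bounded_linear[of A]]
    by (auto simp: mult.commute)
  have symA: "x \<bullet> (A *v y) = (A *v x) \<bullet> y" for x y
    using assms by (metis dot_lmul_matrix inner_commute pos_def_def transpose_matrix_vector)
  \<comment> \<open>This scaling minimises the bound 1 - 2c/\<mu> + K^2/\<mu>^2 for the squared norm
    of I - A/\<mu>; the minimum is 1 - c^2/K^2.\<close>
  define \<mu> where "\<mu> = K\<^sup>2 / c"
  have "\<mu> > 0" using \<open>c > 0\<close> \<open>K > 0\<close> by (simp add: \<mu>_def)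
  define a where "a = Blinfun ((*v) A)"
  have a: "a x = A *v x" for x
    by (simp add: a_def bounded_linear_Blinfun_apply matrix_vector_mul_bounded_linear)
  define B where "B = id_blinfun - (1/\<mu>) *\<^sub>R a"
  have B: "B x = x - (1/\<mu>) *\<^sub>R (A *v x)" for x
    by (simp add: B_def blinfun.diff_left blinfun.scaleR_left a)
  have normB2: "(norm (B x))\<^sup>2 \<le> (1 - c\<^sup>2/K\<^sup>2) * (norm x)\<^sup>2" for x
  proof -
    have "(norm (B x))\<^sup>2 = (norm x)\<^sup>2 - 2/\<mu> * (x \<bullet> (A *v x)) + (norm (A *v x))\<^sup>2/\<mu>\<^sup>2"
    proof -
      have "(norm (x - k *\<^sub>R z))\<^sup>2 = (norm x)\<^sup>2 - 2 * k * (x \<bullet> z) + k\<^sup>2 * (norm z)\<^sup>2"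
        for k and z :: "real ^ 'n"
        unfolding power2_norm_eq_inner
        by (simp add: inner_diff_left inner_diff_right inner_commute[of z x] power2_eq_square algebra_simps)
      from this[of "1/\<mu>" "A *v x"] show ?thesis by (simp add: B power_divide)
    qed
    also have "\<dots> \<le> (norm x)\<^sup>2 - 2/\<mu> * (c * (norm x)\<^sup>2) + (K * norm x)\<^sup>2/\<mu>\<^sup>2"
      using c[of x] K[of x] \<open>\<mu> > 0\<close>
      by (intro add_mono diff_mono mult_left_mono divide_right_mono power_mono)
        (auto simp: power2_norm_eq_inner)
    also have "\<dots> = (1 - c\<^sup>2/K\<^sup>2) * (norm x)\<^sup>2"
      using \<open>c > 0\<close> \<open>K > 0\<close> by (simp add: \<mu>_def field_simps power2_eq_square)
    finally show ?thesis .
  qed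
  define b where "b = sqrt (1 - c\<^sup>2/K\<^sup>2)"
  obtain v :: "real ^ 'n" where v: "norm v = 1"
    by (meson vector_choose_size zero_le_one)
  have "0 \<le> 1 - c\<^sup>2/K\<^sup>2"
    using normB2[of v] v by (smt (verit) mult_cancel_left1 one_power2 zero_le_power2)
  then have b: "0 \<le> b" "b < 1"
    using \<open>c > 0\<close> \<open>K > 0\<close> by (auto simp: b_def real_sqrt_lt_1_iff)
  have "norm B \<le> b"
  proof (rule norm_blinfun_bound[OF b(1)])
    show "norm (B x) \<le> b * norm x" for x
      using real_sqrt_le_mono[OF normB2[of x]] by (simp add: b_def real_sqrt_mult)
  qed
  \<comment> \<open>The smaller root of r = (b + r^2)/2: the ball of radius r is mapped into itself,
    and r < 1 is also a Lipschitz constant there.\<close>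
  define r where "r = 1 - sqrt (1 - b)"
  have r: "0 \<le> r" "r < 1" and rb: "(b + r * r) / 2 = r"
    using b by (auto simp: r_def field_simps)
  \<comment> \<open>Symmetry is a closed condition that \<Phi> preserves, so it passes to the fixed
    point and from there to the square root.\<close>
  define S where "S = {Y :: (real ^ 'n) \<Rightarrow>\<^sub>L (real ^ 'n). norm Y \<le> r \<and> (\<forall>x y. x \<bullet> blinfun_apply Y y = blinfun_apply Y x \<bullet> y)}"
  define \<Phi> where "\<Phi> Y = (1/2) *\<^sub>R (B + (Y o\<^sub>L Y))" for Y :: "(real ^ 'n) \<Rightarrow>\<^sub>L (real ^ 'n)"
  have "S = cball 0 r \<inter> (\<Inter>x. \<Inter>y. {Y. x \<bullet> blinfun_apply Y y = blinfun_apply Y x \<bullet> y})"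
    by (auto simp: S_def)
  also have "closed \<dots>"
    by (intro closed_Int closed_cball closed_INT ballI closed_Collect_eq continuous_intros)
  finally have "complete S" by (simp add: complete_eq_closed)
  moreover have "0 \<in> S" using r by (simp add: S_def)
  moreover have "\<Phi> ` S \<subseteq> S"
  proof safe
    fix Y assume Y: "Y \<in> S"
    have "norm (\<Phi> Y) \<le> (norm B + norm (Y o\<^sub>L Y)) / 2"
      using norm_triangle_ineq[of B "Y o\<^sub>L Y"] by (simp add: \<Phi>_def)
    also have "\<dots> \<le> (b + r * r) / 2"
      using Y \<open>norm B \<le> b\<close> r
      by (intro divide_right_mono add_mono order_trans[OF norm_blinfun_compose] mult_mono)
        (auto simp: S_def)
    finally have "norm (\<Phi> Y) \<le> r" unfolding rb .
    moreover have "x \<bullet> \<Phi> Y y = \<Phi> Y x \<bullet> y" for x y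
      using Y symA[of x y] by (simp add: \<Phi>_def S_def B blinfun.add_left blinfun.scaleR_left inner_simps)
    ultimately show "\<Phi> Y \<in> S" by (simp add: S_def)
  qed
  moreover have "dist (\<Phi> Y) (\<Phi> Z) \<le> r * dist Y Z" if "Y \<in> S" "Z \<in> S" for Y Z
  proof -
    have "\<Phi> Y - \<Phi> Z = (1/2) *\<^sub>R ((Y o\<^sub>L (Y - Z)) + ((Y - Z) o\<^sub>L Z))"
      by (rule blinfun_eqI) (simp add: \<Phi>_def blinfun.diff_left blinfun.diff_right blinfun.add_left
          blinfun.scaleR_left algebra_simps)
    then have "norm (\<Phi> Y - \<Phi> Z) \<le> (norm (Y o\<^sub>L (Y - Z)) + norm ((Y - Z) o\<^sub>L Z)) / 2"
      using norm_triangle_ineq[of "Y o\<^sub>L (Y - Z)" "(Y - Z) o\<^sub>L Z"] by simp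
    also have "\<dots> \<le> (r * norm (Y - Z) + norm (Y - Z) * r) / 2"
      using that r
      by (intro divide_right_mono add_mono order_trans[OF norm_blinfun_compose] mult_mono)
        (auto simp: S_def)
    finally show ?thesis by (simp add: dist_norm algebra_simps)
  qed
  ultimately obtain Y where Y: "Y \<in> S" "\<Phi> Y = Y"
    using Banach_fix[of S r \<Phi>] r by blast
  have YY: "Y (Y x) = 2 *\<^sub>R Y x - B x" for x
  proof -
    have "blinfun_apply (\<Phi> Y) x = Y x" using Y(2) by simp
    then have "(1/2) *\<^sub>R (B x + Y (Y x)) = Y x"
      unfolding \<Phi>_def by (simp only: blinfun.scaleR_left blinfun.add_left blinfun_apply_blinfun_compose)
    then have "2 *\<^sub>R (1/2) *\<^sub>R (B x + Y (Y x)) = 2 *\<^sub>R Y x" by (rule arg_cong)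
    then have "2 *\<^sub>R Y x = B x + Y (Y x)" by (simp only: scaleR_scaleR) simp
    then show ?thesis by simp
  qed
  \<comment> \<open>Here B = I - A/\<mu>, so the fixed point gives (I - Y)^2 = A/\<mu>, and the
    factor \<open>sqrt \<mu>\<close> undoes the scaling. Positivity comes from norm Y \<le> r <
    1.\<close>
  define \<rho> where "\<rho> x = sqrt \<mu> *\<^sub>R (x - Y x)" for x
  have "linear \<rho>"
    unfolding \<rho>_def by (intro bounded_linear.linear) (auto intro!: bounded_linear_intros)
  have \<rho>2: "\<rho> (\<rho> x) = A *v x" for x
  proof -
    have "\<rho> (\<rho> x) = (sqrt \<mu> * sqrt \<mu>) *\<^sub>R (x - Y x - (Y x - Y (Y x)))"
      unfolding \<rho>_def by (simp only: blinfun.diff_right blinfun.scaleR_right scaleR_diff_right scaleR_scaleR)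
    also have "x - Y x - (Y x - Y (Y x)) = (1/\<mu>) *\<^sub>R (A *v x)"
      by (simp add: YY B scaleR_2)
    finally show ?thesis using \<open>\<mu> > 0\<close> by simp
  qed
  have pos: "x \<bullet> \<rho> x > 0" if "x \<noteq> 0" for x
  proof -
    have "x \<bullet> Y x \<le> norm x * norm (Y x)" by (rule norm_cauchy_schwarz)
    also have "\<dots> \<le> norm x * (r * norm x)"
      using Y(1) by (intro mult_left_mono order_trans[OF norm_blinfun] mult_right_mono) (auto simp: S_def)
    also have "\<dots> < norm x * norm x" using r that by simp
    finally show ?thesis
      using \<open>\<mu> > 0\<close> by (simp add: \<rho>_def inner_diff_right flip: power2_eq_square power2_norm_eq_inner)
  qed
  have mv: "matrix \<rho> *v x = \<rho> x" for x
    using matrix_works[of \<rho>] \<open>linear \<rho>\<close> by (simp add: linear_matrix_vector_mul_eq)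
  show ?thesis
  proof
    have sym: "x \<bullet> \<rho> y = \<rho> x \<bullet> y" for x y
      using Y(1) by (simp add: S_def \<rho>_def inner_diff_left inner_diff_right)
    have "transpose (matrix \<rho>) *v x = matrix \<rho> *v x" for x
    proof (rule vector_eq_ldot[THEN iffD1], rule allI)
      show "y \<bullet> (transpose (matrix \<rho>) *v x) = y \<bullet> (matrix \<rho> *v x)" for y
        by (metis dot_lmul_matrix inner_commute mv sym transpose_matrix_vector)
    qed
    then have "transpose (matrix \<rho>) = matrix \<rho>"
      by (simp add: matrix_eq)
    then show "pos_def (matrix \<rho>)"
      using pos by (simp add: pos_def_def mv)
    show "matrix \<rho> ** matrix \<rho> = A"
      by (simp add: matrix_eq mv \<rho>2 flip: matrix_vector_mul_assoc)
  qed
qed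

lemma pos_def_matrix_inv:
  assumes "pos_def A"
  shows "pos_def (matrix_inv A)" "A ** matrix_inv A = mat 1"
proof -
  have "x = 0" if "A *v x = 0" for x
    using assms that by (force simp: pos_def_def)
  then have "invertible A"
    by (metis invertible_left_inverse matrix_left_invertible_ker)
  then show AI: "A ** matrix_inv A = mat 1"
    unfolding matrix_inv_def invertible_def by (metis (mono_tags, lifting) someI_ex)
  have tA: "transpose A = A" using assms by (simp add: pos_def_def)
  have "transpose (matrix_inv A) ** A = mat 1"
    by (metis AI matrix_transpose_mul tA transpose_mat)
  then have "transpose (matrix_inv A) = matrix_inv A"
    by (metis AI matrix_mul_assoc matrix_mul_lid matrix_mul_rid)
  moreover have "0 < x \<bullet> (matrix_inv A *v x)" if "x \<noteq> 0" for x
  proof -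
    let ?z = "matrix_inv A *v x"
    have x: "x = A *v ?z" by (simp add: AI matrix_vector_mul_assoc)
    then have "?z \<noteq> 0" using that by auto
    then have "0 < ?z \<bullet> (A *v ?z)" using assms by (simp add: pos_def_def)
    then show ?thesis using x by (simp add: inner_commute)
  qed
  ultimately show "pos_def (matrix_inv A)" by (simp add: pos_def_def)
qed

text \<open>\<open>inv_sqrt\<close> is a choice, so a square root has to exist before anything is
  known about it. Then \<open>\<Gamma> ** inv_sqrt \<Gamma>\<close> is a left inverse of
  \<open>inv_sqrt \<Gamma>\<close>, and any bound for it serves as C.\<close>

lemma inv_sqrt_bounded_below:
  assumes "pos_def \<Gamma>"
  obtains C where "C > 0" "\<And>x. norm x \<le> C * norm (inv_sqrt \<Gamma> *v x)"
proof -
  have "\<exists>S. pos_def S \<and> S ** S = matrix_inv \<Gamma>"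
    using pos_def_sqrt[OF pos_def_matrix_inv(1)[OF assms]] by metis
  then have S: "inv_sqrt \<Gamma> ** inv_sqrt \<Gamma> = matrix_inv \<Gamma>"
    unfolding inv_sqrt_def by (rule someI2_ex) auto
  obtain C where C: "C > 0" "\<And>x. norm ((\<Gamma> ** inv_sqrt \<Gamma>) *v x) \<le> C * norm x"
    using bounded_linear.pos_bounded[OF matrix_vector_mul_bounded_linear[of "\<Gamma> ** inv_sqrt \<Gamma>"]]
    by (auto simp: mult.commute)
  show ?thesis
  proof (rule that[OF C(1)])
    fix x
    have "(\<Gamma> ** inv_sqrt \<Gamma>) *v (inv_sqrt \<Gamma> *v x) = x"
      using S pos_def_matrix_inv(2)[OF assms]
      by (metis matrix_mul_assoc matrix_vector_mul_assoc matrix_vector_mul_lid)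
    then show "norm x \<le> C * norm (inv_sqrt \<Gamma> *v x)"
      using C(2) by metis
  qed
qed

text \<open>Completing the square in the coordinate p leaves the form of the Schur complement. This
  removes one index at a time while staying within positive definite matrices.\<close>

lemma pos_def_on_Schur:
  assumes "pos_def_on (insert p I) A" "finite I" "p \<notin> I"
  shows "A p p > 0" "pos_def_on I (\<lambda>a b. A a b - A a p * A p b / A p p)"
proof -
  have sym: "\<And>a b. a \<in> insert p I \<Longrightarrow> b \<in> insert p I \<Longrightarrow> A a b = A b a"
    and pos: "\<And>x. \<exists>a\<in>insert p I. x a \<noteq> 0 \<Longrightarrow>
      0 < (\<Sum>a\<in>insert p I. \<Sum>b\<in>insert p I. x a * A a b * x b)"
    using assms(1) by (auto simp: pos_def_on_def)
  have expand: "(\<Sum>a\<in>insert p I. \<Sum>b\<in>insert p I. x a * A a b * x b) =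
      A p p * (x p)\<^sup>2 + 2 * x p * (\<Sum>a\<in>I. x a * A a p) + (\<Sum>a\<in>I. \<Sum>b\<in>I. x a * A a b * x b)" for x
  proof -
    have "(\<Sum>b\<in>I. x p * A p b * x b) = x p * (\<Sum>a\<in>I. x a * A a p)"
      unfolding sum_distrib_left by (intro sum.cong) (auto simp: sym)
    moreover have "(\<Sum>a\<in>I. x a * A a p * x p) = x p * (\<Sum>a\<in>I. x a * A a p)"
      unfolding sum_distrib_left by (intro sum.cong) auto
    ultimately show ?thesis
      using assms(2,3) by (simp add: sum.distrib power2_eq_square algebra_simps)
  qed
  show app: "A p p > 0"
  proof -
    have "0 < (\<Sum>a\<in>insert p I. \<Sum>b\<in>insert p I. (if a = p then 1 else 0) * A a b * (if b = p then 1 else 0))"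
      by (rule pos) auto
    then show ?thesis
      using assms(2,3) by (simp add: expand sum.neutral)
  qed
  show "pos_def_on I (\<lambda>a b. A a b - A a p * A p b / A p p)"
    unfolding pos_def_on_def
  proof (intro conjI ballI allI impI)
    show "A a b - A a p * A p b / A p p = A b a - A b p * A p a / A p p" if "a \<in> I" "b \<in> I" for a b
      using that by (simp add: sym mult.commute)
  next
    fix x assume x: "\<exists>a\<in>I. x a \<noteq> (0::real)"
    define s where "s = (\<Sum>a\<in>I. x a * A a p)"
    \<comment> \<open>The value at p minimises the form in this coordinate, so the form at z is that
      of the Schur complement at x.\<close>
    define z where "z = x(p := - s / A p p)"
    have zx: "z a = x a" if "a \<in> I" for a using that assms(3) by (auto simp: z_def)
    have "0 < (\<Sum>a\<in>insert p I. \<Sum>b\<in>insert p I. z a * A a b * z b)"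
      using x assms(3) by (intro pos) (auto simp: z_def)
    also have "\<dots> = (\<Sum>a\<in>I. \<Sum>b\<in>I. x a * A a b * x b) - s\<^sup>2 / A p p"
      unfolding expand using app zx
      by (simp add: s_def[symmetric] z_def power2_eq_square field_simps)
    also have "s\<^sup>2 / A p p = (\<Sum>a\<in>I. \<Sum>b\<in>I. x a * (A a p * A p b / A p p) * x b)"
      unfolding s_def power2_eq_square sum_product sum_divide_distrib
      by (intro sum.cong) (auto simp: sym)
    finally show "0 < (\<Sum>a\<in>I. \<Sum>b\<in>I. x a * (A a b - A a p * A p b / A p p) * x b)"
      by (simp add: algebra_simps sum_subtractf)
  qed
qed

text \<open>Gaussian elimination: once the unknown at p is eliminated, the remaining system has the
  Schur complement as its matrix and a modified right-hand side. Hence both A and v vary in the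
  induction.\<close>

lemma pos_def_on_solvable:
  assumes "finite I" "pos_def_on I A"
  shows "\<exists>x. \<forall>a\<in>I. (\<Sum>c\<in>I. A a c * x c) = v a"
  using assms
proof (induction I arbitrary: A v rule: finite_induct)
  case (insert p I)
  note S = pos_def_on_Schur[OF insert.prems insert.hyps]
  obtain x where
    x: "\<And>a. a \<in> I \<Longrightarrow> (\<Sum>c\<in>I. (A a c - A a p * A p c / A p p) * x c) = v a - A a p * v p / A p p"
    using insert.IH[OF S(2), of "\<lambda>a. v a - A a p * v p / A p p"] by blast
  define xp where "xp = (v p - (\<Sum>c\<in>I. A p c * x c)) / A p p"
  have "(\<Sum>c\<in>insert p I. A a c * (x(p := xp)) c) = v a" if "a \<in> insert p I" for a
  proof -
    have *: "(\<Sum>c\<in>insert p I. A a c * (x(p := xp)) c) = A a p * xp + (\<Sum>c\<in>I. A a c * x c)"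
    proof -
      have "(\<Sum>c\<in>I. A a c * (x(p := xp)) c) = (\<Sum>c\<in>I. A a c * x c)"
        using insert.hyps by (intro sum.cong) auto
      then show ?thesis using insert.hyps by simp
    qed
    show ?thesis
    proof (cases "a = p")
      case True
      then show ?thesis using S(1) unfolding * by (simp add: xp_def)
    next
      case False
      then have "(\<Sum>c\<in>I. A a c * x c) - A a p / A p p * (\<Sum>c\<in>I. A p c * x c) = v a - A a p * v p / A p p"
        using x[of a] that by (simp add: sum_subtractf sum_distrib_left left_diff_distrib mult.assoc)
      then show ?thesis using S(1) unfolding * by (simp add: xp_def field_simps)
    qed
  qed
  then show ?case by blast
qed simp

text \<open>The choice in \<open>mat_inv_on\<close> asks for a two-sided inverse on I. Solving for
  the unit vectors gives a right inverse; since A is symmetric, so is this inverse, which makes it a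
  left inverse as well.\<close>

lemma mat_inv_on_pos_def:
  fixes A :: "'a \<Rightarrow> 'a \<Rightarrow> real"
  assumes "finite I" "pos_def_on I A" "a \<in> I" "b \<in> I"
  shows "(\<Sum>c\<in>I. A a c * mat_inv_on I A c b) = (if a = b then 1 else 0)"
proof -
  have sym: "\<And>a b. a \<in> I \<Longrightarrow> b \<in> I \<Longrightarrow> A a b = A b a"
    using assms(2) by (auto simp: pos_def_on_def)
  have "\<exists>B. \<forall>b. \<forall>a\<in>I. (\<Sum>c\<in>I. A a c * B c b) = (if a = b then 1 else 0)"
  proof -
    have "\<forall>b. \<exists>x. \<forall>a\<in>I. (\<Sum>c\<in>I. A a c * x c) = (if a = b then 1 else 0)"
      using pos_def_on_solvable[OF assms(1,2)] by (rule allI)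
    then obtain X where "\<forall>b. \<forall>a\<in>I. (\<Sum>c\<in>I. A a c * X b c) = (if a = b then 1 else 0)"
      by (rule choice[THEN exE])
    then show ?thesis by (intro exI[of _ "\<lambda>c b. X b c"]) simp
  qed
  then obtain B where B: "\<And>a b. a \<in> I \<Longrightarrow> (\<Sum>c\<in>I. A a c * B c b) = (if a = b then 1 else 0)"
    by blast
  have B_sym: "B a b = B b a" if "a \<in> I" "b \<in> I" for a b
  proof -
    have "B a b = (\<Sum>c\<in>I. (\<Sum>d\<in>I. A c d * B d a) * B c b)"
      using that assms(1) by (simp add: B if_distrib[of "\<lambda>x. x * _"] cong: if_cong)
    also have "\<dots> = (\<Sum>d\<in>I. B d a * (\<Sum>c\<in>I. A d c * B c b))"
      unfolding sum_distrib_left sum_distrib_right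
      by (subst sum.swap, intro sum.cong) (auto simp: sym)
    also have "\<dots> = B b a"
      using that assms(1) by (simp add: B if_distrib cong: if_cong)
    finally show ?thesis .
  qed
  have "(\<Sum>c\<in>I. B a c * A c b) = (if a = b then 1 else 0)" if "a \<in> I" "b \<in> I" for a b
    using B[OF that(2), of a] that by (auto simp: sym B_sym mult.commute cong: sum.cong)
  then have "\<exists>B. \<forall>a\<in>I. \<forall>b\<in>I.
     (\<Sum>c\<in>I. A a c * B c b) = (if a = b then 1 else 0) \<and>
     (\<Sum>c\<in>I. B a c * A c b) = (if a = b then 1 else 0)"
    using B by blast
  from someI_ex[OF this] show ?thesis
    using assms(3,4) unfolding mat_inv_on_def by blast
qed

text \<open>Cauchy--Schwarz for the form of \<open>A\<close>, applied to \<open>z = A\<^sup>-\<^sup>1 x\<close> and the unit vector \<open>e\<^sub>a\<close>: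
  \<open>x\<^sub>a\<^sup>2 = (e\<^sub>a\<^sup>T A z)\<^sup>2 \<le> A\<^sub>a\<^sub>a (z\<^sup>T A z)\<close>.\<close>

lemma mat_inv_on_form_bound:
  assumes "finite I" "pos_def_on I A" "a \<in> I"
  shows "(x a)\<^sup>2 \<le> A a a * (\<Sum>a\<in>I. \<Sum>b\<in>I. x a * mat_inv_on I A a b * x b)"
proof -
  have sym: "\<And>a b. a \<in> I \<Longrightarrow> b \<in> I \<Longrightarrow> A a b = A b a"
    and nonneg: "\<And>x. 0 \<le> (\<Sum>a\<in>I. \<Sum>b\<in>I. x a * A a b * x b)"
    and pos: "\<And>x. \<exists>a\<in>I. x a \<noteq> 0 \<Longrightarrow> 0 < (\<Sum>a\<in>I. \<Sum>b\<in>I. x a * A a b * x b)"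
  proof -
    fix x
    show "0 \<le> (\<Sum>a\<in>I. \<Sum>b\<in>I. x a * A a b * x b)"
    proof (cases "\<exists>a\<in>I. x a \<noteq> 0")
      case True
      then show ?thesis using assms(2) unfolding pos_def_on_def by (meson less_imp_le)
    qed simp
  qed (use assms(2) in \<open>auto simp: pos_def_on_def\<close>)
  define z where "z a = (\<Sum>b\<in>I. mat_inv_on I A a b * x b)" for a
  have Az: "(\<Sum>c\<in>I. A a c * z c) = x a" if "a \<in> I" for a
  proof -
    have "(\<Sum>c\<in>I. A a c * z c) = (\<Sum>b\<in>I. (\<Sum>c\<in>I. A a c * mat_inv_on I A c b) * x b)"
      unfolding z_def sum_distrib_left sum_distrib_right
      by (subst sum.swap) (simp add: mult.assoc)
    also have "\<dots> = (\<Sum>b\<in>I. (if a = b then 1 else 0) * x b)"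
      using that by (intro sum.cong) (auto simp: mat_inv_on_pos_def[OF assms(1,2)])
    also have "\<dots> = x a"
      using that assms(1) by (simp add: if_distrib[of "\<lambda>x. x * _"] cong: if_cong)
    finally show ?thesis .
  qed
  define Q where "Q = (\<Sum>a\<in>I. \<Sum>b\<in>I. x a * mat_inv_on I A a b * x b)"
  have Q: "Q = (\<Sum>a\<in>I. x a * z a)"
    by (simp add: Q_def z_def sum_distrib_left mult.assoc)
  have form: "(\<Sum>b\<in>I. \<Sum>c\<in>I. w b * A b c * z c) = (\<Sum>b\<in>I. w b * x b)" for w
    by (intro sum.cong) (auto simp: mult.assoc Az simp flip: sum_distrib_left)
  have Aaa: "A a a > 0"
    using pos[of "\<lambda>b. if b = a then 1 else 0"] assms(1,3)
    by (auto simp: if_distrib[of "\<lambda>x. x * _"] if_distrib[of "(*) _"] cong: if_cong)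
  \<comment> \<open>The value of t that minimises the form at z - t e_a, namely Q - 2 t x_a + t^2
    A_aa. Its nonnegativity at the minimum is the asserted inequality.\<close>
  define t where "t = x a / A a a"
  define w where "w b = z b - t * (if b = a then 1 else 0)" for b
  have delta: "(\<Sum>b\<in>I. (if b = a then 1 else 0) * h b) = h a" for h :: "_ \<Rightarrow> real"
    using assms(1,3) by (simp add: if_distrib[of "\<lambda>x. x * _"] cong: if_cong)
  have "0 \<le> (\<Sum>b\<in>I. \<Sum>c\<in>I. w b * A b c * w c)" by (rule nonneg)
  also have "\<dots> = (\<Sum>b\<in>I. w b * (x b - t * A b a))"
  proof (intro sum.cong refl)
    fix b assume b: "b \<in> I"
    have "(\<Sum>c\<in>I. w b * A b c * w c)
        = w b * (\<Sum>c\<in>I. A b c * z c) - w b * (t * (\<Sum>c\<in>I. (if c = a then 1 else 0) * A b c))"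
      unfolding sum_distrib_left sum_subtractf[symmetric]
    proof (rule sum.cong[OF refl])
      fix c
      have "w c = z c - t * (if c = a then 1 else 0)" by (rule w_def)
      then show "w b * A b c * w c = w b * (A b c * z c) - w b * (t * ((if c = a then 1 else 0) * A b c))"
        by (simp only: right_diff_distrib mult.assoc mult.left_commute[of "A b c"] mult.commute[of "A b c"])
    qed
    then show "(\<Sum>c\<in>I. w b * A b c * w c) = w b * (x b - t * A b a)"
      unfolding delta Az[OF b] by (simp add: right_diff_distrib)
  qed
  also have "\<dots> = (\<Sum>b\<in>I. z b * x b) - t * (\<Sum>b\<in>I. A b a * z b)
      - t * (\<Sum>b\<in>I. (if b = a then 1 else 0) * (x b - t * A b a))"
    unfolding sum_distrib_left sum_subtractf[symmetric]
    by (intro sum.cong) (auto simp: w_def algebra_simps)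
  also have "(\<Sum>b\<in>I. A b a * z b) = x a"
    using Az[OF assms(3)] assms(3) by (simp add: sym cong: sum.cong)
  also have "(\<Sum>b\<in>I. z b * x b) = Q" by (simp add: Q mult.commute)
  finally have "0 \<le> Q - t * x a - t * (x a - t * A a a)" unfolding delta .
  then have "(x a)\<^sup>2 \<le> A a a * Q"
    using Aaa by (simp add: t_def field_simps power2_eq_square)
  then show ?thesis by (simp add: Q_def)
qed


section \<open>Functions vanishing on a mesh\<close>

lemma has_vector_derivative_continuous_on:
  "(\<And>t. t \<in> S \<Longrightarrow> (v has_vector_derivative v' t) (at t within S)) \<Longrightarrow> continuous_on S v"
  by (meson continuous_on_eq_continuous_within has_vector_derivative_continuous)

section \<open>Meshes and the fill distance\<close>

lemma mesh_strict_mono: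
  assumes "is_mesh T N s" "m < n" "n \<le> N"
  shows "s m < s n"
  using assms(2,3)
proof (induction n)
  case (Suc n)
  then have "s n < s (Suc n)" using assms(1) by (simp add: is_mesh_def)
  with Suc show ?case by (cases "m = n") auto
qed simp

lemma mesh_in_range:
  assumes "is_mesh T N s" "n \<le> N"
  shows "s n \<in> {0..T}"
  using assms mesh_strict_mono[OF assms(1), of 0 n] mesh_strict_mono[OF assms(1), of n N]
  by (cases "n = 0"; cases "n = N") (auto simp: is_mesh_def)

lemma fill_distance_upper:
  assumes "is_mesh T N s" "t \<in> {0..T}"
  obtains n where "n \<le> N" "\<bar>t - s n\<bar> \<le> fill_distance T N s"
proof -
  let ?m = "\<lambda>t. MIN n\<in>{..N}. \<bar>t - s n\<bar>"
  have "?m t \<in> (\<lambda>n. \<bar>t - s n\<bar>) ` {..N}"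
    by (rule Min_in) auto
  then obtain n where n: "n \<in> {..N}" "?m t = \<bar>t - s n\<bar>" by blast
  have "?m x \<le> T" if "x \<in> {0..T}" for x
  proof -
    have "?m x \<le> \<bar>x - s 0\<bar>" by (rule Min_le) auto
    moreover have "s 0 = 0" using assms(1) by (simp add: is_mesh_def)
    ultimately show ?thesis using that by simp
  qed
  then have "bdd_above (?m ` {0..T})" by (rule bdd_aboveI2)
  then have "?m t \<le> fill_distance T N s"
    unfolding fill_distance_def by (rule cSUP_upper[OF assms(2)])
  with n that show ?thesis by simp
qed

text \<open>The midpoint of the first cell has distance at least half the length of this cell from
  every mesh point.\<close>

lemma fill_distance_pos:
  assumes "0 < T" "is_mesh T N s"
  shows "0 < fill_distance T N s"
proof -
  have "N \<noteq> 0" using assms by (metis is_mesh_def less_irrefl)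
  then have "0 < s 1" using mesh_strict_mono[OF assms(2), of 0 1] assms(2) \<open>N \<noteq> 0\<close> by (simp add: is_mesh_def)
  moreover have "s 1 \<in> {0..T}" using mesh_in_range[OF assms(2), of 1] \<open>N \<noteq> 0\<close> by simp
  ultimately have "s 1 / 2 \<in> {0..T}" by auto
  from fill_distance_upper[OF assms(2) this] obtain n where
    n: "n \<le> N" "\<bar>s 1 / 2 - s n\<bar> \<le> fill_distance T N s" .
  have "s n = 0 \<or> s 1 \<le> s n"
  proof (cases "n = 0")
    case True then show ?thesis using assms(2) by (simp add: is_mesh_def)
  next
    case False
    then show ?thesis using mesh_strict_mono[OF assms(2), of 1 n] n(1) by (cases "n = 1") auto
  qed
  with n(2) \<open>0 < s 1\<close> show ?thesis by auto
qed

lemma mesh_point_in_interval: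
  assumes "is_mesh T N s" "0 \<le> a" "b \<le> T" "2 * fill_distance T N s \<le> b - a" "a \<le> b"
  shows "\<exists>z\<in>{a..b}. z \<in> s ` {..N}"
proof -
  have "(a + b) / 2 \<in> {0..T}" using assms by auto
  from fill_distance_upper[OF assms(1) this] obtain n where
    n: "n \<le> N" "\<bar>(a + b) / 2 - s n\<bar> \<le> fill_distance T N s" .
  then have "s n \<in> {a..b}" using assms(4) by (auto simp: abs_le_iff field_simps)
  then show ?thesis using n(1) by blast
qed

section \<open>Zeros of the derivatives of a function that vanishes on a mesh\<close>

lemma Rolle_within:
  fixes v :: "real \<Rightarrow> real"
  assumes "a < b" "{a..b} \<subseteq> S" "v a = v b"
    and der: "\<And>t. t \<in> S \<Longrightarrow> (v has_vector_derivative v' t) (at t within S)"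
  obtains z where "a < z" "z < b" "v' z = 0"
proof -
  have cont: "continuous_on {a..b} v"
    using has_vector_derivative_continuous_on[OF der] continuous_on_subset assms(2) by blast
  \<comment> \<open>At an interior point the derivative within S is a two-sided one, as Rolle's
    theorem requires.\<close>
  have "(v has_derivative (\<lambda>h. h * v' x)) (at x)" if "a < x" "x < b" for x
  proof -
    have "(v has_vector_derivative v' x) (at x within {a<..<b})"
      using der[of x] that assms(2)
      by (intro has_vector_derivative_within_subset[OF der]) auto
    then have "(v has_vector_derivative v' x) (at x)"
      using that by (simp add: at_within_open[of x "{a<..<b}"])
    then show ?thesis by (simp add: has_vector_derivative_def)
  qed
  from Rolle_deriv[OF assms(1,3) cont this] obtain z where
    "a < z" "z < b" "(\<lambda>h. h * v' z) = (\<lambda>h. 0)" by auto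
  then show ?thesis using that fun_cong[of "\<lambda>h. h * v' z" "\<lambda>h. 0" 1] by auto
qed

text \<open>An interval is cut into thirds. Each outer third contains a zero of \<open>v k\<close>,
  and the middle third keeps these two zeros apart, so that Rolle's theorem applies between them.
  With halves the two zeros could coincide at the common end point. The thirds are the origin of the
  powers of 3 in the constants.\<close>

lemma derivative_zeros_dense:
  fixes v :: "nat \<Rightarrow> real \<Rightarrow> real"
  assumes der: "\<And>k t. k < n \<Longrightarrow> t \<in> {0..T} \<Longrightarrow> (v k has_vector_derivative v (Suc k) t) (at t within {0..T})"
    and base: "\<And>a b. 0 \<le> a \<Longrightarrow> b \<le> T \<Longrightarrow> L \<le> b - a \<Longrightarrow> \<exists>z\<in>{a..b}. v 0 z = 0" and "0 < L"
  shows "k \<le> n \<Longrightarrow> 0 \<le> a \<Longrightarrow> b \<le> T \<Longrightarrow> 3 ^ k * L \<le> b - a \<Longrightarrow> \<exists>z\<in>{a..b}. v k z = 0"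
proof (induction k arbitrary: a b)
  case 0
  then show ?case using base by simp
next
  case (Suc k)
  define l where "l = (b - a) / 3"
  have l: "3 ^ k * L \<le> l" and b: "b = a + 3 * l"
    using Suc.prems(4) by (auto simp: l_def field_simps)
  moreover have "0 < 3 ^ k * L" using \<open>0 < L\<close> by simp
  ultimately have "0 < l" by linarith
  obtain x where x: "x \<in> {a..a + l}" "v k x = 0"
    using Suc.IH[of a "a + l"] Suc.prems l b \<open>0 < l\<close> by auto
  obtain y where y: "y \<in> {a + 2 * l..b}" "v k y = 0"
    using Suc.IH[of "a + 2 * l" b] Suc.prems l b \<open>0 < l\<close> by auto
  have xy: "x < y" "{x..y} \<subseteq> {0..T}"
    using x(1) y(1) Suc.prems(2,3) \<open>0 < l\<close> by auto
  have "k < n" using Suc.prems(1) by simp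
  obtain z where "x < z" "z < y" "v (Suc k) z = 0"
    using Rolle_within[OF xy _ der[OF \<open>k < n\<close>]] x(2) y(2) by auto
  then show ?case using x y by (intro bexI[of _ z]) auto
qed

text \<open>Cauchy--Schwarz against the constant 1, obtained from the nonnegative integral of the
  square of \<phi> - c, where c is the mean value of \<phi>.\<close>

lemma square_integral_le:
  fixes \<phi> :: "real \<Rightarrow> real"
  assumes "s \<le> t" "(\<phi> has_integral d) {s..t}" "(\<lambda>x. (\<phi> x)\<^sup>2) integrable_on {s..t}"
  shows "d\<^sup>2 \<le> (t - s) * integral {s..t} (\<lambda>x. (\<phi> x)\<^sup>2)"
proof (cases "s = t")
  case True
  then have "d = 0" using assms(2) has_integral_unique[OF _ has_integral_null_real[of s t \<phi>]] by simp
  then show ?thesis using True by simp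
next
  case False
  with assms(1) have "s < t" by simp
  define c where "c = d / (t - s)"
  have "((\<lambda>x. (\<phi> x)\<^sup>2 - 2 * c * \<phi> x + c\<^sup>2) has_integral
      (integral {s..t} (\<lambda>x. (\<phi> x)\<^sup>2) - 2 * c * d + (t - s) * c\<^sup>2)) {s..t}"
    using assms(1) has_integral_const_real[of "c\<^sup>2" s t]
    by (intro has_integral_add has_integral_diff integrable_integral[OF assms(3)]
        has_integral_mult_right assms(2)) simp
  then have "0 \<le> integral {s..t} (\<lambda>x. (\<phi> x)\<^sup>2) - 2 * c * d + (t - s) * c\<^sup>2"
  proof (rule has_integral_nonneg)
    show "0 \<le> (\<phi> x)\<^sup>2 - 2 * c * \<phi> x + c\<^sup>2" for x
      using zero_le_power2[of "\<phi> x - c"] by (simp add: power2_diff algebra_simps)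
  qed
  moreover have "(t - s) * c\<^sup>2 = c * d" "c * d = d\<^sup>2 / (t - s)"
    using \<open>s < t\<close> by (simp_all add: c_def power2_eq_square)
  ultimately have "d\<^sup>2 / (t - s) \<le> integral {s..t} (\<lambda>x. (\<phi> x)\<^sup>2)" by simp
  then show ?thesis using \<open>s < t\<close> by (simp add: field_simps)
qed

text \<open>With \<open>\<Phi>\<close> the primitive of \<open>\<phi>\<^sup>2\<close>, Cauchy--Schwarz on the way to the nearest zero gives
  \<open>w(t)\<^sup>2 \<le> L (\<Phi>(t + L) - \<Phi>(t - L))\<close>, and the integral of the right-hand side telescopes.\<close>

lemma near_zeros_bounds:
  fixes \<phi> w :: "real \<Rightarrow> real"
  assumes "0 < T" "0 < L" and sq: "(\<lambda>x. (\<phi> x)\<^sup>2) integrable_on {0..T}"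
    and incr: "\<And>s t. 0 \<le> s \<Longrightarrow> s \<le> t \<Longrightarrow> t \<le> T \<Longrightarrow> (\<phi> has_integral w t - w s) {s..t}"
    and cont: "continuous_on {0..T} w"
    and zeros: "\<And>t. t \<in> {0..T} \<Longrightarrow> \<exists>z\<in>{0..T}. \<bar>t - z\<bar> \<le> L \<and> w z = 0"
  shows "\<And>t. t \<in> {0..T} \<Longrightarrow> (w t)\<^sup>2 \<le> L * integral {0..T} (\<lambda>x. (\<phi> x)\<^sup>2)"
    and "integral {0..T} (\<lambda>x. (w x)\<^sup>2) \<le> 2 * L\<^sup>2 * integral {0..T} (\<lambda>x. (\<phi> x)\<^sup>2)"
proof -
  define \<Phi> where "\<Phi> x = integral {0..x} (\<lambda>x. (\<phi> x)\<^sup>2)" for x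
  \<comment> \<open>\<Phi> continued by constants beyond \<open>{0..T}\<close>, because t - L and t
    + L may leave the interval.\<close>
  define \<Psi> where "\<Psi> x = \<Phi> (max 0 (min x T))" for x
  have int: "(\<lambda>x. (\<phi> x)\<^sup>2) integrable_on {s..t}" if "0 \<le> s" "t \<le> T" for s t
    using integrable_subinterval_real[OF sq] that by simp
  have diff: "\<Phi> t - \<Phi> s = integral {s..t} (\<lambda>x. (\<phi> x)\<^sup>2)" if "0 \<le> s" "s \<le> t" "t \<le> T" for s t
    using Henstock_Kurzweil_Integration.integral_combine[OF that(1,2) int[OF order_refl that(3)]]
    by (simp add: \<Phi>_def)
  have mono: "\<Phi> s \<le> \<Phi> t" if "0 \<le> s" "s \<le> t" "t \<le> T" for s t
    using diff[OF that] integral_nonneg[OF int[OF that(1,3)]] by simp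
  have "\<Phi> 0 = 0" by (simp add: \<Phi>_def)
  have \<Psi>_mono: "\<Psi> s \<le> \<Psi> t" if "s \<le> t" for s t
    unfolding \<Psi>_def using that \<open>0 < T\<close> by (intro mono) auto
  have \<Psi>0: "0 \<le> \<Psi> x" and \<Psi>T: "\<Psi> x \<le> \<Phi> T" for x
  proof -
    have "0 \<le> max 0 (min x T)" "max 0 (min x T) \<le> T" using \<open>0 < T\<close> by auto
    then show "0 \<le> \<Psi> x" "\<Psi> x \<le> \<Phi> T"
      using mono[of 0 "max 0 (min x T)"] mono[of "max 0 (min x T)" T] \<open>\<Phi> 0 = 0\<close>
      unfolding \<Psi>_def by linarith+
  qed
  have \<Psi>_eq: "\<Psi> x = \<Phi> x" if "x \<in> {0..T}" for x using that by (simp add: \<Psi>_def)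
  have w2: "(w t)\<^sup>2 \<le> L * (\<Psi> (t + L) - \<Psi> (t - L))" if t: "t \<in> {0..T}" for t
  proof -
    obtain z where z: "z \<in> {0..T}" "\<bar>t - z\<bar> \<le> L" "w z = 0" using zeros[OF t] by blast
    define lo hi where "lo = min t z" and "hi = max t z"
    have lh: "0 \<le> lo" "lo \<le> hi" "hi \<le> T" "hi - lo \<le> L" "t - L \<le> lo" "hi \<le> t + L"
      using t z by (auto simp: lo_def hi_def)
    have "(w hi - w lo)\<^sup>2 \<le> (hi - lo) * integral {lo..hi} (\<lambda>x. (\<phi> x)\<^sup>2)"
      by (rule square_integral_le[OF lh(2) incr[OF lh(1-3)] int[OF lh(1,3)]])
    also have "\<dots> = (hi - lo) * (\<Psi> hi - \<Psi> lo)"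
      using lh by (simp add: diff \<Psi>_eq)
    also have "\<dots> \<le> L * (\<Psi> (t + L) - \<Psi> (t - L))"
      using lh \<Psi>_mono[of lo hi] \<Psi>_mono[of hi "t + L"] \<Psi>_mono[of "t - L" lo]
      by (intro mult_mono) auto
    finally show ?thesis
      using z(3) by (cases "t \<le> z") (auto simp: lo_def hi_def)
  qed
  show "(w t)\<^sup>2 \<le> L * integral {0..T} (\<lambda>x. (\<phi> x)\<^sup>2)" if t: "t \<in> {0..T}" for t
  proof -
    have "\<Psi> (t + L) - \<Psi> (t - L) \<le> \<Phi> T" using \<Psi>0[of "t - L"] \<Psi>T[of "t + L"] by simp
    then show ?thesis
      using w2[OF t] \<open>0 < L\<close> by (fold \<Phi>_def) (meson mult_left_mono order_trans less_imp_le)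
  qed
  have "continuous_on {0..T} \<Phi>"
    unfolding \<Phi>_def by (rule indefinite_integral_continuous_1[OF sq])
  then have \<Psi>_cont: "continuous_on X \<Psi>" for X
    unfolding \<Psi>_def
    by (rule continuous_on_compose2) (use \<open>0 < T\<close> in \<open>auto intro!: continuous_intros\<close>)
  \<comment> \<open>A primitive of \<Psi>. The integral of \<Psi>(t + L) - \<Psi>(t - L) over
    \<open>{0..T}\<close> becomes the integral of \<Psi> over an interval of length 2L around T
    minus that over one around 0; the former is at most 2L \<Phi>(T), the latter is
    nonnegative.\<close>
  define P where "P x = integral {-L..x} \<Psi>" for x
  have P: "(P has_vector_derivative \<Psi> x) (at x within {-L..T + L})" if "x \<in> {-L..T + L}" for x
    unfolding P_def using that by (intro integral_has_vector_derivative \<Psi>_cont)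
  have P_diff: "P t - P s = integral {s..t} \<Psi>" if "-L \<le> s" "s \<le> t" for s t
    using Henstock_Kurzweil_Integration.integral_combine[OF that integrable_continuous_real[OF \<Psi>_cont]]
    by (simp add: P_def)
  have "((\<lambda>t. P (t + L) - P (t - L)) has_vector_derivative \<Psi> (t + L) - \<Psi> (t - L)) (at t within {0..T})"
    if t: "t \<in> {0..T}" for t
  proof (rule has_vector_derivative_diff)
    have "((P \<circ> (\<lambda>t. t + L)) has_vector_derivative 1 *\<^sub>R \<Psi> (t + L)) (at t within {0..T})"
      using t \<open>0 < L\<close>
      by (intro vector_diff_chain_within has_vector_derivative_within_subset[OF P])
        (auto intro!: derivative_eq_intros)
    then show "((\<lambda>t. P (t + L)) has_vector_derivative \<Psi> (t + L)) (at t within {0..T})"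
      by (simp add: o_def)
    have "((P \<circ> (\<lambda>t. t - L)) has_vector_derivative 1 *\<^sub>R \<Psi> (t - L)) (at t within {0..T})"
      using t \<open>0 < L\<close>
      by (intro vector_diff_chain_within has_vector_derivative_within_subset[OF P])
        (auto intro!: derivative_eq_intros)
    then show "((\<lambda>t. P (t - L)) has_vector_derivative \<Psi> (t - L)) (at t within {0..T})"
      by (simp add: o_def)
  qed
  then have I: "((\<lambda>t. \<Psi> (t + L) - \<Psi> (t - L)) has_integral
      (P (T + L) - P (T - L)) - (P (0 + L) - P (0 - L))) {0..T}"
    using \<open>0 < T\<close> by (intro fundamental_theorem_of_calculus) auto
  have "P (T + L) - P (T - L) = integral {T - L..T + L} \<Psi>"
    using \<open>0 < T\<close> \<open>0 < L\<close> by (intro P_diff) auto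
  also have "\<dots> \<le> integral {T - L..T + L} (\<lambda>x. \<Phi> T)"
    by (intro integral_le integrable_continuous_real \<Psi>_cont \<Psi>T continuous_on_const)
  also have "\<dots> = 2 * L * \<Phi> T" using \<open>0 < L\<close> by simp
  finally have "P (T + L) - P (T - L) \<le> 2 * L * \<Phi> T" .
  moreover have "0 \<le> P (0 + L) - P (0 - L)"
    using \<open>0 < L\<close> \<Psi>0
    by (subst P_diff) (auto intro!: integral_nonneg integrable_continuous_real \<Psi>_cont)
  ultimately have le: "integral {0..T} (\<lambda>t. \<Psi> (t + L) - \<Psi> (t - L)) \<le> 2 * L * \<Phi> T"
    using integral_unique[OF I] by linarith
  have "integral {0..T} (\<lambda>x. (w x)\<^sup>2) \<le> integral {0..T} (\<lambda>t. L * (\<Psi> (t + L) - \<Psi> (t - L)))"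
  proof (rule integral_le)
    show "(\<lambda>x. (w x)\<^sup>2) integrable_on {0..T}"
      by (intro integrable_continuous_real continuous_intros cont)
    show "(\<lambda>t. L * (\<Psi> (t + L) - \<Psi> (t - L))) integrable_on {0..T}"
      using I by (intro integrable_on_mult_right) (rule has_integral_integrable)
  qed (rule w2)
  also have "\<dots> \<le> L * (2 * L * \<Phi> T)"
    using le \<open>0 < L\<close> by simp
  finally show "integral {0..T} (\<lambda>x. (w x)\<^sup>2) \<le> 2 * L\<^sup>2 * integral {0..T} (\<lambda>x. (\<phi> x)\<^sup>2)"
    by (simp add: \<Phi>_def power2_eq_square algebra_simps)
qed


section \<open>Lebesgue norms\<close>

text \<open>Induction downwards from k = n, where the derivative is the merely square integrable
  \<phi>; below that it is the continuous \<open>v (Suc k)\<close>. Each step gains sqrt 2 * L in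
  L_2 and sqrt L from L_2 to the supremum. Both factors are enlarged so that everything is expressed
  in powers of the single length 2L.\<close>

lemma sampling_inequality:
  fixes v :: "nat \<Rightarrow> real \<Rightarrow> real" and \<phi> :: "real \<Rightarrow> real"
  assumes "0 < T" and der: "\<And>k t. k < n \<Longrightarrow> t \<in> {0..T} \<Longrightarrow>
      (v k has_vector_derivative v (Suc k) t) (at t within {0..T})"
    and cont: "continuous_on {0..T} (v n)"
    and incr: "\<And>s t. 0 \<le> s \<Longrightarrow> s \<le> t \<Longrightarrow> t \<le> T \<Longrightarrow> (\<phi> has_integral v n t - v n s) {s..t}"
    and sq: "(\<lambda>x. (\<phi> x)\<^sup>2) integrable_on {0..T}"
    and "0 \<le> M" and M: "integral {0..T} (\<lambda>x. (\<phi> x)\<^sup>2) \<le> M\<^sup>2"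
    and "0 < L" "L \<le> T"
    and zeros: "\<And>k t. k \<le> n \<Longrightarrow> t \<in> {0..T} \<Longrightarrow> \<exists>z\<in>{0..T}. \<bar>t - z\<bar> \<le> L \<and> v k z = 0"
    and "k \<le> n"
  shows "integral {0..T} (\<lambda>x. (v k x)\<^sup>2) \<le> ((2 * L) ^ (n + 1 - k) * M)\<^sup>2 \<and>
    (\<forall>t\<in>{0..T}. (v k t)\<^sup>2 \<le> 2 * L * ((2 * L) ^ (n - k) * M)\<^sup>2)"
proof -
  have contv: "continuous_on {0..T} (v k)" if "k \<le> n" for k
  proof (cases "k = n")
    case False
    with that have "k < n" by simp
    then show ?thesis by (rule has_vector_derivative_continuous_on[OF der])
  qed (simp add: cont)
  have sstep: "integral {0..T} (\<lambda>x. (w x)\<^sup>2) \<le> ((2 * L) ^ Suc j * M)\<^sup>2 \<and>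
      (\<forall>t\<in>{0..T}. (w t)\<^sup>2 \<le> 2 * L * ((2 * L) ^ j * M)\<^sup>2)"
    if "(\<lambda>x. (\<psi> x)\<^sup>2) integrable_on {0..T}"
      and "\<And>s t. 0 \<le> s \<Longrightarrow> s \<le> t \<Longrightarrow> t \<le> T \<Longrightarrow> (\<psi> has_integral w t - w s) {s..t}"
      and "continuous_on {0..T} w"
      and "\<And>t. t \<in> {0..T} \<Longrightarrow> \<exists>z\<in>{0..T}. \<bar>t - z\<bar> \<le> L \<and> w z = 0"
      and I: "integral {0..T} (\<lambda>x. (\<psi> x)\<^sup>2) \<le> ((2 * L) ^ j * M)\<^sup>2"
    for \<psi> w j
  proof -
    have B1: "(w t)\<^sup>2 \<le> L * integral {0..T} (\<lambda>x. (\<psi> x)\<^sup>2)" if "t \<in> {0..T}" for t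
      by (rule near_zeros_bounds(1)[OF \<open>0 < T\<close> \<open>0 < L\<close>]) fact+
    have B2: "integral {0..T} (\<lambda>x. (w x)\<^sup>2) \<le> 2 * L\<^sup>2 * integral {0..T} (\<lambda>x. (\<psi> x)\<^sup>2)"
      by (rule near_zeros_bounds(2)[OF \<open>0 < T\<close> \<open>0 < L\<close>]) fact+
    have "integral {0..T} (\<lambda>x. (w x)\<^sup>2) \<le> 2 * L\<^sup>2 * ((2 * L) ^ j * M)\<^sup>2"
      using I by (intro order_trans[OF B2] mult_left_mono) auto
    also have "\<dots> \<le> (2 * L)\<^sup>2 * ((2 * L) ^ j * M)\<^sup>2"
      by (intro mult_right_mono) (auto simp: power_mult_distrib)
    also have "\<dots> = ((2 * L) ^ Suc j * M)\<^sup>2"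
      by (simp add: power_mult_distrib algebra_simps)
    finally have 1: "integral {0..T} (\<lambda>x. (w x)\<^sup>2) \<le> ((2 * L) ^ Suc j * M)\<^sup>2" .
    have "(w t)\<^sup>2 \<le> 2 * L * ((2 * L) ^ j * M)\<^sup>2" if "t \<in> {0..T}" for t
    proof -
      have "(w t)\<^sup>2 \<le> L * ((2 * L) ^ j * M)\<^sup>2"
        using I \<open>0 < L\<close> by (intro order_trans[OF B1[OF that]] mult_left_mono) auto
      also have "\<dots> \<le> 2 * L * ((2 * L) ^ j * M)\<^sup>2"
        using \<open>0 < L\<close> by (intro mult_right_mono) auto
      finally show ?thesis .
    qed
    with 1 show ?thesis by blast
  qed
  show ?thesis
    using \<open>k \<le> n\<close>
  proof (induction k rule: inc_induct)
    case base
    show ?case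
      using sstep[OF sq incr cont zeros[OF order_refl], of 0] M by simp
  next
    case (step k)
    have "k < n" "k \<le> n" using step.hyps by auto
    have "n - k = Suc (n - Suc k)" "n + 1 - Suc k = n - k" "n + 1 - k = Suc (n - k)"
      using \<open>k < n\<close> by auto
    moreover have "integral {0..T} (\<lambda>x. (v k x)\<^sup>2) \<le> ((2 * L) ^ Suc (n - k) * M)\<^sup>2 \<and>
      (\<forall>t\<in>{0..T}. (v k t)\<^sup>2 \<le> 2 * L * ((2 * L) ^ (n - k) * M)\<^sup>2)"
    proof (rule sstep[where \<psi> = "v (Suc k)"])
      show "(v (Suc k) has_integral v k t - v k s) {s..t}" if "0 \<le> s" "s \<le> t" "t \<le> T" for s t
        using that by (intro fundamental_theorem_of_calculus has_vector_derivative_within_subset[OF der[OF \<open>k < n\<close>]]) auto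
    qed (use step.IH \<open>k < n\<close> \<open>k \<le> n\<close> zeros contv in
        \<open>auto intro!: integrable_continuous_real continuous_intros simp: Suc_leI\<close>)
    ultimately show ?case by simp
  qed
qed

lemma recip_finite:
  assumes "1 \<le> q" "q \<noteq> \<infinity>"
  shows "1 \<le> enn2real q" "recip q = 1 / enn2real q" "q = ennreal (enn2real q)"
proof -
  show q: "q = ennreal (enn2real q)" using assms(2) by (simp add: less_top)
  show 1: "1 \<le> enn2real q" using assms by (metis ennreal_le_1 ennreal_1 ennreal_leI q enn2real_1 enn2real_mono less_top infinity_ennreal_def)
  show "recip q = 1 / enn2real q"
    unfolding recip_def using 1 by (subst q, subst inverse_ennreal) (auto simp: inverse_eq_divide)
qed

lemma recip_bounds:
  assumes "1 \<le> q"
  shows "0 \<le> recip q" "recip q \<le> 1"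
  using recip_finite[OF assms] by (cases "q = \<infinity>"; simp add: recip_def)+

text \<open>A continuous majorant g carries the estimate from the nonnegative Lebesgue integral in
  \<open>Lq_norm\<close> over to the gauge integral, and its finite integral excludes the infinite
  branch of the definition.\<close>

lemma Lq_norm_le_dominated:
  assumes "0 \<le> T" "continuous_on {0..T} u" "1 \<le> q" "q \<noteq> \<infinity>"
    and "continuous_on {0..T} g" "integral {0..T} g \<le> G"
    and dom: "\<And>t. t \<in> {0..T} \<Longrightarrow> \<bar>u t\<bar> powr enn2real q \<le> g t"
  shows "Lq_norm {0..T} q u \<le> ennreal (G powr recip q)"
proof -
  let ?M = "lebesgue_on {0..T}"
  let ?I = "\<integral>\<^sup>+ t. ennreal (\<bar>u t\<bar> powr enn2real q) \<partial>?M"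
  have meas: "u \<in> borel_measurable ?M"
    by (rule continuous_imp_measurable_on_sets_lebesgue[OF assms(2)]) simp
  have g0: "0 \<le> g t" if "t \<in> {0..T}" for t
    using dom[OF that] by (meson order_trans powr_ge_zero)
  have int: "integrable ?M g"
    using continuous_imp_integrable_real[OF assms(5)] .
  have "?I \<le> (\<integral>\<^sup>+ t. ennreal (g t) \<partial>?M)"
    using dom by (intro nn_integral_mono ennreal_leI) auto
  also have "\<dots> = ennreal (integral\<^sup>L ?M g)"
    using g0 by (intro nn_integral_eq_integral int AE_I2) auto
  also have "integral\<^sup>L ?M g = integral {0..T} g"
    using int by (intro lebesgue_integral_eq_integral) auto
  also have "ennreal \<dots> \<le> ennreal G" by (intro ennreal_leI assms(6))
  finally have I: "?I \<le> ennreal G" .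
  then have fin: "?I \<noteq> \<infinity>" by (auto simp: top_unique)
  have "0 \<le> integral {0..T} g"
    using g0 by (intro integral_nonneg integrable_continuous_real assms(5)) auto
  then have "0 \<le> G" using assms(6) by linarith
  then have "enn2real ?I \<le> G" using I by (rule enn2real_leI)
  then have "enn2real ?I powr recip q \<le> G powr recip q"
    using recip_bounds[OF assms(3)] by (intro powr_mono2) auto
  then show ?thesis
    using meas fin assms(4) by (simp add: Lq_norm_def Let_def ennreal_leI)
qed

text \<open>One formula covers all q: for infinite q, \<open>recip q\<close> is 0, and the power of
  T > 0 becomes 1.\<close>

lemma Lq_norm_le_sup:
  assumes "0 < T" "continuous_on {0..T} u" "1 \<le> q" "0 \<le> S"
    and S: "\<And>t. t \<in> {0..T} \<Longrightarrow> \<bar>u t\<bar> \<le> S"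
  shows "Lq_norm {0..T} q u \<le> ennreal (S * T powr recip q)"
proof (cases "q = \<infinity>")
  case True
  have meas: "u \<in> borel_measurable (lebesgue_on {0..T})"
    by (rule continuous_imp_measurable_on_sets_lebesgue[OF assms(2)]) simp
  then have "Lq_norm {0..T} q u = esssup (lebesgue_on {0..T}) (\<lambda>t. ennreal \<bar>u t\<bar>)"
    using True by (simp add: Lq_norm_def)
  also have "\<dots> \<le> ennreal S"
    using meas S by (intro esssup_I AE_I2 ennreal_leI) auto
  finally show ?thesis using True \<open>0 < T\<close> by (simp add: recip_def)
next
  case False
  note q = recip_finite[OF assms(3) False]
  have "Lq_norm {0..T} q u \<le> ennreal ((S powr enn2real q * T) powr recip q)"
    using assms q False by (intro Lq_norm_le_dominated[where g = "\<lambda>_. S powr enn2real q"] powr_mono2) auto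
  also have "(S powr enn2real q * T) powr recip q = S * T powr recip q"
    using assms(1,4) q by (simp add: powr_mult powr_powr)
  finally show ?thesis .
qed

text \<open>For \<open>q \<le> 2\<close>, the cheap bound \<open>|x|\<^sup>q \<le> 1 + x\<^sup>2\<close> replaces Hoelder's inequality, at the cost of the
  factor \<open>T + 1\<close>; for \<open>q > 2\<close>, \<open>|u|\<^sup>q \<le> S\<^sup>q\<^sup>-\<^sup>2 u\<^sup>2\<close>.\<close>

lemma Lq_norm_interpolate:
  assumes "0 < T" and cont: "continuous_on {0..T} u" and "1 \<le> q" "0 < A" "0 < S"
    and A: "integral {0..T} (\<lambda>x. (u x)\<^sup>2) \<le> A\<^sup>2"
    and S: "\<And>t. t \<in> {0..T} \<Longrightarrow> \<bar>u t\<bar> \<le> S"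
  shows "Lq_norm {0..T} q u \<le> ennreal ((T + 1) *
    (if 1/2 \<le> recip q then A else S powr (1 - 2 * recip q) * A powr (2 * recip q)))"
proof (cases "q = \<infinity>")
  case True
  have "Lq_norm {0..T} q u \<le> ennreal S"
    using Lq_norm_le_sup[OF assms(1,2,3) _ S] \<open>0 < S\<close> \<open>0 < T\<close> True by (simp add: recip_def)
  also have "\<dots> \<le> ennreal ((T + 1) * S)" using \<open>0 < S\<close> \<open>0 < T\<close> by (intro ennreal_leI) simp
  finally show ?thesis using True \<open>0 < S\<close> \<open>0 < A\<close> by (simp add: recip_def)
next
  case False
  define p where "p = enn2real q"
  note q = recip_finite[OF assms(3) False, folded p_def]
  have cont2: "continuous_on {0..T} (\<lambda>x. (u x)\<^sup>2)" by (intro continuous_intros cont)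
  show ?thesis
  proof (cases "p \<le> 2")
    case True
    have "Lq_norm {0..T} q u \<le> ennreal ((A powr p * (T + 1)) powr recip q)"
    proof (rule Lq_norm_le_dominated[OF _ cont assms(3) False])
      \<comment> \<open>The elementary inequality is applied to u/A rather than to u. The majorant
        then has an integral of order A^p, and the p-th root returns A.\<close>
      show "continuous_on {0..T} (\<lambda>x. A powr p * (1 + (u x)\<^sup>2 / A\<^sup>2))"
        using \<open>0 < A\<close> by (intro continuous_intros cont) auto
      have "integral {0..T} (\<lambda>x. A powr p * (1 + (u x)\<^sup>2 / A\<^sup>2))
          = A powr p * (T + integral {0..T} (\<lambda>x. (u x)\<^sup>2) / A\<^sup>2)"
        using \<open>0 < T\<close> \<open>0 < A\<close>
        by (subst integral_mult_right, subst integral_add)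
          (auto intro!: integrable_continuous_real continuous_intros cont)
      also have "\<dots> \<le> A powr p * (T + 1)"
        using A \<open>0 < A\<close> by (intro mult_left_mono add_left_mono) (auto simp: divide_le_eq)
      finally show "integral {0..T} (\<lambda>x. A powr p * (1 + (u x)\<^sup>2 / A\<^sup>2)) \<le> A powr p * (T + 1)" .
      show "\<bar>u t\<bar> powr enn2real q \<le> A powr p * (1 + (u t)\<^sup>2 / A\<^sup>2)" if "t \<in> {0..T}" for t
      proof -
        have "(\<bar>u t\<bar> / A) powr p \<le> 1 + (\<bar>u t\<bar> / A)\<^sup>2"
        proof (cases "\<bar>u t\<bar> / A \<le> 1")
          case le: True
          then have "(\<bar>u t\<bar> / A) powr p \<le> 1" using \<open>0 < A\<close> q(1) by (intro powr_le1) auto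
          then show ?thesis by (smt (verit) zero_le_power2)
        next
          case ge: False
          then have "(\<bar>u t\<bar> / A) powr p \<le> (\<bar>u t\<bar> / A) powr 2" using True by (intro powr_mono) auto
          also have "\<dots> = (\<bar>u t\<bar> / A)\<^sup>2" using ge by (subst powr_numeral) auto
          finally show ?thesis by simp
        qed
        then have "A powr p * (\<bar>u t\<bar> / A) powr p \<le> A powr p * (1 + (u t)\<^sup>2 / A\<^sup>2)"
          by (intro mult_left_mono) (auto simp: power_divide)
        moreover have "A powr p * (\<bar>u t\<bar> / A) powr p = \<bar>u t\<bar> powr p"
          using \<open>0 < A\<close> by (simp flip: powr_mult)
        ultimately show ?thesis by (simp add: p_def)
      qed
    qed (use \<open>0 < T\<close> in auto)
    also have "(A powr p * (T + 1)) powr recip q = A * (T + 1) powr recip q"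
      using \<open>0 < A\<close> \<open>0 < T\<close> q by (simp add: powr_mult powr_powr)
    also have "ennreal \<dots> \<le> ennreal (A * (T + 1))"
      using \<open>0 < A\<close> \<open>0 < T\<close> powr_mono[of "recip q" 1 "T + 1"] recip_bounds[OF assms(3)]
      by (intro ennreal_leI mult_left_mono) auto
    finally have "Lq_norm {0..T} q u \<le> ennreal (A * (T + 1))" .
    moreover have "1/2 \<le> recip q" unfolding q(2) using True q(1) by (simp add: field_simps)
    ultimately show ?thesis by (simp add: mult.commute)
  next
    case gt: False
    have "Lq_norm {0..T} q u \<le> ennreal ((S powr (p - 2) * A\<^sup>2) powr recip q)"
    proof (rule Lq_norm_le_dominated[OF _ cont assms(3) False])
      show "continuous_on {0..T} (\<lambda>x. S powr (p - 2) * (u x)\<^sup>2)"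
        by (intro continuous_intros cont)
      show "integral {0..T} (\<lambda>x. S powr (p - 2) * (u x)\<^sup>2) \<le> S powr (p - 2) * A\<^sup>2"
        using A by (subst integral_mult_right) (auto intro!: mult_left_mono)
      show "\<bar>u t\<bar> powr enn2real q \<le> S powr (p - 2) * (u t)\<^sup>2" if "t \<in> {0..T}" for t
      proof (cases "u t = 0")
        case nz: False
        have "\<bar>u t\<bar> powr p = \<bar>u t\<bar> powr (p - 2) * \<bar>u t\<bar> powr 2"
          unfolding powr_add[symmetric] by simp
        also have "\<dots> = \<bar>u t\<bar> powr (p - 2) * (u t)\<^sup>2"
          using nz by (subst powr_numeral) auto
        also have "\<dots> \<le> S powr (p - 2) * (u t)\<^sup>2"
          using S[OF that] gt by (intro mult_right_mono powr_mono2) auto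
        finally show ?thesis by (simp add: p_def)
      qed simp
    qed (use \<open>0 < T\<close> in auto)
    also have "(S powr (p - 2) * A\<^sup>2) powr recip q = S powr (1 - 2 * recip q) * A powr (2 * recip q)"
    proof -
      have "A\<^sup>2 = A powr 2" using \<open>0 < A\<close> by (subst powr_numeral) auto
      moreover have "(p - 2) * recip q = 1 - 2 * recip q"
        using q(1,2) by (simp add: field_simps)
      ultimately show ?thesis
        using \<open>0 < A\<close> \<open>0 < S\<close> by (simp only: powr_mult powr_powr powr_ge_zero)
    qed
    also have "ennreal \<dots> \<le> ennreal ((T + 1) * (S powr (1 - 2 * recip q) * A powr (2 * recip q)))"
      using \<open>0 < T\<close> by (intro ennreal_leI) (simp add: mult_le_cancel_right1 not_less)
    finally have "Lq_norm {0..T} q u \<le> \<dots>" .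
    moreover have "\<not> 1/2 \<le> recip q" unfolding q(2) using gt q(1) by (simp add: field_simps)
    ultimately show ?thesis by simp
  qed
qed

text \<open>The origin of the exponent (1/2 - 1/q)_+. The L_2 norm is of order h^(j+1) and the
  supremum of order h^(j+1/2). For q > 2, interpolation with weight 2/q gives (j + 1/2)(1 - 2/q) +
  (j + 1)(2/q) = j + 1 - (1/2 - 1/q).\<close>

lemma Lq_norm_scaled:
  assumes "0 < T" and cont: "continuous_on {0..T} u" and "1 \<le> q" "0 < h" "0 < M"
    and A: "integral {0..T} (\<lambda>x. (u x)\<^sup>2) \<le> (h ^ Suc j * M)\<^sup>2"
    and S: "\<And>t. t \<in> {0..T} \<Longrightarrow> (u t)\<^sup>2 \<le> h * (h ^ j * M)\<^sup>2"
  shows "Lq_norm {0..T} q u \<le> ennreal ((T + 1) * (h powr (real (Suc j) - max (1/2 - recip q) 0) * M))"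
proof -
  have hA: "h ^ Suc j = h powr real (Suc j)" using \<open>0 < h\<close> by (simp only: powr_realpow)
  have hS: "sqrt (h * (h ^ j * M)\<^sup>2) = h powr (real j + 1/2) * M"
    using \<open>0 < h\<close> \<open>0 < M\<close> by (simp add: real_sqrt_mult powr_add powr_realpow powr_half_sqrt)
  have "Lq_norm {0..T} q u \<le> ennreal ((T + 1) * (if 1/2 \<le> recip q then h ^ Suc j * M
      else (h powr (real j + 1/2) * M) powr (1 - 2 * recip q) * (h ^ Suc j * M) powr (2 * recip q)))"
  proof (rule Lq_norm_interpolate[OF \<open>0 < T\<close> cont \<open>1 \<le> q\<close> _ _ A])
    show "\<bar>u t\<bar> \<le> h powr (real j + 1/2) * M" if "t \<in> {0..T}" for t
      using real_sqrt_le_mono[OF S[OF that]] by (simp only: hS real_sqrt_abs)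
  qed (use assms in auto)
  also have "(if 1/2 \<le> recip q then h ^ Suc j * M
      else (h powr (real j + 1/2) * M) powr (1 - 2 * recip q) * (h ^ Suc j * M) powr (2 * recip q))
    = h powr (real (Suc j) - max (1/2 - recip q) 0) * M"
  proof (cases "1/2 \<le> recip q")
    case True
    then have "max (1/2 - recip q) 0 = 0" by simp
    then show ?thesis using True hA by simp
  next
    case False
    have interp: "(h powr a * M) powr (1 - \<theta>) * (h powr b * M) powr \<theta>
        = h powr (a * (1 - \<theta>) + b * \<theta>) * M" for a b \<theta>
    proof -
      have "(h powr a * M) powr (1 - \<theta>) * (h powr b * M) powr \<theta>
          = h powr (a * (1 - \<theta>)) * h powr (b * \<theta>) * (M powr (1 - \<theta>) * M powr \<theta>)"
        using \<open>0 < M\<close> by (simp add: powr_mult powr_powr)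
      also have "\<dots> = h powr (a * (1 - \<theta>) + b * \<theta>) * M"
        using \<open>0 < M\<close> by (simp flip: powr_add)
      finally show ?thesis .
    qed
    have "(real j + 1/2) * (1 - 2 * recip q) + real (Suc j) * (2 * recip q)
        = real (Suc j) - max (1/2 - recip q) 0"
      using False by (simp add: max_def algebra_simps)
    then show ?thesis using False unfolding hA interp by simp
  qed
  finally show ?thesis .
qed


section \<open>Composition of functions of class k\<close>

text \<open>A quantitative class C^k in which one number bounds the function and all its derivatives
  up to order k. This lets constants be chosen before the function is known.\<close>

primrec bounded_Ck :: "real \<Rightarrow> nat \<Rightarrow> real \<Rightarrow> (real \<Rightarrow> real) \<Rightarrow> bool" where
  "bounded_Ck T 0 M g \<longleftrightarrow> continuous_on {0..T} g \<and> (\<forall>t\<in>{0..T}. \<bar>g t\<bar> \<le> M)"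
| "bounded_Ck T (Suc k) M g \<longleftrightarrow> (\<forall>t\<in>{0..T}. \<bar>g t\<bar> \<le> M) \<and>
     (\<exists>g'. (\<forall>t\<in>{0..T}. (g has_vector_derivative g' t) (at t within {0..T})) \<and> bounded_Ck T k M g')"

lemma bounded_Ck_SucI:
  assumes "\<And>t. t \<in> {0..T} \<Longrightarrow> \<bar>g t\<bar> \<le> M"
    and "\<And>t. t \<in> {0..T} \<Longrightarrow> (g has_vector_derivative g' t) (at t within {0..T})"
    and "bounded_Ck T k M g'"
  shows "bounded_Ck T (Suc k) M g"
  using assms unfolding bounded_Ck.simps by (intro conjI ballI exI[of _ g']) auto

lemma bounded_Ck_SucE:
  assumes "bounded_Ck T (Suc k) M g"
  obtains g' where "\<And>t. t \<in> {0..T} \<Longrightarrow> (g has_vector_derivative g' t) (at t within {0..T})"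
    "bounded_Ck T k M g'"
proof -
  have "\<exists>g'. (\<forall>t\<in>{0..T}. (g has_vector_derivative g' t) (at t within {0..T})) \<and> bounded_Ck T k M g'"
    using assms by simp
  then show ?thesis using that by blast
qed

lemma bounded_CkD:
  assumes "bounded_Ck T k M g"
  shows "continuous_on {0..T} g" "\<And>t. t \<in> {0..T} \<Longrightarrow> \<bar>g t\<bar> \<le> M"
proof -
  show "\<And>t. t \<in> {0..T} \<Longrightarrow> \<bar>g t\<bar> \<le> M" using assms by (cases k) auto
  show "continuous_on {0..T} g"
  proof (cases k)
    case (Suc j)
    then obtain g' where "\<And>t. t \<in> {0..T} \<Longrightarrow> (g has_vector_derivative g' t) (at t within {0..T})"
      using assms unfolding Suc bounded_Ck.simps by blast
    then show ?thesis by (rule has_vector_derivative_continuous_on)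
  qed (use assms in simp)
qed

lemma bounded_Ck_SucD: "bounded_Ck T (Suc k) M g \<Longrightarrow> bounded_Ck T k M g"
proof (induction k arbitrary: g)
  case 0
  then show ?case using bounded_CkD[OF 0] by simp
next
  case (Suc k)
  from Suc.prems show ?case
    unfolding bounded_Ck.simps(2)[of T "Suc k"] bounded_Ck.simps(2)[of T k M g] using Suc.IH by blast
qed

lemma bounded_Ck_mono: "bounded_Ck T k M g \<Longrightarrow> M \<le> N \<Longrightarrow> bounded_Ck T k N g"
proof (induction k arbitrary: g)
  case 0
  then show ?case by force
next
  case (Suc k)
  have "\<bar>g t\<bar> \<le> N" if "t \<in> {0..T}" for t
    using bounded_CkD(2)[OF Suc.prems(1) that] Suc.prems(2) by linarith
  then show ?case using Suc unfolding bounded_Ck.simps by blast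
qed

lemma bounded_Ck_add:
  "bounded_Ck T k M g \<Longrightarrow> bounded_Ck T k N h \<Longrightarrow> bounded_Ck T k (M + N) (\<lambda>t. g t + h t)"
proof (induction k arbitrary: g h)
  case 0
  then show ?case by (fastforce intro: continuous_on_add abs_triangle_ineq[THEN order_trans])
next
  case (Suc k)
  obtain g' where
    g': "\<And>t. t \<in> {0..T} \<Longrightarrow> (g has_vector_derivative g' t) (at t within {0..T})" "bounded_Ck T k M g'"
    using bounded_Ck_SucE[OF Suc.prems(1)] by blast
  obtain h' where
    h': "\<And>t. t \<in> {0..T} \<Longrightarrow> (h has_vector_derivative h' t) (at t within {0..T})" "bounded_Ck T k N h'"
    using bounded_Ck_SucE[OF Suc.prems(2)] by blast
  show ?case
  proof (rule bounded_Ck_SucI)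
    show "\<bar>g t + h t\<bar> \<le> M + N" if "t \<in> {0..T}" for t
      using bounded_CkD(2)[OF Suc.prems(1) that] bounded_CkD(2)[OF Suc.prems(2) that] by linarith
    show "((\<lambda>t. g t + h t) has_vector_derivative g' t + h' t) (at t within {0..T})"
      if "t \<in> {0..T}" for t
      by (rule has_vector_derivative_add[OF g'(1)[OF that] h'(1)[OF that]])
    show "bounded_Ck T k (M + N) (\<lambda>t. g' t + h' t)" by (rule Suc.IH[OF g'(2) h'(2)])
  qed
qed

text \<open>Each use of the product rule doubles the number of terms, whence the factor 2^k.\<close>

lemma bounded_Ck_mult:
  assumes "0 \<le> M" "0 \<le> N"
  shows "bounded_Ck T k M g \<Longrightarrow> bounded_Ck T k N h \<Longrightarrow> bounded_Ck T k (2 ^ k * (M * N)) (\<lambda>t. g t * h t)"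
proof (induction k arbitrary: g h)
  case 0
  then show ?case by (auto intro!: continuous_on_mult mult_mono simp: abs_mult assms)
next
  case (Suc k)
  obtain g' where
    g': "\<And>t. t \<in> {0..T} \<Longrightarrow> (g has_vector_derivative g' t) (at t within {0..T})" "bounded_Ck T k M g'"
    using bounded_Ck_SucE[OF Suc.prems(1)] by blast
  obtain h' where
    h': "\<And>t. t \<in> {0..T} \<Longrightarrow> (h has_vector_derivative h' t) (at t within {0..T})" "bounded_Ck T k N h'"
    using bounded_Ck_SucE[OF Suc.prems(2)] by blast
  show ?case
  proof (rule bounded_Ck_SucI)
    show "((\<lambda>t. g t * h t) has_vector_derivative g t * h' t + g' t * h t) (at t within {0..T})"
      if "t \<in> {0..T}" for t
      by (rule has_vector_derivative_mult[OF g'(1)[OF that] h'(1)[OF that]])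
    have "bounded_Ck T k (2 ^ k * (M * N) + 2 ^ k * (M * N)) (\<lambda>t. g t * h' t + g' t * h t)"
      by (rule bounded_Ck_add[OF Suc.IH[OF bounded_Ck_SucD[OF Suc.prems(1)] h'(2)]
            Suc.IH[OF g'(2) bounded_Ck_SucD[OF Suc.prems(2)]]])
    moreover have "2 ^ k * (M * N) + 2 ^ k * (M * N) = 2 ^ Suc k * (M * N)" by simp
    ultimately show "bounded_Ck T k (2 ^ Suc k * (M * N)) (\<lambda>t. g t * h' t + g' t * h t)"
      by (simp only:)
    show "\<bar>g t * h t\<bar> \<le> 2 ^ Suc k * (M * N)" if "t \<in> {0..T}" for t
    proof -
      have "\<bar>g t * h t\<bar> \<le> M * N"
        unfolding abs_mult using assms
        by (intro mult_mono bounded_CkD(2)[OF Suc.prems(1) that] bounded_CkD(2)[OF Suc.prems(2) that]) auto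
      also have "\<dots> \<le> 2 ^ Suc k * (M * N)"
        using assms one_le_power[of "2::real" "Suc k"] mult_right_mono[of 1 "2 ^ Suc k" "M * N"] by simp
      finally show ?thesis .
    qed
  qed
qed

lemma bounded_Ck_zero: "bounded_Ck T k 0 (\<lambda>t. 0)"
proof (induction k)
  case (Suc k)
  then show ?case
    by (intro bounded_Ck_SucI[where g' = "\<lambda>_. 0"] has_vector_derivative_const) auto
qed simp

lemma bounded_Ck_sum:
  assumes "finite I" "\<And>i. i \<in> I \<Longrightarrow> bounded_Ck T k (M i) (g i)"
  shows "bounded_Ck T k (\<Sum>i\<in>I. M i) (\<lambda>t. \<Sum>i\<in>I. g i t)"
  using assms
proof (induction I rule: finite_induct)
  case (insert i I)
  then show ?case using bounded_Ck_add[of T k "M i" "g i"] by simp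
qed (simp add: bounded_Ck_zero)

section \<open>Restriction, order and linear images in the class C^k\<close>

lemma Ck_on_subset: "Ck_on k S f \<Longrightarrow> S' \<subseteq> S \<Longrightarrow> Ck_on k S' f"
proof (induction k arbitrary: f)
  case 0
  then show ?case by (auto intro: continuous_on_subset)
next
  case (Suc k)
  then obtain f' where f': "\<And>x. x\<in>S \<Longrightarrow> (f has_derivative f' x) (at x within S)" "\<And>v. Ck_on k S (\<lambda>x. f' x v)"
    by auto
  have "(f has_derivative f' x) (at x within S')" if "x \<in> S'" for x
    using f'(1)[of x] that Suc.prems(2) by (blast intro: has_derivative_subset)
  moreover have "Ck_on k S' (\<lambda>x. f' x v)" for v
    by (rule Suc.IH[OF f'(2) Suc.prems(2)])
  ultimately show ?case unfolding Ck_on.simps by blast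
qed

lemma Ck_on_imp_continuous: "Ck_on k S f \<Longrightarrow> continuous_on S f"
  by (cases k) (auto intro: has_derivative_continuous_on)

lemma Ck_on_SucD: "Ck_on (Suc k) S f \<Longrightarrow> Ck_on k S f"
proof (induction k arbitrary: f)
  case 0
  then show ?case using Ck_on_imp_continuous by (metis Ck_on.simps(1))
next
  case (Suc k)
  then obtain f' where f': "\<And>x. x\<in>S \<Longrightarrow> (f has_derivative f' x) (at x within S)" "\<And>v. Ck_on (Suc k) S (\<lambda>x. f' x v)"
    unfolding Ck_on.simps(2)[of "Suc k"] by blast
  then show ?case using Suc.IH[OF f'(2)] unfolding Ck_on.simps(2)[of k S f] by blast
qed

lemma Ck_on_le: "Ck_on k S f \<Longrightarrow> j \<le> k \<Longrightarrow> Ck_on j S f"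
  by (induction k) (use Ck_on_SucD le_Suc_eq in blast)+

lemma Ck_on_bounded_linear:
  assumes "bounded_linear L"
  shows "Ck_on k S f \<Longrightarrow> Ck_on k S (\<lambda>x. L (f x))"
proof (induction k arbitrary: f)
  case 0
  then show ?case using bounded_linear.continuous_on[OF assms] by simp
next
  case (Suc k)
  then obtain f' where f': "\<And>x. x\<in>S \<Longrightarrow> (f has_derivative f' x) (at x within S)" "\<And>v. Ck_on k S (\<lambda>x. f' x v)"
    by auto
  then show ?case using Suc.IH[OF f'(2)]
    by (auto intro!: exI[of _ "\<lambda>x v. L (f' x v)"] bounded_linear.has_derivative[OF assms])
qed

lemma Ck_on_cong:
  assumes "\<And>x. x \<in> S \<Longrightarrow> f x = g x"
  shows "Ck_on k S f \<Longrightarrow> Ck_on k S g"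
proof (cases k)
  case (Suc j)
  assume "Ck_on k S f"
  then show ?thesis
    unfolding Suc Ck_on.simps using assms by (metis has_derivative_transform)
next
  case 0
  assume "Ck_on k S f"
  then show ?thesis
    unfolding 0 Ck_on.simps using assms by (metis continuous_on_cong)
qed

text \<open>Induction on k takes the place of a formula for higher derivatives of a composition: the
  first derivative of h(t, y(t)) is a sum of products of y' with compositions of class k along the
  same y. The bound M is quantified before y, which makes it uniform over all curves with the bound
  R.\<close>

lemma bounded_Ck_compose:
  fixes h :: "real \<times> (real ^ 'd) \<Rightarrow> real"
  assumes "0 \<le> R"
  shows "Ck_on k ({0..T} \<times> UNIV) h \<Longrightarrow> \<exists>M\<ge>0. \<forall>y. (\<forall>j. bounded_Ck T k R (\<lambda>t. y t $ j)) \<longrightarrow>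
    bounded_Ck T k M (\<lambda>t. h (t, y t))"
proof (induction k arbitrary: h)
  \<comment> \<open>All admissible curves run in one compact set, on which the continuous h is
    bounded. This is stated for every k because it is needed both at order 0 and at each
    successor.\<close>
  have bound: "\<exists>M\<ge>0. \<forall>y. (\<forall>j. bounded_Ck T k R (\<lambda>t. y t $ j)) \<longrightarrow> (\<forall>t\<in>{0..T}. \<bar>h (t, y t)\<bar> \<le> M)"
    if cont: "continuous_on ({0..T} \<times> UNIV) h" for h :: "real \<times> (real ^ 'd) \<Rightarrow> real" and k
  proof -
    let ?K = "{0..T} \<times> cball (0 :: real ^ 'd) (CARD('d) * R)"
    have "compact (h ` ?K)"
      by (intro compact_continuous_image continuous_on_subset[OF cont] compact_Times) auto
    then obtain M where M: "\<And>x. x \<in> ?K \<Longrightarrow> \<bar>h x\<bar> \<le> M"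
      using compact_imp_bounded[THEN bounded_iff[THEN iffD1]] by (metis image_eqI real_norm_def)
    have "y t \<in> cball 0 (CARD('d) * R)" if "\<forall>j. bounded_Ck T k R (\<lambda>t. y t $ j)" "t \<in> {0..T}"
      for y :: "real \<Rightarrow> real ^ 'd" and t
    proof -
      have "norm (y t) \<le> (\<Sum>j\<in>UNIV. \<bar>y t $ j\<bar>)" by (rule norm_le_l1_cart)
      also have "\<dots> \<le> (\<Sum>j\<in>(UNIV::'d set). R)"
        using bounded_CkD(2) that by (intro sum_mono) blast
      finally show ?thesis by simp
    qed
    then show ?thesis using M by (intro exI[of _ "max M 0"]) (auto simp: le_max_iff_disj)
  qed
  {
    case 0
    then have cont: "continuous_on ({0..T} \<times> UNIV) h" by simp
    from bound[OF this, of 0] obtain M where M: "M \<ge> 0"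
      "\<And>y. \<forall>j. bounded_Ck T 0 R (\<lambda>t. y t $ j) \<Longrightarrow> \<forall>t\<in>{0..T}. \<bar>h (t, y t)\<bar> \<le> M" by blast
    have "bounded_Ck T 0 M (\<lambda>t. h (t, y t))" if "\<forall>j. bounded_Ck T 0 R (\<lambda>t. y t $ j)" for y
    proof -
      have "continuous_on {0..T} (\<lambda>t. \<chi> j. y t $ j)"
        using that by (intro continuous_on_vec_lambda) auto
      then have "continuous_on {0..T} y" by simp
      then have "continuous_on {0..T} (\<lambda>t. h (t, y t))"
        by (intro continuous_on_compose2[OF cont] continuous_intros) auto
      then show ?thesis using M(2)[OF that] by simp
    qed
    then show ?case using M(1) by blast
  next
    case (Suc k)
    obtain h' where h': "\<And>x. x \<in> {0..T} \<times> UNIV \<Longrightarrow> (h has_derivative h' x) (at x within {0..T} \<times> UNIV)"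
      "\<And>v. Ck_on k ({0..T} \<times> UNIV) (\<lambda>x. h' x v)"
      using Suc.prems by auto
    have "\<forall>v. \<exists>M\<ge>0. \<forall>y. (\<forall>j. bounded_Ck T k R (\<lambda>t. y t $ j)) \<longrightarrow>
        bounded_Ck T k M (\<lambda>t. h' (t, y t) v)"
      using Suc.IH[OF h'(2)] by blast
    then obtain M where M: "\<And>v. M v \<ge> 0"
      "\<And>v y. \<forall>j. bounded_Ck T k R (\<lambda>t. y t $ j) \<Longrightarrow> bounded_Ck T k (M v) (\<lambda>t. h' (t, y t) v)"
      by metis
    from bound[OF Ck_on_imp_continuous[OF Suc.prems], of "Suc k"] obtain M0 where M0: "M0 \<ge> 0"
      "\<And>y. \<forall>j. bounded_Ck T (Suc k) R (\<lambda>t. y t $ j) \<Longrightarrow> \<forall>t\<in>{0..T}. \<bar>h (t, y t)\<bar> \<le> M0" by blast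
    \<comment> \<open>The direction of the j-th space coordinate; (1, 0) is that of time. By
      linearity the derivative along the curve involves these finitely many directions, so finitely
      many of the bounds \<open>M v\<close> add up to N.\<close>
    define e :: "'d \<Rightarrow> real \<times> (real ^ 'd)" where "e j = (0, axis j 1)" for j
    define N where "N = M (1, 0) + (\<Sum>j\<in>UNIV. 2 ^ k * (R * M (e j)))"
    have "N \<ge> 0" using M(1) \<open>0 \<le> R\<close> unfolding N_def
      by (intro add_nonneg_nonneg sum_nonneg mult_nonneg_nonneg) auto
    have "bounded_Ck T (Suc k) (max M0 N) (\<lambda>t. h (t, y t))"
      if y: "\<forall>j. bounded_Ck T (Suc k) R (\<lambda>t. y t $ j)" for y
    proof -
      have "\<forall>j. \<exists>y'. (\<forall>t\<in>{0..T}. ((\<lambda>t. y t $ j) has_vector_derivative y' t) (at t within {0..T}))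
          \<and> bounded_Ck T k R y'"
        using y unfolding bounded_Ck.simps by blast
      then obtain y' where y': "\<And>j t. t \<in> {0..T} \<Longrightarrow>
          ((\<lambda>t. y t $ j) has_vector_derivative y' j t) (at t within {0..T})"
          "\<And>j. bounded_Ck T k R (y' j)"
        by metis
      define g where "g t = h' (t, y t) (1, 0) + (\<Sum>j\<in>UNIV. y' j t * h' (t, y t) (e j))" for t
      have yk: "\<forall>j. bounded_Ck T k R (\<lambda>t. y t $ j)" using y bounded_Ck_SucD by blast
      have g: "bounded_Ck T k N g"
        unfolding N_def g_def
        by (intro bounded_Ck_add bounded_Ck_sum bounded_Ck_mult M y' yk \<open>0 \<le> R\<close> finite)
      have deriv: "((\<lambda>t. h (t, y t)) has_vector_derivative g t) (at t within {0..T})" if t: "t \<in> {0..T}" for t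
      proof -
        let ?Y = "\<chi> j. y' j t"
        have "(y has_vector_derivative ?Y) (at t within {0..T})"
          using y'(1)[OF t] unfolding has_vector_derivative_def
          by (subst has_derivative_componentwise_within)
            (auto simp: Basis_vec_def inner_axis intro!: has_derivative_eq_rhs)
        then have "((\<lambda>t. (t, y t)) has_derivative (\<lambda>x. (x, x *\<^sub>R ?Y))) (at t within {0..T})"
          unfolding has_vector_derivative_def by (intro has_derivative_Pair has_derivative_ident)
        moreover have "(h has_derivative h' (t, y t)) (at (t, y t) within (\<lambda>t. (t, y t)) ` {0..T})"
          using t by (intro has_derivative_subset[OF h'(1)]) auto
        ultimately have "((h \<circ> (\<lambda>t. (t, y t))) has_derivative (h' (t, y t) \<circ> (\<lambda>x. (x, x *\<^sub>R ?Y)))) (at t within {0..T})"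
          by (rule diff_chain_within)
        moreover have "h' (t, y t) (x, x *\<^sub>R ?Y) = x *\<^sub>R g t" for x
        proof -
          have lin: "linear (h' (t, y t))"
            using h'(1)[of "(t, y t)"] t has_derivative_linear by auto
          have "?Y = (\<Sum>j\<in>UNIV. y' j t *\<^sub>R axis j 1)"
            by (simp add: vec_eq_iff sum_component axis_def if_distrib cong: if_cong)
          then have "(1, ?Y) = (1, 0) + (\<Sum>j\<in>UNIV. y' j t *\<^sub>R e j)"
            by (simp add: e_def prod_eq_iff fst_sum snd_sum)
          then have "h' (t, y t) (1, ?Y) = g t"
            using lin by (simp add: g_def linear_add linear_sum linear_cmul)
          moreover have "h' (t, y t) (x *\<^sub>R (1, ?Y)) = x *\<^sub>R h' (t, y t) (1, ?Y)"
            by (rule linear_cmul[OF lin])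
          ultimately show ?thesis by simp
        qed
        ultimately show ?thesis by (simp add: has_vector_derivative_def o_def)
      qed
      show ?thesis
      proof (rule bounded_Ck_SucI[OF _ deriv])
        show "\<bar>h (t, y t)\<bar> \<le> max M0 N" if "t \<in> {0..T}" for t
          using M0(2)[OF y] that by (auto simp: le_max_iff_disj)
        show "bounded_Ck T k (max M0 N) g"
          by (rule bounded_Ck_mono[OF g]) simp
      qed
    qed
    then show ?case using M0(1) by (intro exI[of _ "max M0 N"]) auto
  }
qed


section \<open>The RKHS of the prior\<close>

lemma L2_on_add:
  assumes "L2_on S f" "L2_on S g"
  shows "L2_on S (\<lambda>t. f t + g t)"
proof -
  have meas: "(\<lambda>t. f t + g t) \<in> borel_measurable (lebesgue_on S)"
    using assms by (intro borel_measurable_add) (auto simp: L2_on_def)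
  have "(norm (f t + g t))\<^sup>2 \<le> 2 * (norm (f t))\<^sup>2 + 2 * (norm (g t))\<^sup>2" for t
  proof -
    have "(norm (f t + g t))\<^sup>2 \<le> (norm (f t) + norm (g t))\<^sup>2"
      by (intro power_mono norm_triangle_ineq) simp
    also have "\<dots> \<le> 2 * (norm (f t))\<^sup>2 + 2 * (norm (g t))\<^sup>2"
      using zero_le_power2[of "norm (f t) - norm (g t)"] by (simp add: power2_eq_square algebra_simps)
    finally show ?thesis .
  qed
  moreover have "integrable (lebesgue_on S) (\<lambda>t. 2 * (norm (f t))\<^sup>2 + 2 * (norm (g t))\<^sup>2)"
    using assms by (intro Bochner_Integration.integrable_add integrable_mult_right) (auto simp: L2_on_def)
  ultimately have "integrable (lebesgue_on S) (\<lambda>t. (norm (f t + g t))\<^sup>2)"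
    using meas by (elim Bochner_Integration.integrable_bound) (auto intro!: borel_measurable_power)
  with meas show ?thesis by (simp add: L2_on_def)
qed

lemma L2_on_bounded_linear:
  assumes "bounded_linear L" "L2_on S f"
  shows "L2_on S (\<lambda>t. L (f t))"
proof -
  obtain K where K: "\<And>x. norm (L x) \<le> norm x * K"
    using bounded_linear.bounded[OF assms(1)] by blast
  have "continuous_on UNIV L"
    using assms(1) by (rule linear_continuous_on)
  then have meas: "(\<lambda>t. L (f t)) \<in> borel_measurable (lebesgue_on S)"
    using assms(2) by (auto simp: L2_on_def intro: borel_measurable_continuous_on)
  have "(norm (L (f t)))\<^sup>2 \<le> K\<^sup>2 * (norm (f t))\<^sup>2" for t
    using power_mono[OF K[of "f t"], of 2] by (simp add: power_mult_distrib mult.commute)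
  moreover have "integrable (lebesgue_on S) (\<lambda>t. K\<^sup>2 * (norm (f t))\<^sup>2)"
    using assms(2) by (intro integrable_mult_right) (auto simp: L2_on_def)
  ultimately have "integrable (lebesgue_on S) (\<lambda>t. (norm (L (f t)))\<^sup>2)"
    using meas by (elim Bochner_Integration.integrable_bound) (auto intro!: borel_measurable_power)
  with meas show ?thesis by (simp add: L2_on_def)
qed

lemma L2_on_continuous:
  fixes f :: "real \<Rightarrow> 'a::euclidean_space"
  assumes "continuous_on {a..b} f"
  shows "L2_on {a..b} f"
  unfolding L2_on_def
  by (intro conjI continuous_imp_measurable_on_sets_lebesgue[OF assms] continuous_imp_integrable_real
      continuous_intros assms) simp

lemma L2_on_norm_sq_integrable: "L2_on {a..b} f \<Longrightarrow> (\<lambda>t. (norm (f t))\<^sup>2) integrable_on {a..b}"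
  unfolding L2_on_def by (intro integrable_on_lebesgue_on) auto

lemma L2_on_norm_integrable:
  assumes "L2_on {a..b} f"
  shows "(\<lambda>t. norm (f t)) integrable_on {a..b}"
proof -
  have "integrable (lebesgue_on {a..b}) (\<lambda>t. 1 + (norm (f t))\<^sup>2)"
    using assms continuous_imp_integrable_real[of a b "\<lambda>_. 1 :: real"]
    by (intro Bochner_Integration.integrable_add) (auto simp: L2_on_def)
  moreover have "norm (f t) \<le> 1 + (norm (f t))\<^sup>2" for t
    using zero_le_power2[of "norm (f t) - 1/2"] by (simp add: power2_eq_square algebra_simps)
  ultimately have "integrable (lebesgue_on {a..b}) (\<lambda>t. norm (f t))"
    using assms by (elim Bochner_Integration.integrable_bound) (auto simp: L2_on_def)
  then show ?thesis by (intro integrable_on_lebesgue_on) auto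
qed

text \<open>Let w be V weighted by exp(-2Dt), and take a maximum point of w. There the integral term
  is at most half of the maximum in the weighted scale and is absorbed on the left. This gives the
  factor 2 and the doubled rate, and uses only the continuity of V.\<close>

lemma gronwall_integral:
  fixes V :: "real \<Rightarrow> real"
  assumes "0 \<le> a" "0 < D" and cont: "continuous_on {0..T} V"
    and V: "\<And>t. t \<in> {0..T} \<Longrightarrow> V t \<le> a + D * integral {0..t} V" and t: "t \<in> {0..T}"
  shows "V t \<le> 2 * a * exp (2 * D * t)"
proof -
  define w where "w t = exp (- (2 * D * t)) * V t" for t
  have "continuous_on {0..T} w" unfolding w_def by (intro continuous_intros cont)
  then obtain t0 where t0: "t0 \<in> {0..T}" "\<And>t. t \<in> {0..T} \<Longrightarrow> w t \<le> w t0"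
    using continuous_attains_sup[of "{0..T}" w] t by auto
  have Vw: "V s = w s * exp (2 * D * s)" for s by (simp add: w_def flip: exp_add)
  have "w t0 \<le> 2 * a"
  proof (cases "w t0 \<le> 0")
    case True
    with \<open>0 \<le> a\<close> show ?thesis by simp
  next
    case False
    have "((\<lambda>s. w t0 * exp (2 * D * s)) has_integral
        (w t0 / (2 * D) * exp (2 * D * t0) - w t0 / (2 * D) * exp (2 * D * 0))) {0..t0}"
      using t0(1) \<open>0 < D\<close>
      by (intro fundamental_theorem_of_calculus)
        (auto intro!: derivative_eq_intros simp flip: has_real_derivative_iff_has_vector_derivative)
    then have I: "((\<lambda>s. w t0 * exp (2 * D * s)) has_integral
        (w t0 / (2 * D) * (exp (2 * D * t0) - 1))) {0..t0}"
      by (simp add: right_diff_distrib)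
    have "integral {0..t0} V \<le> w t0 / (2 * D) * (exp (2 * D * t0) - 1)"
    proof (rule has_integral_le[OF integrable_integral I])
      show "V integrable_on {0..t0}"
        using t0(1) by (intro integrable_continuous_real continuous_on_subset[OF cont]) auto
      show "V s \<le> w t0 * exp (2 * D * s)" if "s \<in> {0..t0}" for s
        using t0 that unfolding Vw[of s] by (intro mult_right_mono) auto
    qed
    then have "V t0 \<le> a + D * (w t0 / (2 * D) * (exp (2 * D * t0) - 1))"
      using V[OF t0(1)] \<open>0 < D\<close> by (meson add_left_mono mult_left_mono order_trans less_imp_le)
    also have "\<dots> = a + w t0 / 2 * (exp (2 * D * t0) - 1)" using \<open>0 < D\<close> by simp
    also have "\<dots> \<le> a * exp (2 * D * t0) + w t0 / 2 * exp (2 * D * t0)"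
      using False \<open>0 \<le> a\<close> \<open>0 < D\<close> t0(1) by (intro add_mono mult_left_mono) (auto simp: mult_le_cancel_left1)
    finally have "w t0 * exp (2 * D * t0) \<le> (a + w t0 / 2) * exp (2 * D * t0)"
      by (simp add: Vw algebra_simps)
    then show ?thesis by simp
  qed
  then have "w t \<le> 2 * a" using t0(2)[OF t] by linarith
  then show ?thesis unfolding Vw[of t] by (intro mult_right_mono) auto
qed

section \<open>Continuity and the fundamental theorem of calculus in \<open>Yspace\<close>\<close>

lemma abs_continuous_on_subset:
  "abs_continuous_on S g \<Longrightarrow> S' \<subseteq> S \<Longrightarrow> abs_continuous_on S' g"
  unfolding abs_continuous_on_def by (meson order_trans)

lemma abs_continuous_on_imp_continuous_on:
  assumes "abs_continuous_on {a..b} g"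
  shows "continuous_on {a..b} g"
  unfolding continuous_on_iff
proof (intro ballI allI impI)
  fix x and e :: real assume x: "x \<in> {a..b}" and "0 < e"
  obtain \<delta> where \<delta>: "\<delta> > 0" "\<And>\<D> X. \<D> division_of X \<Longrightarrow> X \<subseteq> {a..b} \<Longrightarrow>
      (\<Sum>K\<in>\<D>. Sup K - Inf K) < \<delta> \<Longrightarrow> (\<Sum>K\<in>\<D>. norm (g (Sup K) - g (Inf K))) < e"
    using assms \<open>0 < e\<close> unfolding abs_continuous_on_def by meson
  have "dist (g y) (g x) < e" if "y \<in> {a..b}" "dist y x < \<delta>" for y
  proof -
    have "{cbox (min x y) (max x y)} division_of cbox (min x y) (max x y)"
      by (rule division_of_self) auto
    then have "norm (g (max x y) - g (min x y)) < e"
      using \<delta>(2)[of "{cbox (min x y) (max x y)}"] x that by (auto simp: dist_real_def)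
    then show ?thesis
      by (cases "x \<le> y") (auto simp: dist_norm norm_minus_commute)
  qed
  then show "\<exists>d>0. \<forall>y\<in>{a..b}. dist y x < d \<longrightarrow> dist (g y) (g x) < e" using \<delta>(1) by blast
qed

text \<open>\<open>vector_derivative\<close> is a choice. On a nondegenerate interval the derivative
  within the interval is unique, at the end points too, so the choice is forced.\<close>

lemma Dn_Suc_eqI:
  fixes y :: "real \<Rightarrow> 'b::real_normed_vector"
  assumes "0 < T" "t \<in> {0..T}" "(Dn {0..T} m y has_vector_derivative d) (at t within {0..T})"
  shows "Dn {0..T} (Suc m) y t = d"
  using vector_derivative_within_cbox[of 0 T t "Dn {0..T} m y" d] assms by simp

lemma Yspace_has_vector_derivative:
  assumes "y \<in> Yspace T \<nu>" "m < \<nu>" "t \<in> {0..T}"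
  shows "(Dn {0..T} m y has_vector_derivative Dn {0..T} (Suc m) y t) (at t within {0..T})"
proof -
  have "Dn {0..T} m y differentiable (at t within {0..T})"
    using assms by (simp add: Yspace_def)
  then show ?thesis by (simp only: Dn.simps(2) vector_derivative_works)
qed

lemma Yspace_continuous_on:
  assumes "y \<in> Yspace T \<nu>" "m \<le> \<nu>"
  shows "continuous_on {0..T} (Dn {0..T} m y)"
  using assms by (intro abs_continuous_on_imp_continuous_on) (simp add: Yspace_def)

text \<open>Below the top order the derivative is classical. At m = \<nu> it exists only almost
  everywhere, and the exceptional null set is handed to the theorem for absolutely continuous
  functions.\<close>

lemma Yspace_has_integral:
  assumes "y \<in> Yspace T \<nu>" "m \<le> \<nu>" "0 \<le> s" "s \<le> t" "t \<le> T"
  shows "(Dn {0..T} (Suc m) y has_integral Dn {0..T} m y t - Dn {0..T} m y s) {s..t}"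
proof (cases "m < \<nu>")
  case True
  then show ?thesis
    using assms by (intro fundamental_theorem_of_calculus
        has_vector_derivative_within_subset[OF Yspace_has_vector_derivative]) auto
next
  case False
  with assms(2) have "m = \<nu>" by simp
  have "AE t in lebesgue_on {0..T}. Dn {0..T} \<nu> y differentiable (at t within {0..T})"
    using assms(1) by (simp add: Yspace_def)
  then have "AE t in lebesgue. t \<in> {0..T} \<longrightarrow> Dn {0..T} \<nu> y differentiable (at t within {0..T})"
    by (subst (asm) AE_restrict_space_iff) auto
  then obtain E where E: "E \<in> null_sets lebesgue"
    "{t. \<not> (t \<in> {0..T} \<longrightarrow> Dn {0..T} \<nu> y differentiable (at t within {0..T}))} \<subseteq> E"
    by (auto simp: eventually_ae_filter)
  show ?thesis
  proof (rule abs_continuous_on_imp_has_integral[OF assms(4)])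
    show "abs_continuous_on {s..t} (Dn {0..T} m y)"
      by (rule abs_continuous_on_subset[of "{0..T}"]) (use assms in \<open>auto simp: Yspace_def\<close>)
    show "negligible E" using E(1) by (simp add: negligible_iff_null_sets)
    fix x assume x: "x \<in> {s..t} - E"
    then have "x \<in> {0..T}" using assms by auto
    with x E(2) have "Dn {0..T} \<nu> y differentiable (at x within {0..T})" by auto
    then have "(Dn {0..T} m y has_vector_derivative Dn {0..T} (Suc m) y x) (at x within {0..T})"
      by (simp only: Dn.simps(2) vector_derivative_works \<open>m = \<nu>\<close>)
    then show "(Dn {0..T} m y has_vector_derivative Dn {0..T} (Suc m) y x) (at x within {s..t})"
      using assms by (elim has_vector_derivative_within_subset) auto
  qed
qed

section \<open>What the norm of the RKHS controls\<close>

lemma L2_on_Aop: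
  assumes "y \<in> Yspace T \<nu>"
  shows "L2_on {0..T} (Aop T \<nu> F \<Gamma> y)"
proof -
  have "L2_on {0..T} (\<lambda>t. inv_sqrt \<Gamma> *v (Dn {0..T} (\<nu> + 1) y t
      + (- (\<Sum>m\<le>\<nu>. F m *v Dn {0..T} m y t))))"
  proof (rule L2_on_bounded_linear[OF matrix_vector_mul_bounded_linear], rule L2_on_add)
    show "L2_on {0..T} (Dn {0..T} (\<nu> + 1) y)" using assms by (simp add: Yspace_def)
    show "L2_on {0..T} (\<lambda>t. - (\<Sum>m\<le>\<nu>. F m *v Dn {0..T} m y t))"
      using Yspace_continuous_on[OF assms]
      by (intro L2_on_continuous continuous_intros
          bounded_linear.continuous_on[OF matrix_vector_mul_bounded_linear]) auto
  qed
  then show ?thesis by (simp add: Aop_def[abs_def])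
qed

lemma normY_bounds:
  fixes y :: "real \<Rightarrow> real ^ 'd"
  assumes "pos_def_on (stack_index \<nu>) \<Sigma>" "y \<in> Yspace T \<nu>"
  shows "(normY T \<nu> \<Sigma> F \<Gamma> y)\<^sup>2 = innerY T \<nu> \<Sigma> F \<Gamma> y y" "0 \<le> normY T \<nu> \<Sigma> F \<Gamma> y"
    and "integral {0..T} (\<lambda>t. (norm (Aop T \<nu> F \<Gamma> y t))\<^sup>2) \<le> (normY T \<nu> \<Sigma> F \<Gamma> y)\<^sup>2"
    and "a \<in> stack_index \<nu> \<Longrightarrow> \<bar>stacked T y a\<bar> \<le> sqrt (\<Sigma> a a) * normY T \<nu> \<Sigma> F \<Gamma> y"
proof -
  define Q where "Q = (\<Sum>a\<in>stack_index \<nu>. \<Sum>b\<in>stack_index \<nu>.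
        stacked T y a * mat_inv_on (stack_index \<nu>) \<Sigma> a b * stacked T y b)"
  define J where "J = integral {0..T} (\<lambda>t. (norm (Aop T \<nu> F \<Gamma> y t))\<^sup>2)"
  have fin: "finite (stack_index \<nu> :: (nat \<times> 'd) set)" by (simp add: stack_index_def)
  have inner: "innerY T \<nu> \<Sigma> F \<Gamma> y y = Q + J"
    by (simp add: innerY_def Q_def J_def power2_norm_eq_inner)
  have "J \<ge> 0" unfolding J_def
    by (intro integral_nonneg L2_on_norm_sq_integrable L2_on_Aop assms(2)) auto
  have Q: "(stacked T y a)\<^sup>2 \<le> \<Sigma> a a * Q" if "a \<in> stack_index \<nu>" for a
    unfolding Q_def by (rule mat_inv_on_form_bound[OF fin assms(1) that])
  have diag: "\<Sigma> a a > 0" if "a \<in> stack_index \<nu>" for a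
  proof -
    have "insert a (stack_index \<nu> - {a}) = stack_index \<nu>" using that by auto
    then show ?thesis
      using pos_def_on_Schur(1)[of a "stack_index \<nu> - {a}" \<Sigma>] fin assms(1) by simp
  qed
  \<comment> \<open>Any index will do: the square of one coordinate is at most a positive diagonal
    entry times Q, which forces Q to be nonnegative.\<close>
  have "(0, undefined) \<in> (stack_index \<nu> :: (nat \<times> 'd) set)" by (simp add: stack_index_def)
  then have "Q \<ge> 0" using Q diag by (smt (verit) zero_le_power2 mult_pos_neg)
  then show sq: "(normY T \<nu> \<Sigma> F \<Gamma> y)\<^sup>2 = innerY T \<nu> \<Sigma> F \<Gamma> y y"
    and nn: "0 \<le> normY T \<nu> \<Sigma> F \<Gamma> y"
    using \<open>J \<ge> 0\<close> by (simp_all add: normY_def inner)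
  show "integral {0..T} (\<lambda>t. (norm (Aop T \<nu> F \<Gamma> y t))\<^sup>2) \<le> (normY T \<nu> \<Sigma> F \<Gamma> y)\<^sup>2"
    using \<open>Q \<ge> 0\<close> by (simp add: sq inner J_def)
  assume a: "a \<in> stack_index \<nu>"
  have "(stacked T y a)\<^sup>2 \<le> \<Sigma> a a * (normY T \<nu> \<Sigma> F \<Gamma> y)\<^sup>2"
    using Q[OF a] diag[OF a] \<open>J \<ge> 0\<close> unfolding sq inner
    by (smt (verit) mult_left_mono)
  then have "sqrt ((stacked T y a)\<^sup>2) \<le> sqrt (\<Sigma> a a * (normY T \<nu> \<Sigma> F \<Gamma> y)\<^sup>2)"
    by (rule real_sqrt_le_mono)
  then show "\<bar>stacked T y a\<bar> \<le> sqrt (\<Sigma> a a) * normY T \<nu> \<Sigma> F \<Gamma> y"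
    using nn by (simp add: real_sqrt_mult)
qed

lemma Dn_zero_bound:
  assumes "pos_def_on (stack_index \<nu>) \<Sigma>" "y \<in> Yspace T \<nu>" "m \<le> \<nu>"
  shows "norm (Dn {0..T} m y 0) \<le> (\<Sum>j\<in>UNIV. sqrt (\<Sigma> (m, j) (m, j))) * normY T \<nu> \<Sigma> F \<Gamma> y"
proof -
  have "norm (Dn {0..T} m y 0) \<le> (\<Sum>j\<in>UNIV. \<bar>Dn {0..T} m y 0 $ j\<bar>)"
    by (rule norm_le_l1_cart)
  also have "\<dots> = (\<Sum>j\<in>UNIV. \<bar>stacked T y (m, j)\<bar>)" by (simp add: stacked_def)
  also have "\<dots> \<le> (\<Sum>j\<in>UNIV. sqrt (\<Sigma> (m, j) (m, j)) * normY T \<nu> \<Sigma> F \<Gamma> y)"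
    using assms by (intro sum_mono normY_bounds(4)) (auto simp: stack_index_def)
  finally show ?thesis by (simp add: sum_distrib_right)
qed

text \<open>The definition of the operator, solved for the highest derivative. The estimate is
  pointwise and thus holds for every y.\<close>

lemma Aop_dominates:
  fixes F :: "nat \<Rightarrow> real ^ 'd ^ 'd"
  assumes "pos_def \<Gamma>"
  obtains c B where "0 < c" "0 \<le> B" "\<And>y t. norm (Dn {0..T} (Suc \<nu>) y t) \<le>
    c * norm (Aop T \<nu> F \<Gamma> y t) + B * (\<Sum>m\<le>\<nu>. norm (Dn {0..T} m y t))"
proof -
  obtain c where c: "c > 0" "\<And>x. norm x \<le> c * norm (inv_sqrt \<Gamma> *v x)"
    using inv_sqrt_bounded_below[OF assms] by blast
  define B where "B = (\<Sum>m\<le>\<nu>. onorm ((*v) (F m)))"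
  have on: "0 \<le> onorm ((*v) (F m))" "norm (F m *v x) \<le> onorm ((*v) (F m)) * norm x" for m x
    by (intro onorm_pos_le onorm matrix_vector_mul_bounded_linear)+
  show ?thesis
  proof (rule that[OF c(1)])
    show "0 \<le> B" unfolding B_def by (intro sum_nonneg on)
    fix y :: "real \<Rightarrow> real ^ 'd" and t
    let ?S = "\<Sum>m\<le>\<nu>. F m *v Dn {0..T} m y t"
    have "norm ?S \<le> (\<Sum>m\<le>\<nu>. B * norm (Dn {0..T} m y t))"
    proof (rule sum_norm_le)
      fix m assume m: "m \<in> {..\<nu>}"
      have "norm (F m *v Dn {0..T} m y t) \<le> onorm ((*v) (F m)) * norm (Dn {0..T} m y t)"
        by (rule on)
      also have "\<dots> \<le> B * norm (Dn {0..T} m y t)"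
        unfolding B_def using m on by (intro mult_right_mono member_le_sum) auto
      finally show "norm (F m *v Dn {0..T} m y t) \<le> B * norm (Dn {0..T} m y t)" .
    qed
    moreover have "norm (Dn {0..T} (Suc \<nu>) y t - ?S) \<le> c * norm (Aop T \<nu> F \<Gamma> y t)"
      using c(2) by (simp add: Aop_def)
    ultimately show "norm (Dn {0..T} (Suc \<nu>) y t) \<le>
        c * norm (Aop T \<nu> F \<Gamma> y t) + B * (\<Sum>m\<le>\<nu>. norm (Dn {0..T} m y t))"
      using norm_triangle_ineq[of "Dn {0..T} (Suc \<nu>) y t - ?S" ?S] by (simp add: sum_distrib_left)
  qed
qed

lemma Yspace_norm_increment:
  fixes y :: "real \<Rightarrow> real ^ 'd"
  assumes "y \<in> Yspace T \<nu>" "m \<le> \<nu>" "t \<in> {0..T}" "g integrable_on {0..t}"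
    and "\<And>s. s \<in> {0..t} \<Longrightarrow> norm (Dn {0..T} (Suc m) y s) \<le> g s"
  shows "norm (Dn {0..T} m y t) \<le> norm (Dn {0..T} m y 0) + integral {0..t} g"
proof -
  have I: "(Dn {0..T} (Suc m) y has_integral Dn {0..T} m y t - Dn {0..T} m y 0) {0..t}"
    using assms by (intro Yspace_has_integral) auto
  have "norm (integral {0..t} (Dn {0..T} (Suc m) y)) \<le> integral {0..t} g"
    using I assms(4,5) by (intro integral_norm_bound_integral) auto
  then show ?thesis
    using norm_triangle_sub[of "Dn {0..T} m y t" "Dn {0..T} m y 0"]
    unfolding integral_unique[OF I] by linarith
qed

text \<open>Gronwall's inequality is applied to the sum V of the norms of all orders up to \<nu>,
  because only this sum closes: each lower order is an integral of the next one, and the top order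
  is an integral of \<open>Aop\<close> and all lower ones.\<close>

lemma Yspace_embedding:
  fixes \<Sigma> :: "nat \<times> 'd::finite \<Rightarrow> nat \<times> 'd \<Rightarrow> real"
  assumes "0 < T" and \<Sigma>: "pos_def_on (stack_index \<nu>) \<Sigma>" and \<Gamma>: "pos_def \<Gamma>"
  obtains C where "0 < C" "\<And>y m t. y \<in> Yspace T \<nu> \<Longrightarrow> m \<le> \<nu> \<Longrightarrow> t \<in> {0..T} \<Longrightarrow>
      norm (Dn {0..T} m y t) \<le> C * normY T \<nu> \<Sigma> F \<Gamma> y"
    "\<And>y. y \<in> Yspace T \<nu> \<Longrightarrow> integral {0..T} (\<lambda>t. (norm (Dn {0..T} (Suc \<nu>) y t))\<^sup>2)
      \<le> (C * normY T \<nu> \<Sigma> F \<Gamma> y)\<^sup>2"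
proof -
  obtain c B where "0 < c" "0 \<le> B" and dom: "\<And>y t. norm (Dn {0..T} (Suc \<nu>) y t) \<le>
      c * norm (Aop T \<nu> F \<Gamma> y t) + B * (\<Sum>m\<le>\<nu>. norm (Dn {0..T} m y t))"
    using Aop_dominates[OF \<Gamma>, of T \<nu> F] by metis
  define s0 where "s0 = (\<Sum>m\<le>\<nu>. \<bar>\<Sum>j\<in>UNIV. sqrt (\<Sigma> (m, j) (m, j))\<bar>)"
  \<comment> \<open>Each of the \<nu> lower orders contributes one integral of V and the top order B
    of them; the summand 1 keeps D positive.\<close>
  define D where "D = real \<nu> + B + 1"
  have "0 < D" using \<open>0 \<le> B\<close> by (simp add: D_def)
  \<comment> \<open>The outcome of Gronwall's inequality: s0 stems from the initial values, and c *
    sqrt T from bounding the L_1 norm of \<open>Aop\<close> by its L_2 norm.\<close>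
  define C1 where "C1 = 2 * (s0 + c * sqrt T) * exp (2 * D * T)"
  have "0 \<le> s0" unfolding s0_def by (intro sum_nonneg) simp
  then have "0 < C1" using \<open>0 < T\<close> \<open>0 < c\<close> by (auto simp: C1_def intro!: mult_pos_pos add_nonneg_pos)
  \<comment> \<open>From (a + b)^2 \<le> 2 a^2 + 2 b^2, where a is c times the norm of
    \<open>Aop\<close> and b is B times the bound already found for V.\<close>
  define C2 where "C2 = sqrt (2 * c\<^sup>2 + 2 * B\<^sup>2 * C1\<^sup>2 * T)"
  have "0 \<le> C2" using \<open>0 < T\<close> by (simp add: C2_def)
  have V_bound: "(\<Sum>m\<le>\<nu>. norm (Dn {0..T} m y t)) \<le> C1 * normY T \<nu> \<Sigma> F \<Gamma> y"
    if y: "y \<in> Yspace T \<nu>" and t: "t \<in> {0..T}" for y t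
  proof -
    define K where "K = normY T \<nu> \<Sigma> F \<Gamma> y"
    define V where "V t = (\<Sum>m\<le>\<nu>. norm (Dn {0..T} m y t))" for t
    define W where "W t = norm (Aop T \<nu> F \<Gamma> y t)" for t
    have "0 \<le> K" unfolding K_def by (rule normY_bounds(2)[OF \<Sigma> y])
    have V_cont: "continuous_on {0..T} V"
      unfolding V_def using Yspace_continuous_on[OF y] by (intro continuous_intros) auto
    have V0: "0 \<le> V t" for t by (simp add: V_def sum_nonneg)
    have W_int: "W integrable_on {0..T}"
      unfolding W_def by (rule L2_on_norm_integrable[OF L2_on_Aop[OF y]])
    have "V 0 \<le> s0 * K"
      unfolding V_def s0_def sum_distrib_right
    proof (rule sum_mono)
      fix m assume "m \<in> {..\<nu>}"
      then have "norm (Dn {0..T} m y 0) \<le> (\<Sum>j\<in>UNIV. sqrt (\<Sigma> (m, j) (m, j))) * K"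
        unfolding K_def by (intro Dn_zero_bound \<Sigma> y) simp
      then show "norm (Dn {0..T} m y 0) \<le> \<bar>\<Sum>j\<in>UNIV. sqrt (\<Sigma> (m, j) (m, j))\<bar> * K"
        using \<open>0 \<le> K\<close> by (elim order_trans) (intro mult_right_mono abs_ge_self)
    qed
    have W1: "integral {0..T} W \<le> sqrt T * K"
    proof (rule power2_le_imp_le)
      have "(integral {0..T} W)\<^sup>2 \<le> (T - 0) * integral {0..T} (\<lambda>x. (W x)\<^sup>2)"
        using \<open>0 < T\<close> W_int L2_on_norm_sq_integrable[OF L2_on_Aop[OF y]]
        by (intro square_integral_le integrable_integral) (auto simp: W_def[abs_def])
      also have "\<dots> \<le> T * K\<^sup>2"
        using \<open>0 < T\<close> normY_bounds(3)[OF \<Sigma> y] by (simp add: W_def K_def)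
      finally show "(integral {0..T} W)\<^sup>2 \<le> (sqrt T * K)\<^sup>2"
        using \<open>0 < T\<close> by (simp add: power_mult_distrib)
    qed (use \<open>0 \<le> K\<close> \<open>0 < T\<close> in simp)
    have "V s \<le> (s0 + c * sqrt T) * K + D * integral {0..s} V" if s: "s \<in> {0..T}" for s
    proof -
      have Vi: "V integrable_on {0..s}"
        using s by (intro integrable_continuous_real continuous_on_subset[OF V_cont]) auto
      have Wi: "W integrable_on {0..s}"
        using integrable_subinterval_real[OF W_int, of 0 s] s by simp
      have Vi0: "0 \<le> integral {0..s} V" by (intro integral_nonneg Vi V0)
      have "integral {0..s} W \<le> integral {0..T} W"
        using s by (intro integral_subset_le Wi W_int) (auto simp: W_def)
      then have "c * integral {0..s} W \<le> c * (sqrt T * K)"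
        using W1 \<open>0 < c\<close> by (intro mult_left_mono) auto
      have low: "norm (Dn {0..T} m y s) \<le> norm (Dn {0..T} m y 0) + integral {0..s} V" if "m < \<nu>" for m
      proof (rule Yspace_norm_increment[OF y _ s Vi])
        show "norm (Dn {0..T} (Suc m) y r) \<le> V r" for r
          unfolding V_def using that by (intro member_le_sum) auto
      qed (use that in simp)
      have "norm (Dn {0..T} \<nu> y s) \<le> norm (Dn {0..T} \<nu> y 0) + integral {0..s} (\<lambda>r. c * W r + B * V r)"
        using dom[of y]
        by (intro Yspace_norm_increment[OF y order_refl s] integrable_add integrable_on_mult_right Vi Wi)
          (simp add: V_def W_def)
      also have "integral {0..s} (\<lambda>r. c * W r + B * V r) = c * integral {0..s} W + B * integral {0..s} V"
        using Vi Wi by (simp add: integral_add integrable_on_mult_right)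
      finally have top: "norm (Dn {0..T} \<nu> y s) \<le> norm (Dn {0..T} \<nu> y 0)
          + (c * (sqrt T * K) + B * integral {0..s} V)"
        using \<open>c * integral {0..s} W \<le> c * (sqrt T * K)\<close> by linarith
      have split: "(\<Sum>m\<le>\<nu>. h m) = (\<Sum>m<\<nu>. h m) + h \<nu>" for h :: "nat \<Rightarrow> real"
        by (simp add: lessThan_Suc_atMost[symmetric])
      have "(\<Sum>m<\<nu>. norm (Dn {0..T} m y s)) \<le> (\<Sum>m<\<nu>. norm (Dn {0..T} m y 0) + integral {0..s} V)"
        using low by (intro sum_mono) auto
      then have "V s \<le> V 0 + (real \<nu> * integral {0..s} V + (c * (sqrt T * K) + B * integral {0..s} V))"
        using top unfolding V_def[of s] V_def[of 0] split by (simp add: sum.distrib)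
      also have "\<dots> \<le> s0 * K + (real \<nu> * integral {0..s} V + (c * (sqrt T * K) + B * integral {0..s} V))
          + integral {0..s} V"
        using \<open>V 0 \<le> s0 * K\<close> Vi0 by simp
      also have "\<dots> = (s0 + c * sqrt T) * K + D * integral {0..s} V"
        by (simp add: D_def algebra_simps)
      finally show ?thesis .
    qed
    then have "V t \<le> 2 * ((s0 + c * sqrt T) * K) * exp (2 * D * t)"
      using \<open>0 \<le> s0\<close> \<open>0 < c\<close> \<open>0 < T\<close> \<open>0 \<le> K\<close> \<open>0 < D\<close> V_cont t
      by (intro gronwall_integral) auto
    also have "\<dots> \<le> 2 * ((s0 + c * sqrt T) * K) * exp (2 * D * T)"
      using \<open>0 \<le> s0\<close> \<open>0 < c\<close> \<open>0 < T\<close> \<open>0 \<le> K\<close> \<open>0 < D\<close> t by (intro mult_left_mono) auto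
    finally show ?thesis by (simp add: V_def C1_def K_def algebra_simps)
  qed
  show ?thesis
  proof (rule that[of "C1 + C2"])
    show "0 < C1 + C2" using \<open>0 < C1\<close> \<open>0 \<le> C2\<close> by simp
    fix y :: "real \<Rightarrow> real ^ 'd" assume y: "y \<in> Yspace T \<nu>"
    define K where "K = normY T \<nu> \<Sigma> F \<Gamma> y"
    have "0 \<le> K" unfolding K_def by (rule normY_bounds(2)[OF \<Sigma> y])
    show "norm (Dn {0..T} m y t) \<le> (C1 + C2) * normY T \<nu> \<Sigma> F \<Gamma> y"
      if "m \<le> \<nu>" "t \<in> {0..T}" for m t
    proof -
      have "norm (Dn {0..T} m y t) \<le> (\<Sum>m\<le>\<nu>. norm (Dn {0..T} m y t))"
        using that(1) by (intro member_le_sum) auto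
      also have "\<dots> \<le> C1 * K" unfolding K_def by (rule V_bound[OF y that(2)])
      also have "\<dots> \<le> (C1 + C2) * K" using \<open>0 \<le> K\<close> \<open>0 \<le> C2\<close> by (intro mult_right_mono) auto
      finally show ?thesis by (simp add: K_def)
    qed
    let ?W = "\<lambda>t. norm (Aop T \<nu> F \<Gamma> y t)"
    have W_int: "(\<lambda>t. (?W t)\<^sup>2) integrable_on {0..T}"
      by (rule L2_on_norm_sq_integrable[OF L2_on_Aop[OF y]])
    have "integral {0..T} (\<lambda>t. (norm (Dn {0..T} (Suc \<nu>) y t))\<^sup>2)
        \<le> integral {0..T} (\<lambda>t. 2 * c\<^sup>2 * (?W t)\<^sup>2 + 2 * B\<^sup>2 * (C1 * K)\<^sup>2)"
    proof (rule integral_le)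
      have "L2_on {0..T} (Dn {0..T} (Suc \<nu>) y)" using y by (simp add: Yspace_def)
      then show "(\<lambda>t. (norm (Dn {0..T} (Suc \<nu>) y t))\<^sup>2) integrable_on {0..T}"
        by (rule L2_on_norm_sq_integrable)
      show "(\<lambda>t. 2 * c\<^sup>2 * (?W t)\<^sup>2 + 2 * B\<^sup>2 * (C1 * K)\<^sup>2) integrable_on {0..T}"
        by (intro integrable_add integrable_on_mult_right W_int integrable_const_ivl)
      show "(norm (Dn {0..T} (Suc \<nu>) y t))\<^sup>2 \<le> 2 * c\<^sup>2 * (?W t)\<^sup>2 + 2 * B\<^sup>2 * (C1 * K)\<^sup>2"
        if t: "t \<in> {0..T}" for t
      proof -
        have "norm (Dn {0..T} (Suc \<nu>) y t) \<le> c * ?W t + B * (C1 * K)"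
          using dom[of y t] mult_left_mono[OF V_bound[OF y t] \<open>0 \<le> B\<close>] by (simp add: K_def)
        then have "(norm (Dn {0..T} (Suc \<nu>) y t))\<^sup>2 \<le> (c * ?W t + B * (C1 * K))\<^sup>2"
          by (intro power_mono) auto
        also have "\<dots> \<le> 2 * (c * ?W t)\<^sup>2 + 2 * (B * (C1 * K))\<^sup>2"
          using zero_le_power2[of "c * ?W t - B * (C1 * K)"] by (simp add: power2_sum power2_diff)
        finally show ?thesis by (simp add: power_mult_distrib)
      qed
    qed
    also have "\<dots> = 2 * c\<^sup>2 * integral {0..T} (\<lambda>t. (?W t)\<^sup>2) + 2 * B\<^sup>2 * (C1 * K)\<^sup>2 * T"
      using W_int \<open>0 < T\<close> by (subst integral_add) (auto intro!: integrable_on_mult_right)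
    also have "\<dots> \<le> 2 * c\<^sup>2 * K\<^sup>2 + 2 * B\<^sup>2 * (C1 * K)\<^sup>2 * T"
      using normY_bounds(3)[OF \<Sigma> y, of F \<Gamma>] by (intro add_right_mono mult_left_mono) (auto simp: K_def)
    also have "\<dots> = (C2 * K)\<^sup>2"
      using \<open>0 < T\<close> by (simp add: C2_def power_mult_distrib algebra_simps)
    also have "\<dots> \<le> ((C1 + C2) * K)\<^sup>2"
      using \<open>0 < C1\<close> \<open>0 \<le> C2\<close> \<open>0 \<le> K\<close> by (intro power_mono mult_right_mono) auto
    finally show "integral {0..T} (\<lambda>t. (norm (Dn {0..T} (Suc \<nu>) y t))\<^sup>2)
        \<le> ((C1 + C2) * normY T \<nu> \<Sigma> F \<Gamma> y)\<^sup>2"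
      by (simp add: K_def)
  qed
qed

text \<open>\<open>Ck_on\<close> quantifies derivatives existentially and \<open>Dn\<close> selects
  them by choice; on a nondegenerate interval, uniqueness identifies the two.\<close>

lemma Ck_on_Dn:
  fixes g :: "real \<Rightarrow> 'b::real_normed_vector"
  assumes "0 < T" "Ck_on k {0..T} g"
  shows "j \<le> k \<Longrightarrow> Ck_on (k - j) {0..T} (Dn {0..T} j g)"
    and "j < k \<Longrightarrow> t \<in> {0..T} \<Longrightarrow>
      (Dn {0..T} j g has_vector_derivative Dn {0..T} (Suc j) g t) (at t within {0..T})"
proof -
  have step: "Ck_on (k - Suc j) {0..T} (Dn {0..T} (Suc j) g) \<and> (\<forall>t\<in>{0..T}.
      (Dn {0..T} j g has_vector_derivative Dn {0..T} (Suc j) g t) (at t within {0..T}))"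
    if "j < k" "Ck_on (k - j) {0..T} (Dn {0..T} j g)" for j
  proof -
    have "Ck_on (Suc (k - Suc j)) {0..T} (Dn {0..T} j g)" using that by (simp add: Suc_diff_Suc)
    then obtain f' where f': "\<And>x. x \<in> {0..T} \<Longrightarrow> (Dn {0..T} j g has_derivative f' x) (at x within {0..T})"
      "Ck_on (k - Suc j) {0..T} (\<lambda>x. f' x 1)"
      unfolding Ck_on.simps by blast
    have der: "(Dn {0..T} j g has_vector_derivative f' x 1) (at x within {0..T})" if "x \<in> {0..T}" for x
    proof -
      have "f' x h = h *\<^sub>R f' x 1" for h
        using linear_cmul[OF has_derivative_linear[OF f'(1)[OF that]], of h 1] by simp
      then have "f' x = (\<lambda>h. h *\<^sub>R f' x 1)" by blast
      then show ?thesis using f'(1)[OF that] by (simp add: has_vector_derivative_def)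
    qed
    have eq: "Dn {0..T} (Suc j) g x = f' x 1" if "x \<in> {0..T}" for x
      by (rule Dn_Suc_eqI[OF \<open>0 < T\<close> that der[OF that]])
    have "Ck_on (k - Suc j) {0..T} (Dn {0..T} (Suc j) g)"
      by (rule Ck_on_cong[OF _ f'(2)]) (simp add: eq del: Dn.simps)
    then show ?thesis using der eq by (simp del: Dn.simps)
  qed
  have "j \<le> k \<Longrightarrow> Ck_on (k - j) {0..T} (Dn {0..T} j g)" for j
  proof (induction j)
    case (Suc j)
    then show ?case using step[of j] by simp
  qed (simp add: assms)
  then show "j \<le> k \<Longrightarrow> Ck_on (k - j) {0..T} (Dn {0..T} j g)"
    and "j < k \<Longrightarrow> t \<in> {0..T} \<Longrightarrow>
      (Dn {0..T} j g has_vector_derivative Dn {0..T} (Suc j) g t) (at t within {0..T})"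
    using step[of j] by auto
qed

text \<open>The derivative is bounded on the compact interval, so g is Lipschitz with some constant
  B, and \<epsilon> / B is an admissible \<delta>.\<close>

lemma has_vector_derivative_imp_abs_continuous_on:
  fixes g :: "real \<Rightarrow> 'b::real_normed_vector"
  assumes der: "\<And>t. t \<in> {a..b} \<Longrightarrow> (g has_vector_derivative g' t) (at t within {a..b})"
    and cont: "continuous_on {a..b} g'"
  shows "abs_continuous_on {a..b} g"
proof -
  obtain B where B: "B > 0" "\<And>t. t \<in> {a..b} \<Longrightarrow> norm (g' t) \<le> B"
    using compact_imp_bounded[OF compact_continuous_image[OF cont compact_Icc]]
    by (auto simp: bounded_pos)
  have lip: "norm (g y - g x) \<le> B * (y - x)" if "x \<in> {a..b}" "y \<in> {a..b}" "x \<le> y" for x y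
  proof -
    have "norm (g y - g x) \<le> B * norm (y - x)"
    proof (rule differentiable_bound[OF convex_real_interval(5) _ _ that(2,1)])
      show "(g has_derivative (\<lambda>h. h *\<^sub>R g' t)) (at t within {a..b})" if "t \<in> {a..b}" for t
        using der[OF that] by (simp add: has_vector_derivative_def)
      show "onorm (\<lambda>h. h *\<^sub>R g' t) \<le> B" if "t \<in> {a..b}" for t
        using B(1) mult_left_mono[OF B(2)[OF that] abs_ge_zero]
        by (intro onorm_bound) (auto simp: mult.commute)
    qed
    then show ?thesis using that by simp
  qed
  show ?thesis
    unfolding abs_continuous_on_def
  proof (intro allI impI)
    fix \<epsilon> :: real assume "0 < \<epsilon>"
    have "(\<Sum>K\<in>\<D>. norm (g (Sup K) - g (Inf K))) < \<epsilon>"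
      if D: "\<D> division_of X" "X \<subseteq> {a..b}" "(\<Sum>K\<in>\<D>. Sup K - Inf K) < \<epsilon> / B" for \<D> X
    proof -
      have "(\<Sum>K\<in>\<D>. norm (g (Sup K) - g (Inf K))) \<le> (\<Sum>K\<in>\<D>. B * (Sup K - Inf K))"
      proof (rule sum_mono)
        fix K assume K: "K \<in> \<D>"
        obtain u v where uv: "K = cbox u v" using division_ofD(4)[OF D(1) K] by blast
        have "u \<le> v" using division_ofD(3)[OF D(1) K] uv by simp
        moreover have "{u..v} \<subseteq> {a..b}" using order_trans[OF division_ofD(2)[OF D(1) K] D(2)] uv by simp
        ultimately show "norm (g (Sup K) - g (Inf K)) \<le> B * (Sup K - Inf K)"
          using lip[of u v] by (simp add: uv)
      qed
      also have "\<dots> < \<epsilon>" unfolding sum_distrib_left[symmetric] using D(3) \<open>B > 0\<close> by (simp add: field_simps)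
      finally show ?thesis .
    qed
    then show "\<exists>\<delta>>0. \<forall>\<D> X. \<D> division_of X \<and> X \<subseteq> {a..b} \<and> (\<Sum>K\<in>\<D>. Sup K - Inf K) < \<delta> \<longrightarrow>
        (\<Sum>K\<in>\<D>. norm (g (Sup K) - g (Inf K))) < \<epsilon>"
      using \<open>0 < \<epsilon>\<close> \<open>B > 0\<close> by (intro exI[of _ "\<epsilon> / B"]) auto
  qed
qed

lemma Ck_on_imp_Yspace:
  fixes g :: "real \<Rightarrow> real ^ 'd"
  assumes "0 < T" "Ck_on (Suc \<nu>) {0..T} g"
  shows "g \<in> Yspace T \<nu>"
proof -
  have cont: "continuous_on {0..T} (Dn {0..T} j g)" if "j \<le> Suc \<nu>" for j
    using Ck_on_Dn(1)[OF assms that] by (rule Ck_on_imp_continuous)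
  note der = Ck_on_Dn(2)[OF assms]
  have diff: "Dn {0..T} j g differentiable (at t within {0..T})" if "j < Suc \<nu>" "t \<in> {0..T}" for j t
    using der[OF that] by (rule differentiableI_vector)
  have "abs_continuous_on {0..T} (Dn {0..T} m g)" if "m \<le> \<nu>" for m
    using that by (intro has_vector_derivative_imp_abs_continuous_on[OF der cont]) auto
  moreover have "L2_on {0..T} (Dn {0..T} (\<nu> + 1) g)"
    using cont[of "Suc \<nu>"] by (intro L2_on_continuous) simp
  ultimately show ?thesis
    unfolding Yspace_def by (auto intro!: diff AE_I2)
qed

text \<open>The order is \<nu> and not \<nu> + 1: D^\<nu> y is continuous and bounded, whereas the
  next derivative is only square integrable.\<close>

lemma Yspace_bounded_Ck:
  fixes y :: "real \<Rightarrow> real ^ 'd"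
  assumes y: "y \<in> Yspace T \<nu>"
    and R: "\<And>m t. m \<le> \<nu> \<Longrightarrow> t \<in> {0..T} \<Longrightarrow> norm (Dn {0..T} m y t) \<le> R"
  shows "bounded_Ck T \<nu> R (\<lambda>t. y t $ j)"
proof -
  have bound: "\<bar>Dn {0..T} m y t $ j\<bar> \<le> R" if "m \<le> \<nu>" "t \<in> {0..T}" for m t
    using component_le_norm_cart[of "Dn {0..T} m y t" j] R[OF that] by linarith
  have "bounded_Ck T (\<nu> - m) R (\<lambda>t. Dn {0..T} m y t $ j)" if "m \<le> \<nu>" for m
    using that
  proof (induction m rule: inc_induct)
    case base
    then show ?case
      using bound[of \<nu>] by (auto intro!: continuous_intros Yspace_continuous_on[OF y])
  next
    case (step m)
    have "bounded_Ck T (Suc (\<nu> - Suc m)) R (\<lambda>t. Dn {0..T} m y t $ j)"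
    proof (rule bounded_Ck_SucI[OF _ _ step.IH])
      show "\<bar>Dn {0..T} m y t $ j\<bar> \<le> R" if "t \<in> {0..T}" for t
        using bound that step.hyps by simp
      show "((\<lambda>t. Dn {0..T} m y t $ j) has_vector_derivative Dn {0..T} (Suc m) y t $ j)
          (at t within {0..T})" if "t \<in> {0..T}" for t
        using Yspace_has_vector_derivative[OF y step.hyps(2) that]
        by (rule bounded_linear.has_vector_derivative[OF bounded_linear_vec_nth])
    qed
    then show ?case using step.hyps by (simp add: Suc_diff_Suc)
  qed
  from this[of 0] show ?thesis by simp
qed

text \<open>The recursion of \<open>bounded_Ck\<close> hides each derivative behind its own
  quantifier; the residual needs all of them at once, as one sequence.\<close>

lemma bounded_Ck_derivatives:
  assumes "bounded_Ck T k M g"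
  shows "\<exists>G. G 0 = g \<and>
    (\<forall>j<k. \<forall>t\<in>{0..T}. (G j has_vector_derivative G (Suc j) t) (at t within {0..T})) \<and>
    (\<forall>j\<le>k. continuous_on {0..T} (G j) \<and> (\<forall>t\<in>{0..T}. \<bar>G j t\<bar> \<le> M))"
proof -
  have "\<exists>G. G 0 = g \<and> (\<forall>j<k. \<forall>t\<in>{0..T}. (G j has_vector_derivative G (Suc j) t) (at t within {0..T}))
      \<and> (\<forall>j\<le>k. bounded_Ck T (k - j) M (G j))"
    using assms
  proof (induction k arbitrary: g)
    case 0
    then show ?case by (intro exI[of _ "\<lambda>_. g"]) auto
  next
    case (Suc k)
    obtain g' where g': "\<And>t. t \<in> {0..T} \<Longrightarrow> (g has_vector_derivative g' t) (at t within {0..T})"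
      "bounded_Ck T k M g'" using bounded_Ck_SucE[OF Suc.prems] by blast
    obtain G where G: "G 0 = g'"
      "\<forall>j<k. \<forall>t\<in>{0..T}. (G j has_vector_derivative G (Suc j) t) (at t within {0..T})"
      "\<forall>j\<le>k. bounded_Ck T (k - j) M (G j)" using Suc.IH[OF g'(2)] by blast
    define H where "H = case_nat g G"
    have H: "H 0 = g" "\<And>j. H (Suc j) = G j" by (simp_all add: H_def)
    have "(H j has_vector_derivative H (Suc j) t) (at t within {0..T})"
      if "j < Suc k" "t \<in> {0..T}" for j t
      using that g' G by (cases j) (auto simp: H)
    moreover have "bounded_Ck T (Suc k - j) M (H j)" if "j \<le> Suc k" for j
    proof (cases j)
      case 0
      then show ?thesis using Suc.prems by (simp only: H diff_zero)
    qed (use that G(3) H in simp)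
    ultimately show ?case using H(1) by blast
  qed
  then obtain G where G: "G 0 = g"
    "\<forall>j<k. \<forall>t\<in>{0..T}. (G j has_vector_derivative G (Suc j) t) (at t within {0..T})"
    "\<forall>j\<le>k. bounded_Ck T (k - j) M (G j)" by blast
  have "continuous_on {0..T} (G j) \<and> (\<forall>t\<in>{0..T}. \<bar>G j t\<bar> \<le> M)" if "j \<le> k" for j
    using bounded_CkD[of T "k - j" M "G j"] G(3) that by simp
  with G(1,2) show ?thesis by (intro exI[of _ G]) simp
qed


section \<open>The residual\<close>

text \<open>Witnesses that \<open>v 0\<close> lies in the Sobolev space of order n + 1:
  \<open>v k\<close> is the k-th derivative, and \<phi> is the weak derivative of
  \<open>v n\<close>. The latter is described through integrals, so that its values on null sets do
  not matter.\<close>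

definition sobolev_derivatives :: "real \<Rightarrow> nat \<Rightarrow> real \<Rightarrow> (nat \<Rightarrow> real \<Rightarrow> real) \<Rightarrow> (real \<Rightarrow> real) \<Rightarrow> bool" where
  "sobolev_derivatives T n M v \<phi> \<longleftrightarrow>
    (\<forall>k<n. \<forall>t\<in>{0..T}. (v k has_vector_derivative v (Suc k) t) (at t within {0..T})) \<and>
    continuous_on {0..T} (v n) \<and>
    (\<forall>s t. 0 \<le> s \<longrightarrow> s \<le> t \<longrightarrow> t \<le> T \<longrightarrow> (\<phi> has_integral v n t - v n s) {s..t}) \<and>
    (\<lambda>x. (\<phi> x)\<^sup>2) integrable_on {0..T} \<and> integral {0..T} (\<lambda>x. (\<phi> x)\<^sup>2) \<le> M\<^sup>2"

text \<open>A scalar h stands for f_i, so that M can be chosen from f_i and the radius K before the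
  vector field and the curve are known. The order \<nu> - 1 counts the classical derivatives of the
  residual; one further derivative exists in L_2.\<close>

lemma Yspace_residual_bound:
  fixes \<Sigma> :: "nat \<times> 'd::finite \<Rightarrow> nat \<times> 'd \<Rightarrow> real" and h :: "real \<Rightarrow> real ^ 'd \<Rightarrow> real"
  assumes "0 < T" "1 \<le> \<nu>" and \<Sigma>: "pos_def_on (stack_index \<nu>) \<Sigma>" and \<Gamma>: "pos_def \<Gamma>"
    and h: "Ck_on \<nu> ({0..T} \<times> UNIV) (\<lambda>(t, x). h t x)" and "0 \<le> K"
  shows "\<exists>M>0. \<forall>y\<in>Yspace T \<nu>. \<forall>i. normY T \<nu> \<Sigma> F \<Gamma> y \<le> K \<longrightarrow>
    (\<exists>v \<phi>. v 0 = (\<lambda>t. Dn {0..T} 1 y t $ i - h t (y t)) \<and> sobolev_derivatives T (\<nu> - 1) M v \<phi>)"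
proof -
  obtain C where C: "0 < C" "\<And>y m t. y \<in> Yspace T \<nu> \<Longrightarrow> m \<le> \<nu> \<Longrightarrow> t \<in> {0..T} \<Longrightarrow>
      norm (Dn {0..T} m y t) \<le> C * normY T \<nu> \<Sigma> F \<Gamma> y"
    "\<And>y. y \<in> Yspace T \<nu> \<Longrightarrow> integral {0..T} (\<lambda>t. (norm (Dn {0..T} (Suc \<nu>) y t))\<^sup>2)
      \<le> (C * normY T \<nu> \<Sigma> F \<Gamma> y)\<^sup>2"
    using Yspace_embedding[OF \<open>0 < T\<close> \<Sigma> \<Gamma>, of F] by metis
  have "0 \<le> C * K" using C(1) \<open>0 \<le> K\<close> by simp
  from bounded_Ck_compose[OF this h] obtain N where N: "0 \<le> N"
    "\<And>y. (\<And>j. bounded_Ck T \<nu> (C * K) (\<lambda>t. y t $ j)) \<Longrightarrow> bounded_Ck T \<nu> N (\<lambda>t. h t (y t))"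
    by auto
  \<comment> \<open>From (a - b)^2 \<le> 2 a^2 + 2 b^2 for the highest derivative of y and that of
    the composition, which is at most N; the summand 1 makes M positive.\<close>
  define M where "M = sqrt (2 * (C * K)\<^sup>2 + 2 * T * N\<^sup>2) + 1"
  show ?thesis
  proof (intro exI[of _ M] conjI ballI allI impI)
    have "0 \<le> sqrt (2 * (C * K)\<^sup>2 + 2 * T * N\<^sup>2)" using \<open>0 < T\<close> by simp
    then show "0 < M" unfolding M_def by linarith
    fix y :: "real \<Rightarrow> real ^ 'd" and i
    assume y: "y \<in> Yspace T \<nu>" and "normY T \<nu> \<Sigma> F \<Gamma> y \<le> K"
    then have K: "C * normY T \<nu> \<Sigma> F \<Gamma> y \<le> C * K" using C(1) by simp
    have "bounded_Ck T \<nu> (C * K) (\<lambda>t. y t $ j)" for j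
      using C(2)[OF y] K by (intro Yspace_bounded_Ck[OF y]) (meson order_trans)
    from bounded_Ck_derivatives[OF N(2)[OF this]] obtain G where G: "G 0 = (\<lambda>t. h t (y t))"
      "\<forall>j<\<nu>. \<forall>t\<in>{0..T}. (G j has_vector_derivative G (Suc j) t) (at t within {0..T})"
      "\<forall>j\<le>\<nu>. continuous_on {0..T} (G j) \<and> (\<forall>t\<in>{0..T}. \<bar>G j t\<bar> \<le> N)"
      by (elim exE conjE)
    have Gd: "(G j has_vector_derivative G (Suc j) t) (at t within {0..T})"
      if "j < \<nu>" "t \<in> {0..T}" for j t using G(2) that by simp
    have Gc: "continuous_on {0..T} (G j)" and Gb: "t \<in> {0..T} \<Longrightarrow> \<bar>G j t\<bar> \<le> N"
      if "j \<le> \<nu>" for j t using G(3) that by auto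
    \<comment> \<open>The k-th derivative of the residual. The member \<open>v \<nu>\<close> takes
      the role of \<phi> and is linked to \<open>v (\<nu> - 1)\<close> by integration only.\<close>
    define v where "v k t = Dn {0..T} (Suc k) y t $ i - G k t" for k t
    have L2: "L2_on {0..T} (Dn {0..T} (Suc \<nu>) y)" using y by (simp add: Yspace_def)
    have "v 0 = (\<lambda>t. Dn {0..T} 1 y t $ i - h t (y t))"
      by (simp add: v_def[abs_def] G(1))
    moreover have "(v k has_vector_derivative v (Suc k) t) (at t within {0..T})"
      if "k < \<nu> - 1" "t \<in> {0..T}" for k t
      unfolding v_def
      by (intro has_vector_derivative_diff bounded_linear.has_vector_derivative[OF bounded_linear_vec_nth]
          Yspace_has_vector_derivative[OF y] Gd) (use that in auto)
    moreover have "continuous_on {0..T} (v (\<nu> - 1))"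
      unfolding v_def using \<open>1 \<le> \<nu>\<close>
      by (intro continuous_intros Yspace_continuous_on[OF y] Gc) auto
    moreover have "(v \<nu> has_integral v (\<nu> - 1) t - v (\<nu> - 1) s) {s..t}"
      if st: "0 \<le> s" "s \<le> t" "t \<le> T" for s t
    proof -
      have "((\<lambda>r. Dn {0..T} (Suc \<nu>) y r $ i) has_integral (Dn {0..T} \<nu> y t - Dn {0..T} \<nu> y s) $ i) {s..t}"
        using has_integral_linear[OF Yspace_has_integral[OF y order_refl st] bounded_linear_vec_nth]
        by (simp add: o_def)
      moreover have "(G \<nu> has_integral G (\<nu> - 1) t - G (\<nu> - 1) s) {s..t}"
      proof (rule fundamental_theorem_of_calculus[OF st(2)])
        fix r assume "r \<in> {s..t}"
        then have "(G (\<nu> - 1) has_vector_derivative G \<nu> r) (at r within {0..T})"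
          using Gd[of "\<nu> - 1" r] \<open>1 \<le> \<nu>\<close> st by simp
        then show "(G (\<nu> - 1) has_vector_derivative G \<nu> r) (at r within {s..t})"
          by (rule has_vector_derivative_within_subset) (use st in auto)
      qed
      ultimately have "((\<lambda>r. Dn {0..T} (Suc \<nu>) y r $ i - G \<nu> r) has_integral
          (Dn {0..T} \<nu> y t - Dn {0..T} \<nu> y s) $ i - (G (\<nu> - 1) t - G (\<nu> - 1) s)) {s..t}"
        by (rule has_integral_diff)
      moreover have "(Dn {0..T} \<nu> y t - Dn {0..T} \<nu> y s) $ i - (G (\<nu> - 1) t - G (\<nu> - 1) s)
          = v (\<nu> - 1) t - v (\<nu> - 1) s"
        using \<open>1 \<le> \<nu>\<close> by (simp add: v_def del: Dn.simps)
      ultimately show ?thesis by (simp only: v_def[abs_def])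
    qed
    moreover have "L2_on {0..T} (v \<nu>)"
    proof -
      have "L2_on {0..T} (\<lambda>t. Dn {0..T} (Suc \<nu>) y t $ i + (- G \<nu> t))"
        by (rule L2_on_add[OF L2_on_bounded_linear[OF bounded_linear_vec_nth L2]])
          (intro L2_on_continuous continuous_intros Gc order_refl)
      then show ?thesis by (simp add: v_def[abs_def] del: Dn.simps)
    qed
    then have sq: "(\<lambda>x. (v \<nu> x)\<^sup>2) integrable_on {0..T}"
      using L2_on_norm_sq_integrable by fastforce
    moreover have "integral {0..T} (\<lambda>x. (v \<nu> x)\<^sup>2) \<le> M\<^sup>2"
    proof -
      have int: "(\<lambda>t. (norm (Dn {0..T} (Suc \<nu>) y t))\<^sup>2) integrable_on {0..T}"
        by (rule L2_on_norm_sq_integrable[OF L2])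
      have "integral {0..T} (\<lambda>x. (v \<nu> x)\<^sup>2)
          \<le> integral {0..T} (\<lambda>t. 2 * (norm (Dn {0..T} (Suc \<nu>) y t))\<^sup>2 + 2 * N\<^sup>2)"
      proof (intro integral_le sq integrable_add integrable_on_mult_right int integrable_const_ivl)
        fix t assume t: "t \<in> {0..T}"
        define d where "d = Dn {0..T} (Suc \<nu>) y t $ i"
        have "\<bar>d\<bar> \<le> norm (Dn {0..T} (Suc \<nu>) y t)"
          unfolding d_def by (rule component_le_norm_cart)
        then have "d\<^sup>2 \<le> (norm (Dn {0..T} (Suc \<nu>) y t))\<^sup>2" by (metis abs_ge_zero power2_abs power_mono)
        moreover have "(G \<nu> t)\<^sup>2 \<le> N\<^sup>2" using Gb[OF order_refl t] by (metis abs_ge_zero power2_abs power_mono)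
        moreover have "(d - G \<nu> t)\<^sup>2 \<le> 2 * d\<^sup>2 + 2 * (G \<nu> t)\<^sup>2"
          using zero_le_power2[of "d + G \<nu> t"] by (simp add: power2_sum power2_diff)
        ultimately show "(v \<nu> t)\<^sup>2 \<le> 2 * (norm (Dn {0..T} (Suc \<nu>) y t))\<^sup>2 + 2 * N\<^sup>2"
          unfolding v_def d_def[symmetric] by linarith
      qed
      also have "\<dots> = 2 * integral {0..T} (\<lambda>t. (norm (Dn {0..T} (Suc \<nu>) y t))\<^sup>2) + 2 * T * N\<^sup>2"
        using int \<open>0 < T\<close> by (subst integral_add) (auto intro!: integrable_on_mult_right simp del: Dn.simps)
      also have "\<dots> \<le> 2 * (C * K)\<^sup>2 + 2 * T * N\<^sup>2"
        using C(3)[OF y] power_mono[OF K, of 2] C(1) normY_bounds(2)[OF \<Sigma> y, of F \<Gamma>] by simp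
      also have "\<dots> = (sqrt (2 * (C * K)\<^sup>2 + 2 * T * N\<^sup>2))\<^sup>2" using \<open>0 < T\<close> by simp
      also have "\<dots> \<le> M\<^sup>2" unfolding M_def using \<open>0 < T\<close> by (intro power_mono) auto
      finally show ?thesis .
    qed
    ultimately show "\<exists>v \<phi>. v 0 = (\<lambda>t. Dn {0..T} 1 y t $ i - h t (y t)) \<and>
        sobolev_derivatives T (\<nu> - 1) M v \<phi>"
      unfolding sobolev_derivatives_def
      by (intro exI[of _ v] exI[of _ "v \<nu>"] conjI allI impI ballI)
  qed
qed

text \<open>The order shifts by one, since \<open>v 0\<close> is already the first derivative of e.
  The function e is prescribed on \<open>{0..T}\<close> only, which suffices because derivatives are
  taken within that interval.\<close>

lemma Dn_integral:
  fixes v :: "nat \<Rightarrow> real \<Rightarrow> real"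
  assumes "0 < T" and e: "\<And>t. t \<in> {0..T} \<Longrightarrow> e t = integral {0..t} (v 0)"
    and der: "\<And>k t. k < n \<Longrightarrow> t \<in> {0..T} \<Longrightarrow> (v k has_vector_derivative v (Suc k) t) (at t within {0..T})"
    and cont: "continuous_on {0..T} (v n)"
  shows "k \<le> n \<Longrightarrow> t \<in> {0..T} \<Longrightarrow> Dn {0..T} (Suc k) e t = v k t"
proof (induction k arbitrary: t)
  case 0
  have c0: "continuous_on {0..T} (v 0)"
    using cont has_vector_derivative_continuous_on[OF der] by (cases "n = 0") auto
  have "((\<lambda>t. integral {0..t} (v 0)) has_vector_derivative v 0 t) (at t within {0..T})"
    by (rule integral_has_vector_derivative[OF c0 0(2)])
  then have "(Dn {0..T} 0 e has_vector_derivative v 0 t) (at t within {0..T})"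
    using e 0(2) by (auto elim!: has_vector_derivative_transform[rotated 2])
  then show ?case by (rule Dn_Suc_eqI[OF \<open>0 < T\<close> 0(2)])
next
  case (Suc k)
  have "(v k has_vector_derivative v (Suc k) t) (at t within {0..T})"
    using der Suc.prems by simp
  then have "(Dn {0..T} (Suc k) e has_vector_derivative v (Suc k) t) (at t within {0..T})"
    by (rule has_vector_derivative_transform[OF Suc.prems(2), rotated]) (use Suc in simp)
  then show ?case by (rule Dn_Suc_eqI[OF \<open>0 < T\<close> Suc.prems(2)])
qed

section \<open>Seminorms of the integrated residual\<close>

lemma Lq_norm_cong:
  assumes "\<And>t. t \<in> S \<Longrightarrow> u t = w t"
  shows "Lq_norm S q u = Lq_norm S q w"
proof -
  have "u \<in> borel_measurable (lebesgue_on S) \<longleftrightarrow> w \<in> borel_measurable (lebesgue_on S)"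
    using assms by (intro measurable_cong) simp
  moreover have "(\<integral>\<^sup>+ t. ennreal (\<bar>u t\<bar> powr enn2real q) \<partial>lebesgue_on S)
      = (\<integral>\<^sup>+ t. ennreal (\<bar>w t\<bar> powr enn2real q) \<partial>lebesgue_on S)"
    using assms by (intro nn_integral_cong) simp
  moreover have "esssup (lebesgue_on S) (\<lambda>t. ennreal \<bar>u t\<bar>) = esssup (lebesgue_on S) (\<lambda>t. ennreal \<bar>w t\<bar>)"
    if "w \<in> borel_measurable (lebesgue_on S)" "u \<in> borel_measurable (lebesgue_on S)"
    using assms that by (intro esssup_AE_cong AE_I2) auto
  ultimately show ?thesis unfolding Lq_norm_def by auto
qed

text \<open>Used with n + 1 = \<nu>. In c, the factor T + 1 comes from passing between Lebesgue
  norms, and 4 * 3^n is the ratio of 2L to the fill distance, raised to the largest power that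
  occurs.\<close>

lemma mesh_vanishing_seminorms:
  fixes v :: "nat \<Rightarrow> real \<Rightarrow> real"
  assumes "0 < T" and mesh: "is_mesh T N s" and \<delta>: "2 * 3 ^ n * fill_distance T N s \<le> T"
    and vanish: "\<And>z. z \<in> s ` {..N} \<Longrightarrow> v 0 z = 0"
    and sob: "sobolev_derivatives T n M v \<phi>" and "0 < M"
    and e: "\<And>t. t \<in> {0..T} \<Longrightarrow> e t = integral {0..t} (v 0)" and "1 \<le> q"
  defines "c \<equiv> (T + 1) * (4 * 3 ^ n) ^ Suc n * M"
  shows "sobolev_seminorm T q 0 e \<le> ennreal (fill_distance T N s ^ Suc n * T powr recip q * c)"
    and "m \<in> {1..Suc n} \<Longrightarrow> sobolev_seminorm T q m e
      \<le> ennreal (fill_distance T N s powr (real (Suc n) + 1 - real m - max (1 / 2 - recip q) 0) * c)"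
proof -
  have der: "\<And>k t. k < n \<Longrightarrow> t \<in> {0..T} \<Longrightarrow> (v k has_vector_derivative v (Suc k) t) (at t within {0..T})"
    and cont: "continuous_on {0..T} (v n)"
    and incr: "\<And>s t. 0 \<le> s \<Longrightarrow> s \<le> t \<Longrightarrow> t \<le> T \<Longrightarrow> (\<phi> has_integral v n t - v n s) {s..t}"
    and sq: "(\<lambda>x. (\<phi> x)\<^sup>2) integrable_on {0..T}" "integral {0..T} (\<lambda>x. (\<phi> x)\<^sup>2) \<le> M\<^sup>2"
    using sob by (simp_all add: sobolev_derivatives_def)
  define \<delta> where "\<delta> = fill_distance T N s"
  have "0 < \<delta>" unfolding \<delta>_def by (rule fill_distance_pos[OF \<open>0 < T\<close> mesh])
  \<comment> \<open>A closed subinterval of \<open>{0..T}\<close> of length 2\<delta> contains a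
    mesh point, so by the repeated use of Rolle's theorem one of length L contains a zero of each
    \<open>v k\<close> with k \<le> n.\<close>
  define L where "L = 3 ^ n * (2 * \<delta>)"
  have L: "0 < L" "L \<le> T" using \<open>0 < \<delta>\<close> \<delta> by (auto simp: L_def \<delta>_def algebra_simps)
  define \<kappa> :: real where "\<kappa> = 4 * 3 ^ n"
  have \<kappa>: "1 \<le> \<kappa>" "2 * L = \<kappa> * \<delta>"
  proof -
    have "1 \<le> (3::real) ^ n" by simp
    then show "1 \<le> \<kappa>" unfolding \<kappa>_def by linarith
  qed (simp add: \<kappa>_def L_def)
  have contv: "continuous_on {0..T} (v k)" if "k \<le> n" for k
  proof (cases "k = n")
    case False
    with that have "k < n" by simp
    then show ?thesis by (rule has_vector_derivative_continuous_on[OF der])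
  qed (simp add: cont)
  have zeros: "\<exists>z\<in>{0..T}. \<bar>t - z\<bar> \<le> L \<and> v k z = 0" if kn: "k \<le> n" and "t \<in> {0..T}" for k t
  proof -
    \<comment> \<open>The window from a' to a' + L contains t and lies in \<open>{0..T}\<close>;
      near an end point it is shifted inwards, which is possible because L \<le> T.\<close>
    define a where "a = max 0 (t - L)"
    define a' where "a' = min a (T - L)"
    have a': "0 \<le> a'" "a' + L \<le> T" "a' \<le> t" "t \<le> a' + L"
      using that(2) L by (auto simp: a'_def a_def)
    have "(3::real) ^ k \<le> 3 ^ n" using that(1) by (intro power_increasing) auto
    then have "3 ^ k * (2 * \<delta>) \<le> (a' + L) - a'" using \<open>0 < \<delta>\<close> by (simp add: L_def)
    moreover have "\<exists>z\<in>{x..y}. v 0 z = 0" if "0 \<le> x" "y \<le> T" "2 * \<delta> \<le> y - x" for x y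
    proof -
      have "x \<le> y" using that(3) \<open>0 < \<delta>\<close> by simp
      from mesh_point_in_interval[OF mesh that(1,2) _ this] that(3) vanish show ?thesis
        by (auto simp: \<delta>_def)
    qed
    ultimately obtain z where "z \<in> {a'..a' + L}" "v k z = 0"
      using derivative_zeros_dense[where v = v and n = n and T = T and L = "2 * \<delta>" and k = k and a = a' and b = "a' + L", OF der] a' kn \<open>0 < \<delta>\<close> by auto
    then show ?thesis using a' by (intro bexI[of _ z]) auto
  qed
  have B: "integral {0..T} (\<lambda>x. (v k x)\<^sup>2) \<le> ((2 * L) ^ Suc (n - k) * M)\<^sup>2 \<and>
      (\<forall>t\<in>{0..T}. (v k t)\<^sup>2 \<le> 2 * L * ((2 * L) ^ (n - k) * M)\<^sup>2)" if "k \<le> n" for k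
    using sampling_inequality[OF \<open>0 < T\<close> der cont incr sq(1) less_imp_le[OF \<open>0 < M\<close>] sq(2) L zeros that]
    using that by (simp add: Suc_diff_le)
  have Lq: "Lq_norm {0..T} q' (v k) \<le>
      ennreal ((T + 1) * ((2 * L) powr (real (Suc (n - k)) - max (1/2 - recip q') 0) * M))"
    if "k \<le> n" "1 \<le> q'" for k q'
    using B[OF that(1)] L \<open>0 < M\<close>
    by (intro Lq_norm_scaled \<open>0 < T\<close> contv that) auto
  \<comment> \<open>Since \<kappa> \<ge> 1, its power is enlarged to an exponent independent of p,
    and one constant serves all m and q.\<close>
  have scale: "(2 * L) powr p \<le> \<kappa> ^ Suc n * \<delta> powr p" if "0 \<le> p" "p \<le> real (Suc n)" for p
  proof -
    have "(2 * L) powr p = \<kappa> powr p * \<delta> powr p"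
      using \<kappa> \<open>0 < \<delta>\<close> by (simp add: powr_mult)
    also have "\<kappa> powr p \<le> \<kappa> powr real (Suc n)" using \<kappa>(1) that by (intro powr_mono) auto
    also have "\<dots> = \<kappa> ^ Suc n" using \<kappa>(1) by (intro powr_realpow) simp
    finally show ?thesis by (simp add: mult_right_mono)
  qed
  have recip01: "0 \<le> recip q" "recip q \<le> 1" using recip_bounds[OF \<open>1 \<le> q\<close>] by auto
  show "sobolev_seminorm T q m e
      \<le> ennreal (fill_distance T N s powr (real (Suc n) + 1 - real m - max (1 / 2 - recip q) 0) * c)"
    if m: "m \<in> {1..Suc n}"
  proof -
    obtain k where k: "m = Suc k" "k \<le> n" using m by (cases m) auto
    define p where "p = real (Suc (n - k)) - max (1/2 - recip q) 0"
    have p: "p = real (Suc n) + 1 - real m - max (1 / 2 - recip q) 0"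
      using k by (simp add: p_def of_nat_diff)
    \<comment> \<open>The loss is at most 1 and the exponent before it at least 1, so p lies in the
      range required by \<open>scale\<close>.\<close>
    have "max (1/2 - recip q) 0 \<le> 1" using recip01 by simp
    then have p01: "0 \<le> p" "p \<le> real (Suc n)" using k by (auto simp: p_def of_nat_diff)
    have "sobolev_seminorm T q m e = Lq_norm {0..T} q (v k)"
      unfolding sobolev_seminorm_def k(1)
      by (rule Lq_norm_cong) (rule Dn_integral[OF \<open>0 < T\<close> e der cont k(2)])
    also have "\<dots> \<le> ennreal ((T + 1) * ((2 * L) powr p * M))"
      using Lq[OF k(2) \<open>1 \<le> q\<close>] by (simp add: p_def)
    also have "\<dots> \<le> ennreal ((T + 1) * ((\<kappa> ^ Suc n * \<delta> powr p) * M))"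
      using scale[OF p01] \<open>0 < T\<close> \<open>0 < M\<close> by (intro ennreal_leI mult_left_mono mult_right_mono) auto
    also have "\<dots> = ennreal (\<delta> powr p * c)" by (simp add: c_def \<kappa>_def algebra_simps)
    finally show ?thesis by (simp add: p \<delta>_def)
  qed
  show "sobolev_seminorm T q 0 e \<le> ennreal (fill_distance T N s ^ Suc n * T powr recip q * c)"
  proof -
    have c0: "continuous_on {0..T} (v 0)" by (rule contv) simp
    define A where "A = (2 * L) ^ Suc n * M"
    have "0 < A" using L \<open>0 < M\<close> by (simp add: A_def)
    have sq0: "(\<lambda>x. (v 0 x)\<^sup>2) integrable_on {0..T}"
      by (intro integrable_continuous_real continuous_intros c0)
    have int_abs: "integral {0..T} (\<lambda>x. \<bar>v 0 x\<bar>) \<le> (T + 1) * A"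
    proof -
      have "integral {0..T} (\<lambda>x. \<bar>v 0 x\<bar>) \<le> integral {0..T} (\<lambda>x. A + (v 0 x)\<^sup>2 / A)"
      proof (rule integral_le)
        show "(\<lambda>x. \<bar>v 0 x\<bar>) integrable_on {0..T}" "(\<lambda>x. A + (v 0 x)\<^sup>2 / A) integrable_on {0..T}"
          using \<open>0 < A\<close> by (intro integrable_continuous_real continuous_intros c0; simp)+
        \<comment> \<open>A substitute for Cauchy--Schwarz: A bounds the L_2 norm of
          \<open>v 0\<close>, and at this scale both terms on the right integrate to at most a
          multiple of A.\<close>
        show "\<bar>v 0 x\<bar> \<le> A + (v 0 x)\<^sup>2 / A" for x
        proof -
          have "\<bar>v 0 x\<bar> * A \<le> A\<^sup>2 + (v 0 x)\<^sup>2"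
            using zero_le_power2[of "\<bar>v 0 x\<bar> - A"] \<open>0 < A\<close> mult_nonneg_nonneg[of "\<bar>v 0 x\<bar>" A]
            unfolding power2_diff power2_abs by linarith
          then show ?thesis using \<open>0 < A\<close> by (simp add: field_simps power2_eq_square)
        qed
      qed
      also have "\<dots> = A * T + integral {0..T} (\<lambda>x. (v 0 x)\<^sup>2) / A"
        using sq0 \<open>0 < T\<close> \<open>0 < A\<close> by (subst integral_add) (auto intro!: integrable_on_divide)
      also have "\<dots> \<le> A * T + A\<^sup>2 / A"
        using B[of 0] \<open>0 < A\<close> by (intro add_left_mono divide_right_mono) (auto simp: A_def)
      also have "\<dots> = (T + 1) * A" using \<open>0 < A\<close> by (simp add: power2_eq_square algebra_simps)
      finally show ?thesis .
    qed
    have "sobolev_seminorm T q 0 e = Lq_norm {0..T} q (\<lambda>t. integral {0..t} (v 0))"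
      unfolding sobolev_seminorm_def Dn.simps by (rule Lq_norm_cong) (rule e)
    also have "\<dots> \<le> ennreal ((T + 1) * A * T powr recip q)"
    proof (rule Lq_norm_le_sup[OF \<open>0 < T\<close> _ \<open>1 \<le> q\<close>])
      show "continuous_on {0..T} (\<lambda>t. integral {0..t} (v 0))"
        by (rule indefinite_integral_continuous_1) (rule integrable_continuous_real[OF c0])
      show "\<bar>integral {0..t} (v 0)\<bar> \<le> (T + 1) * A" if t: "t \<in> {0..T}" for t
      proof -
        have int: "v 0 integrable_on {0..t}" "(\<lambda>x. \<bar>v 0 x\<bar>) integrable_on {0..t}"
          using t by (intro integrable_continuous_real continuous_intros continuous_on_subset[OF c0]; auto)+
        have "norm (integral {0..t} (v 0)) \<le> integral {0..t} (\<lambda>x. \<bar>v 0 x\<bar>)"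
          by (rule integral_norm_bound_integral[OF int]) simp
        also have "\<dots> \<le> integral {0..T} (\<lambda>x. \<bar>v 0 x\<bar>)"
          using t by (intro integral_subset_le int integrable_continuous_real continuous_intros c0) auto
        finally show ?thesis using int_abs by simp
      qed
    qed (use \<open>0 < T\<close> \<open>0 < A\<close> in auto)
    also have "(T + 1) * A * T powr recip q = \<delta> ^ Suc n * T powr recip q * c"
      unfolding A_def \<kappa>(2) c_def \<kappa>_def by (simp add: power_mult_distrib algebra_simps)
    finally show ?thesis by (simp only: \<delta>_def)
  qed
qed

section \<open>The exact solution as a feasible function\<close>

lemma Ck_solution_in_Yspace:
  fixes y :: "real \<Rightarrow> real ^ 'd"
  assumes "0 < T" "\<nu> \<le> \<alpha>" "{0..T} \<subseteq> J" "Ck_on (\<alpha> + 1) J y"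
  shows "y \<in> Yspace T \<nu>"
proof -
  have "Ck_on (\<alpha> + 1) {0..T} y" by (rule Ck_on_subset[OF assms(4,3)])
  then have "Ck_on (Suc \<nu>) {0..T} y" by (rule Ck_on_le) (use assms(2) in simp)
  then show ?thesis by (rule Ck_on_imp_Yspace[OF assms(1)])
qed

lemma ivp_solution_Zop:
  fixes y :: "real \<Rightarrow> real ^ 'd"
  assumes "0 < T" "{0..T} \<subseteq> J" "ivp_solution J f y0 y" "t \<in> {0..T}"
  shows "Dn {0..T} 1 y t = f t (y t)"
proof -
  have "(y has_vector_derivative f t (y t)) (at t within J)"
    using assms by (auto simp: ivp_solution_def)
  then have "(Dn {0..T} 0 y has_vector_derivative f t (y t)) (at t within {0..T})"
    using assms(2) by (auto intro: has_vector_derivative_within_subset)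
  from Dn_Suc_eqI[OF assms(1,4) this] show ?thesis by simp
qed

lemma ivp_solution_feasible:
  fixes y :: "real \<Rightarrow> real ^ 'd"
  assumes "0 < T" "{0..T} \<subseteq> J" "ivp_solution J f y0 y" "y \<in> Yspace T \<nu>" "is_mesh T N s"
  shows "y \<in> feasible T \<nu> f y0 N s"
proof -
  note Z = ivp_solution_Zop[OF assms(1-3)]
  have "y 0 = y0" using assms(3) by (simp add: ivp_solution_def)
  moreover have "s ` {..N} \<subseteq> {0..T}" using mesh_in_range[OF assms(5)] by auto
  ultimately show ?thesis
    using Z[of 0] Z \<open>0 < T\<close> assms(4) by (auto simp: feasible_def Zop_def simp del: One_nat_def)
qed

text \<open>Coordinates may be taken under the integral because the vector-valued residual is
  continuous; \<nu> \<ge> 1 makes Dy continuous.\<close>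

lemma Eop_component:
  fixes y :: "real \<Rightarrow> real ^ 'd"
  assumes "1 \<le> \<nu>" "y \<in> Yspace T \<nu>" "continuous_on ({0..T} \<times> UNIV) (\<lambda>(t, x). f t x)" "t \<in> {0..T}"
  shows "Eop T f y t $ i = integral {0..t} (\<lambda>t. Dn {0..T} 1 y t $ i - f t (y t) $ i)"
proof -
  have "continuous_on {0..T} (\<lambda>t. (t, y t))"
    using Yspace_continuous_on[OF assms(2), of 0] by (intro continuous_intros) simp
  then have "continuous_on {0..T} (\<lambda>t. (\<lambda>(t, x). f t x) (t, y t))"
    by (rule continuous_on_compose2[OF assms(3)]) auto
  then have "continuous_on {0..T} (Zop T f y)"
    unfolding Zop_def[abs_def] using assms(1)
    by (intro continuous_intros Yspace_continuous_on[OF assms(2)]) auto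
  then have "continuous_on {0..t} (Zop T f y)"
    by (rule continuous_on_subset) (use assms(4) in auto)
  then have "Zop T f y integrable_on {0..t}" by (rule integrable_continuous_real)
  then have "Eop T f y t $ i = integral {0..t} (\<lambda>t. Zop T f y t $ i)"
    unfolding Eop_def by (rule integral_component_eq_cart[symmetric])
  then show ?thesis by (simp add: Zop_def)
qed

section \<open>The degenerate case of norm zero\<close>

lemma Yspace_normY_zero:
  fixes \<Sigma> :: "nat \<times> 'd::finite \<Rightarrow> nat \<times> 'd \<Rightarrow> real"
  assumes "0 < T" "pos_def_on (stack_index \<nu>) \<Sigma>" "pos_def \<Gamma>"
    and "y \<in> Yspace T \<nu>" "normY T \<nu> \<Sigma> F \<Gamma> y = 0" "m \<le> \<nu>" "t \<in> {0..T}"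
  shows "Dn {0..T} m y t = 0"
proof -
  obtain C where "\<And>y m t. y \<in> Yspace T \<nu> \<Longrightarrow> m \<le> \<nu> \<Longrightarrow> t \<in> {0..T} \<Longrightarrow>
      norm (Dn {0..T} m y t) \<le> C * normY T \<nu> \<Sigma> F \<Gamma> y"
    using Yspace_embedding[OF assms(1-3), of F] by metis
  from this[OF assms(4,6,7)] assms(5) show ?thesis by simp
qed

lemma seminorm_of_zero_integral:
  assumes "0 < T" "1 \<le> q" and e: "\<And>t. t \<in> {0..T} \<Longrightarrow> e t = integral {0..t} u"
    and u: "\<And>t. t \<in> {0..T} \<Longrightarrow> u t = 0"
  shows "sobolev_seminorm T q m e \<le> 0"
proof -
  have e0: "e t = 0" if t: "t \<in> {0..T}" for t
  proof -
    have "integral {0..t} u = integral {0..t} (\<lambda>_. 0)"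
      using t by (intro integral_cong u) auto
    then show ?thesis using e[OF t] by simp
  qed
  have "Dn {0..T} m e t = 0" if "t \<in> {0..T}" for t
  proof (cases m)
    case (Suc k)
    show ?thesis
      unfolding Suc
      by (rule Dn_integral[OF \<open>0 < T\<close>, of e "\<lambda>_ _. 0" k]) (use that e0 in auto)
  qed (use that e0 in simp)
  then have "sobolev_seminorm T q m e = Lq_norm {0..T} q (\<lambda>_. 0)"
    unfolding sobolev_seminorm_def by (rule Lq_norm_cong)
  also have "\<dots> \<le> ennreal (0 * T powr recip q)"
    using assms(1,2) by (intro Lq_norm_le_sup) auto
  finally show ?thesis by simp
qed

theorem theorem3:
  fixes T :: real and \<nu> :: nat
    and \<Sigma> :: "nat \<times> 'd::finite \<Rightarrow> nat \<times> 'd \<Rightarrow> real"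
    and F :: "nat \<Rightarrow> real ^ 'd ^ 'd" and \<Gamma> :: "real ^ 'd ^ 'd"
  assumes "0 < T" and "1 \<le> \<nu>"
    and "pos_def_on (stack_index \<nu>) \<Sigma>" and "pos_def \<Gamma>"
  shows "\<exists>(\<delta>\<^sub>0 :: real) (r :: (real \<Rightarrow> real ^ 'd) \<Rightarrow> real)
      (c\<^sub>4 :: (real \<Rightarrow> real ^ 'd) \<Rightarrow> (real \<Rightarrow> real ^ 'd \<Rightarrow> real) \<Rightarrow> real \<Rightarrow> real).
    0 < \<delta>\<^sub>0 \<and> (\<forall>\<rho>. 0 < r \<rho>) \<and> (\<forall>y g R. 0 < c\<^sub>4 y g R) \<and>
    (\<forall>(f :: real \<Rightarrow> real ^ 'd \<Rightarrow> real ^ 'd) y\<^sub>0 \<alpha> TT (Tstar :: ereal) ystar \<rho> q i N s yhat.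
      \<nu> \<le> \<alpha> \<and> {0..T} \<subseteq> TT \<and> Ck_on (\<alpha> + 1) (TT \<times> UNIV) (\<lambda>(t, x). f t x) \<and>
      0 < Tstar \<and> ereal T < Tstar \<and>
      unique_Ck_solution (\<alpha> + 1) {t. 0 \<le> t \<and> ereal t < Tstar} f y\<^sub>0 ystar \<and>
      \<rho> \<in> Yspace T \<nu> \<and> normY T \<nu> \<Sigma> F \<Gamma> \<rho> > normY T \<nu> \<Sigma> F \<Gamma> ystar \<and>
      1 \<le> q \<and>
      is_mesh T N s \<and> fill_distance T N s < \<delta>\<^sub>0 \<and>
      is_arg_min (\<lambda>y. 1 / 2 * (normY T \<nu> \<Sigma> F \<Gamma> y)\<^sup>2) (\<lambda>y. y \<in> feasible T \<nu> f y\<^sub>0 N s) yhat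
      \<longrightarrow>
      (let \<delta> = fill_distance T N s;
           c = c\<^sub>4 ystar (\<lambda>t x. f t x $ i) (r \<rho>);
           e = (\<lambda>t. Eop T f yhat t $ i)
       in sobolev_seminorm T q 0 e
            \<le> ennreal (\<delta> ^ \<nu> * T powr recip q * c * normY T \<nu> \<Sigma> F \<Gamma> ystar) \<and>
          (\<forall>m\<in>{1..\<nu>}. sobolev_seminorm T q m e
            \<le> ennreal (\<delta> powr (real \<nu> + 1 - real m - max (1 / 2 - recip q) 0) * c
                        * normY T \<nu> \<Sigma> F \<Gamma> ystar))))"
proof -
  define n where "n = \<nu> - 1"
  have \<nu>: "\<nu> = Suc n" using \<open>1 \<le> \<nu>\<close> by (simp add: n_def)
  \<comment> \<open>Below this value, 2 * 3^n * \<delta> \<le> T, so a window with zeros of all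
    derivatives up to order n fits into \<open>{0..T}\<close>.\<close>
  define \<delta>0 where "\<delta>0 = T / (2 * 3 ^ n)"
  have "0 < \<delta>0" using \<open>0 < T\<close> by (simp add: \<delta>0_def)
  let ?norm = "normY T \<nu> \<Sigma> F \<Gamma>"
  let ?bounds = "\<lambda>c q N s e K. sobolev_seminorm T q 0 e
        \<le> ennreal (fill_distance T N s ^ \<nu> * T powr recip q * c * K) \<and>
      (\<forall>m\<in>{1..\<nu>}. sobolev_seminorm T q m e
        \<le> ennreal (fill_distance T N s powr (real \<nu> + 1 - real m - max (1 / 2 - recip q) 0) * c * K))"
  let ?J = "\<lambda>Tstar. {t. 0 \<le> t \<and> ereal t < Tstar}"
  let ?hyps = "\<lambda>f y\<^sub>0 \<alpha> TT Tstar ystar q N s yhat. \<nu> \<le> \<alpha> \<and> {0..T} \<subseteq> TT \<and>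
      Ck_on (\<alpha> + 1) (TT \<times> UNIV) (\<lambda>(t, x). f t x) \<and> ereal T < Tstar \<and>
      unique_Ck_solution (\<alpha> + 1) (?J Tstar) f y\<^sub>0 ystar \<and> 1 \<le> q \<and>
      is_mesh T N s \<and> fill_distance T N s < \<delta>0 \<and>
      is_arg_min (\<lambda>y. 1 / 2 * (?norm y)\<^sup>2) (\<lambda>y. y \<in> feasible T \<nu> f y\<^sub>0 N s) yhat"
  \<comment> \<open>\<open>c\<^sub>4\<close> knows f only through its i-th coordinate g. So one
    constant must serve all problems with the solution \<open>ystar\<close> in which some coordinate
    of the vector field equals g, and P gathers exactly these.\<close>
  define P where "P ystar g c \<longleftrightarrow> (\<forall>f y\<^sub>0 \<alpha> TT Tstar q i N s yhat.
      ?hyps f y\<^sub>0 \<alpha> TT Tstar ystar q N s yhat \<and> g = (\<lambda>t x. f t x $ i) \<longrightarrow>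
      ?bounds c q N s (\<lambda>t. Eop T f yhat t $ i) (?norm ystar))"
    for ystar and g :: "real \<Rightarrow> real ^ 'd \<Rightarrow> real" and c
  have "\<exists>c>0. P ystar g c" for ystar g
  proof -
    define K where "K = ?norm ystar"
    have hyps: "Ck_on \<nu> ({0..T} \<times> UNIV) (\<lambda>(t, x). g t x) \<and>
        continuous_on ({0..T} \<times> UNIV) (\<lambda>(t, x). f t x) \<and> 0 \<le> K \<and> yhat \<in> Yspace T \<nu> \<and>
        ystar \<in> Yspace T \<nu> \<and> ?norm yhat \<le> K \<and> (\<forall>z\<in>s ` {..N}. Zop T f yhat z = 0) \<and>
        (\<forall>t\<in>{0..T}. Dn {0..T} 1 ystar t = f t (ystar t))"
      if H: "?hyps f y\<^sub>0 \<alpha> TT Tstar ystar q N s yhat" and g: "g = (\<lambda>t x. f t x $ i)"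
      for f y\<^sub>0 \<alpha> TT Tstar q i N s yhat
    proof -
      have J: "{0..T} \<subseteq> ?J Tstar" using H by (auto intro: le_less_trans[of _ "ereal T"])
      have sol: "ivp_solution (?J Tstar) f y\<^sub>0 ystar" and ck: "Ck_on (\<alpha> + 1) (?J Tstar) ystar"
        using H by (auto simp: unique_Ck_solution_def)
      have ystar: "ystar \<in> Yspace T \<nu>"
        using Ck_solution_in_Yspace[OF \<open>0 < T\<close> _ J ck] H by blast
      have "Ck_on (\<alpha> + 1) ({0..T} \<times> UNIV) (\<lambda>(t, x). f t x)"
        by (rule Ck_on_subset[of _ "TT \<times> UNIV"]) (use H in auto)
      then have f: "Ck_on \<nu> ({0..T} \<times> UNIV) (\<lambda>(t, x). f t x)"
        by (rule Ck_on_le) (use H in auto)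
      have "ystar \<in> feasible T \<nu> f y\<^sub>0 N s"
        using H by (intro ivp_solution_feasible[OF \<open>0 < T\<close> J sol ystar]) blast
      then have "\<not> 1 / 2 * (?norm ystar)\<^sup>2 < 1 / 2 * (?norm yhat)\<^sup>2" and yhat: "yhat \<in> feasible T \<nu> f y\<^sub>0 N s"
        using H by (auto simp: is_arg_min_def)
      then have "(?norm yhat)\<^sup>2 \<le> K\<^sup>2" by (simp add: K_def)
      moreover have "0 \<le> K" unfolding K_def by (rule normY_bounds(2)[OF assms(3) ystar])
      ultimately have "?norm yhat \<le> K" by (rule power2_le_imp_le)
      moreover have "Ck_on \<nu> ({0..T} \<times> UNIV) (\<lambda>(t, x). g t x)"
        using Ck_on_bounded_linear[OF bounded_linear_vec_nth f, of i] by (simp add: g case_prod_unfold)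
      ultimately show ?thesis
        using yhat ystar \<open>0 \<le> K\<close> Ck_on_imp_continuous[OF f] ivp_solution_Zop[OF \<open>0 < T\<close> J sol]
        by (auto simp: feasible_def simp del: One_nat_def)
    qed
    show ?thesis
    proof (cases "Ck_on \<nu> ({0..T} \<times> UNIV) (\<lambda>(t, x). g t x) \<and> 0 < K")
      case True
      have "0 \<le> K" using True by simp
      from Yspace_residual_bound[OF assms conjunct1[OF True] this, of F]
      obtain M where M: "0 < M" "\<forall>y\<in>Yspace T \<nu>. \<forall>i. ?norm y \<le> K \<longrightarrow>
          (\<exists>v \<phi>. v 0 = (\<lambda>t. Dn {0..T} 1 y t $ i - g t (y t)) \<and> sobolev_derivatives T (\<nu> - 1) M v \<phi>)"
        by blast
      \<comment> \<open>The constant of the seminorm estimates for residuals bounded by M. As the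
        claim carries the factor K, the constant returned is c / K.\<close>
      define c where "c = (T + 1) * (4 * 3 ^ n) ^ Suc n * M"
      have "0 < c" using \<open>0 < T\<close> M(1) by (simp add: c_def)
      have "?bounds (c / K) q N s (\<lambda>t. Eop T f yhat t $ i) K"
        if H: "?hyps f y\<^sub>0 \<alpha> TT Tstar ystar q N s yhat" and g: "g = (\<lambda>t x. f t x $ i)"
        for f y\<^sub>0 \<alpha> TT Tstar q i N s yhat
      proof -
        note h = hyps[OF H g]
        obtain v \<phi> where v0: "v 0 = (\<lambda>t. Dn {0..T} 1 yhat t $ i - g t (yhat t))"
          and sob: "sobolev_derivatives T n M v \<phi>"
          using M(2) h unfolding n_def by blast
        have mesh: "is_mesh T N s" and "1 \<le> q" using H by blast+
        have \<delta>: "2 * 3 ^ n * fill_distance T N s \<le> T"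
          using H by (simp add: \<delta>0_def field_simps)
        have vanish: "v 0 z = 0" if "z \<in> s ` {..N}" for z
        proof -
          have "Zop T f yhat z = 0" using h that by blast
          then have "Zop T f yhat z $ i = 0" by simp
          then show ?thesis by (simp add: v0 g Zop_def)
        qed
        have e: "Eop T f yhat t $ i = integral {0..t} (v 0)" if "t \<in> {0..T}" for t
          unfolding v0 g using h by (intro Eop_component[OF \<open>1 \<le> \<nu>\<close> _ _ that]) auto
        note B = mesh_vanishing_seminorms[OF \<open>0 < T\<close> mesh \<delta> vanish sob M(1) e \<open>1 \<le> q\<close>,
            folded c_def \<nu>]
        have eq: "x * (c / K) * K = x * c" for x using True by simp
        show ?thesis unfolding eq using B by blast
      qed
      moreover have "0 < c / K" using \<open>0 < c\<close> True by simp
      ultimately show ?thesis unfolding K_def P_def by blast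
    next
      case False
      \<comment> \<open>A problem that meets the hypotheses has g of class C^\<nu> and K \<ge> 0, so
        in this case it has K = 0; if there is no such problem, the claim is vacuous. The right-hand
        sides are 0 here, so any positive constant will do, such as 1.\<close>
      have "?bounds 1 q N s (\<lambda>t. Eop T f yhat t $ i) K"
        if H: "?hyps f y\<^sub>0 \<alpha> TT Tstar ystar q N s yhat" and g: "g = (\<lambda>t x. f t x $ i)"
        for f y\<^sub>0 \<alpha> TT Tstar q i N s yhat
      proof -
        note h = hyps[OF H g]
        have "K = 0" using False h by linarith
        then have "?norm yhat = 0" using h normY_bounds(2)[OF assms(3), of yhat T F \<Gamma>] by force
        note zero = Yspace_normY_zero[OF assms(1,3,4)]
        have yhat: "Dn {0..T} m yhat t = 0" if "m \<le> \<nu>" "t \<in> {0..T}" for m t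
          using zero[OF _ \<open>?norm yhat = 0\<close> that] h by blast
        have ystar: "Dn {0..T} m ystar t = 0" if "m \<le> \<nu>" "t \<in> {0..T}" for m t
          using zero[of ystar, OF _ _ that] h \<open>K = 0\<close> by (simp add: K_def)
        \<comment> \<open>Both functions vanish on \<open>{0..T}\<close>, so f(t, yhat(t)) = f(t,
          ystar(t)), which is the derivative of \<open>ystar\<close> and hence 0.\<close>
        have res: "Dn {0..T} 1 yhat t $ i - f t (yhat t) $ i = 0" if "t \<in> {0..T}" for t
          using h that yhat[of 0 t] ystar[of 0 t] yhat[of 1 t] ystar[of 1 t] \<open>1 \<le> \<nu>\<close>
          by (simp del: One_nat_def)
        have e: "Eop T f yhat t $ i = integral {0..t} (\<lambda>t. Dn {0..T} 1 yhat t $ i - f t (yhat t) $ i)"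
          if "t \<in> {0..T}" for t
          using h by (intro Eop_component[OF \<open>1 \<le> \<nu>\<close> _ _ that]) auto
        have "1 \<le> q" using H by blast
        from seminorm_of_zero_integral[OF \<open>0 < T\<close> this e res] \<open>K = 0\<close>
        show ?thesis by simp
      qed
      then show ?thesis unfolding K_def P_def using zero_less_one by blast
    qed
  qed
  then have "\<forall>ystar g. \<exists>c. 0 < c \<and> P ystar g c" by blast
  then obtain c where c0: "\<And>ystar g. 0 < c ystar g" and cP: "\<And>ystar g. P ystar g (c ystar g)"
    by metis
  have c: "?bounds (c ystar (\<lambda>t x. f t x $ i)) q N s (\<lambda>t. Eop T f yhat t $ i) (?norm ystar)"
    if "?hyps f y\<^sub>0 \<alpha> TT Tstar ystar q N s yhat" for f y\<^sub>0 \<alpha> TT Tstar q i N s yhat ystar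
    using cP[of ystar "\<lambda>t x. f t x $ i"] that unfolding P_def by blast
  \<comment> \<open>The interpolant is confined to the ball of radius \<open>?norm ystar\<close>,
    which the first argument of \<open>c\<^sub>4\<close> determines; the value 1 is taken for
    \<open>r\<close>.\<close>
  show ?thesis
    unfolding Let_def
    by (rule exI[of _ \<delta>0], rule exI[of _ "\<lambda>_. 1"], rule exI[of _ "\<lambda>y g R. c y g"])
      (use \<open>0 < \<delta>0\<close> c0 c zero_less_one in blast)
qed

end
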